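(* Consider the downlink network model described in the context (homogeneous Poisson base stations of intensity $\lambda$, $N$-piece LOS/NLOS path loss, smallest-path-loss association, Rician fading, interference-limited regime in which the noise is neglected). Set $d_0=0$ and $d_N=\infty$. Then the coverage probability $p^{\mathrm{cov}}(\lambda,\gamma)=\Pr[\mathrm{SINR}>\gamma]$ of the typical UE at threshold $\gamma$ is $$p^{\mathrm{cov}}(\lambda,\gamma)=\sum_{n=1}^{N}\left(T_n^{\mathrm{L}}+T_n^{\mathrm{NL}}\right),$$ where $$T_n^{\mathrm{L}}=\int_{d_{n-1}}^{d_n}\Pr\left[\frac{P\zeta_n^{\mathrm{L}}(r)h}{I_r}>\gamma\right]f_{R,n}^{\mathrm{L}}(r)\,dr,\qquad T_n^{\mathrm{NL}}=\int_{d_{n-1}}^{d_n}\Pr\left[\frac{P\zeta_n^{\mathrm{NL}}(r)h}{I_r}>\gamma\right]f_{R,n}^{\mathrm{NL}}(r)\,dr,$$ and, for $d_{n-1}<r\le d_n$, $$f_{R,n}^{\mathrm{L}}(r)=\exp\left(-\int_0^{r_1}\left(1-\mathrm{Pr}^{\mathrm{L}}(u)\right)2\pi u\lambda\,du\right)\exp\left(-\int_0^{r}\mathrm{Pr}^{\mathrm{L}}(u)2\pi u\lambda\,du\right)\mathrm{Pr}_n^{\mathrm{L}}(r)\,2\pi r\lambda,$$ $$f_{R,n}^{\mathrm{NL}}(r)=\exp\left(-\int_0^{r_2}\mathrm{Pr}^{\mathrm{L}}(u)2\pi u\lambda\,du\right)\exp\left(-\int_0^{r}\left(1-\mathrm{Pr}^{\mathrm{L}}(u)\right)2\pi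 u\lambda\,du\right)\left(1-\mathrm{Pr}_n^{\mathrm{L}}(r)\right)2\pi r\lambda,$$ with $r_1$ and $r_2$ (depending on $r$) determined as $r_1=\arg_{r_1}\{\zeta^{\mathrm{NL}}(r_1)=\zeta_n^{\mathrm{L}}(r)\}$ and $r_2=\arg_{r_2}\{\zeta^{\mathrm{L}}(r_2)=\zeta_n^{\mathrm{NL}}(r)\}$, respectively. Furthermore, the probabilities in the integrands are $$\Pr\left[\frac{P\zeta_n^{\mathrm{L}}(r)h}{I_r}>\gamma\right]=\sum_{k=0}^{\infty}\sum_{m=0}^{k}J(m,k)\,\gamma^{k-m}(-1)^{k-m}\,\frac{\partial^{k-m}}{\partial\gamma^{k-m}}\left[\mathscr{L}_{I_r}\left(\frac{\gamma}{P\zeta_n^{\mathrm{L}}(r)}\right)\right],$$ $$\Pr\left[\frac{P\zeta_n^{\mathrm{NL}}(r)h}{I_r}>\gamma\right]=\sum_{k=0}^{\infty}\sum_{m=0}^{k}J(m,k)\,\gamma^{k-m}(-1)^{k-m}\,\frac{\partial^{k-m}}{\partial\gamma^{k-m}}\left[\mathscr{L}_{I_r}\left(\frac{\gamma}{P\zeta_n^{\mathrm{NL}}(r)}\right)\right],$$ where $\mathscr{L}_{I_r}(s)$ is the Laplace transform of the random variable $I_r$ evaluated at $s$, and $J(m,k)=\dfrac{e^{-K}K^{k}\,m!\binom{k}{m}}{(k!)^2}$ with $K$ the Rician factor.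
   Context: **Base stations and users.** Base stations (BSs) form a homogeneous Poisson point process $\Phi$ in the plane of intensity $\lambda$ (BSs per km$^2$). User equipments (UEs) form another, independent, homogeneous Poisson point process whose intensity is sufficiently larger than $\lambda$ that each BS has at least one associated UE. The typical UE is at the origin. Each BS transmits with power $P$; all antennas are isotropic. Distances $r$ are in km. **Path loss.** Fix breakpoints $0=d_0<d_1<\dots<d_{N-1}<d_N=\infty$. A BS at distance $r$ from the UE has a line-of-sight (LOS) path with probability $\mathrm{Pr}^{\mathrm{L}}(r)$ and a non-line-of-sight (NLOS) path with probability $1-\mathrm{Pr}^{\mathrm{L}}(r)$, independently over BSs; $\mathrm{Pr}_n^{\mathrm{L}}$ denotes the $n$-th piece of the LOS probability function $\mathrm{Pr}^{\mathrm{L}}$, i.e. its restriction to $d_{n-1}<r\le d_n$. For $d_{n-1}<r\le d_n$, the path loss (a power gain factor) is $\zeta(r)=\zeta_n^{\mathrm{L}}(r)=A_n^{\mathrm{L}}r^{-\alpha_n^{\mathrm{L}}}$ if LOS, and $\zeta(r)=\zeta_n^{\mathrm{NL}}(r)=A_n^{\mathrm{NL}}r^{-\alpha_n^{\mathrm{NL}}}$ if NLOS, where $A_n^{\mathrm{L}},A_n^{\mathrm{NL}}$ are the path losses at the reference distance $1$ km and $\alpha_n^{\mathrm{L}},\alpha_n^{\mathrm{NL}}$ are the path loss exponents. For $s\in\{\mathrm{L},\mathrm{NL}\}$, $\zeta^{s}$ denotes the piecewise function equal to $\zeta_n^{s}(r)$ for $d_{n-1}<r\le d_n$, $n=1,\dots,N$.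 **Association.** The UE is served by the BS $b_o$ with the smallest path loss, i.e. the largest value of $\zeta$, regardless of whether it is LOS or NLOS. **Fading.** The channel gains of the links are independent Rician fading gains. The gain of a link with Rician factor $K$ (linear scale) has density $f(x)=e^{-K-x}\sum_{k=0}^{\infty}\frac{(Kx)^k}{(k!)^2}$, $x>0$. For a LOS link of length $\rho$ meters, $K$ is $13-0.03\rho$ in dB; for a NLOS link, $K$ is $0$ dB. The serving link's gain is denoted $h$ and the gain of the link from interfering BS $b_i$ is denoted $g_i$. **SINR.** The analysis is in the interference-limited regime, where noise is neglected: $\mathrm{SINR}=\frac{P\zeta(r)h}{I_r}$, where $r$ is the distance to the serving BS, $\zeta(r)$ the serving link's path loss, and $I_r=\sum_{i:\,b_i\in\Phi\setminus b_o}P\beta_i g_i$ is the aggregate interference, with $\beta_i$ the path loss of $b_i$. **Conditioning convention.** In $\Pr\left[\frac{P\zeta_n^{\mathrm{L}}(r)h}{I_r}>\gamma\right]$ and in the accompanying Laplace transform $\mathscr{L}_{I_r}(s)=\mathbb{E}[e^{-sI_r}]$, the law is conditional on the UE being served by a LOS BS at distance $r$; in the NLOS counterparts it is conditional on the UE being served by a NLOS BS at distance $r$. Correspondingly $K$ in $J(m,k)$ is the Rician factor of the serving link.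
   Formalization: Added assumptions: ζ^L and ζ^NL are strictly decreasing on (0,∞) (no upward jump at a breakpoint), and the equations defining r_1 and r_2 have a solution for every r>0; without them the density formula can fail or r_1, r_2 be undefined. *)

theory Defs
  imports "HOL-Probability.Probability"
begin

definition poisson_point_process :: "'w measure \<Rightarrow> 'b measure \<Rightarrow> ('w \<Rightarrow> 'b set) \<Rightarrow> bool" where
  "poisson_point_process M \<mu> \<Phi> \<longleftrightarrow> prob_space M \<and>
     (\<forall>B\<in>sets \<mu>. emeasure \<mu> B < \<infinity> \<longrightarrow>
        (AE \<omega> in M. finite (\<Phi> \<omega> \<inter> B)) \<and>
        (\<lambda>\<omega>. card (\<Phi> \<omega> \<inter> B)) \<in> M \<rightarrow>\<^sub>M count_space UNIV \<and>
        (\<forall>k. measure M {\<omega>\<in>space M. card (\<Phi> \<omega> \<inter> B) = k} =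
             measure \<mu> B ^ k / fact k * exp (- measure \<mu> B))) \<and>
     (\<forall>n::nat. \<forall>B. disjoint_family_on B {..<n} \<and>
        (\<forall>i<n. B i \<in> sets \<mu> \<and> emeasure \<mu> (B i) < \<infinity>) \<longrightarrow>
        prob_space.indep_vars M (\<lambda>_. count_space UNIV) (\<lambda>i \<omega>. card (\<Phi> \<omega> \<inter> B i)) {..<n})"

definition rician_density :: "real \<Rightarrow> real \<Rightarrow> real" where
  "rician_density K x =
     (if 0 < x then exp (- K - x) * (\<Sum>k. (K * x) ^ k / (fact k)\<^sup>2) else 0)"

definition rician :: "real \<Rightarrow> real measure" where
  "rician K = density lborel (\<lambda>x. ennreal (rician_density K x))"

text \<open>
  A regular conditional distribution of \<open>Y\<close> (with values in \<open>L\<close>), restricted to the event \<open>E\<close>,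
  given the real random variable \<open>Z\<close>: \<open>\<kappa> z\<close> is the law of \<open>Y\<close> conditional on \<open>E\<close> and \<open>Z = z\<close>.
  It is determined up to a null set of \<open>z\<close> for the law of \<open>Z\<close> on \<open>E\<close>, and exists whenever \<open>L\<close> is
  standard Borel and \<open>M\<close> is a probability space.
\<close>

definition regular_cond_law ::
    "'w measure \<Rightarrow> ('w \<Rightarrow> bool) \<Rightarrow> ('w \<Rightarrow> real) \<Rightarrow> ('w \<Rightarrow> 'b) \<Rightarrow> 'b measure \<Rightarrow> (real \<Rightarrow> 'b measure) \<Rightarrow> bool"
  where
  "regular_cond_law M E Z Y L \<kappa> \<longleftrightarrow>
     \<kappa> \<in> borel \<rightarrow>\<^sub>M prob_algebra L \<and>
     (\<forall>B\<in>sets borel. \<forall>C\<in>sets L.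
        emeasure M {\<omega>\<in>space M. E \<omega> \<and> Z \<omega> \<in> B \<and> Y \<omega> \<in> C} =
        (\<integral>\<^sup>+\<omega>\<in>{\<omega>\<in>space M. E \<omega> \<and> Z \<omega> \<in> B}. emeasure (\<kappa> (Z \<omega>)) C \<partial>M))"

datatype link = LOS | NLOS

fun other :: "link \<Rightarrow> link" where
  "other LOS = NLOS"
| "other NLOS = LOS"

definition from_dB :: "real \<Rightarrow> real" where
  "from_dB x = 10 powr (x / 10)"

text \<open>Distances are in km, whereas the LOS Rician factor is specified per metre.\<close>

fun rician_factor :: "link \<Rightarrow> real \<Rightarrow> real" where
  "rician_factor LOS r = from_dB (13 - 0.03 * (1000 * r))"
| "rician_factor NLOS r = from_dB 0"

record network =
  pieces :: nat
  breakpoint :: "nat \<Rightarrow> ereal"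
  los_piece :: "nat \<Rightarrow> real \<Rightarrow> real"
  ref_loss :: "link \<Rightarrow> nat \<Rightarrow> real"
  loss_exponent :: "link \<Rightarrow> nat \<Rightarrow> real"
  tx_power :: real
  intensity :: real

definition on_piece :: "network \<Rightarrow> nat \<Rightarrow> real \<Rightarrow> bool" where
  "on_piece V n r \<longleftrightarrow> breakpoint V (n - 1) < ereal r \<and> ereal r \<le> breakpoint V n"

text \<open>At most one summand is nonzero; at \<open>r \<le> 0\<close>, outside all pieces, the value is \<open>0\<close>.\<close>

definition piecewise :: "network \<Rightarrow> (nat \<Rightarrow> real \<Rightarrow> real) \<Rightarrow> real \<Rightarrow> real" where
  "piecewise V f r = (\<Sum>n=1..pieces V. if on_piece V n r then f n r else 0)"

definition zeta_piece :: "network \<Rightarrow> link \<Rightarrow> nat \<Rightarrow> real \<Rightarrow> real" where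
  "zeta_piece V s n r = ref_loss V s n * r powr (- loss_exponent V s n)"

definition zeta :: "network \<Rightarrow> link \<Rightarrow> real \<Rightarrow> real" where
  "zeta V s = piecewise V (zeta_piece V s)"

fun link_prob_piece :: "network \<Rightarrow> link \<Rightarrow> nat \<Rightarrow> real \<Rightarrow> real" where
  "link_prob_piece V LOS n r = los_piece V n r"
| "link_prob_piece V NLOS n r = 1 - los_piece V n r"

definition los_prob :: "network \<Rightarrow> real \<Rightarrow> real" where
  "los_prob V = piecewise V (los_piece V)"

fun link_prob :: "network \<Rightarrow> link \<Rightarrow> real \<Rightarrow> real" where
  "link_prob V LOS r = los_prob V r"
| "link_prob V NLOS r = 1 - los_prob V r"

text \<open>
  The last two clauses make ``smallest path loss among links of one kind'' the same as
  ``nearest'', and make the equations that determine the equivalent distances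
  \<open>r\<^sub>1\<close>, \<open>r\<^sub>2\<close> solvable; both are needed for the serving-distance densities below to be meaningful.
\<close>

definition valid_network :: "network \<Rightarrow> bool" where
  "valid_network V \<longleftrightarrow>
     1 \<le> pieces V \<and> breakpoint V 0 = 0 \<and> breakpoint V (pieces V) = \<infinity> \<and>
     (\<forall>n<pieces V. breakpoint V n < breakpoint V (Suc n)) \<and>
     los_prob V \<in> borel_measurable borel \<and> (\<forall>r>0. los_prob V r \<in> {0..1}) \<and>
     (\<forall>s. \<forall>n\<in>{1..pieces V}. 0 < ref_loss V s n \<and> 0 < loss_exponent V s n) \<and>
     0 < tx_power V \<and> 0 < intensity V \<and>
     (\<forall>s. strict_antimono_on {0<..} (zeta V s)) \<and>
     (\<forall>s. \<forall>r>0. \<exists>u>0. zeta V (other s) u = zeta V s r)"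

text \<open>
  Base station \<open>i\<close> sits at \<open>X i\<close>, its link to the origin is of kind \<open>S i\<close> and has channel gain \<open>G i\<close>.
  The last clause says that, conditionally on all locations \<open>X\<close>, the pairs \<open>(S i, G i)\<close> are
  independent over \<open>i\<close>, with \<open>S i = s\<close> having probability \<open>link_prob V s r\<close> at distance \<open>r\<close>,
  and \<open>G i\<close> being Rician with the factor belonging to \<open>s\<close> and \<open>r\<close>.
  Every base station transmits, which is what the density of users is for.
\<close>

definition downlink_model ::
    "network \<Rightarrow> 'w measure \<Rightarrow> (nat \<Rightarrow> 'w \<Rightarrow> real \<times> real) \<Rightarrow> (nat \<Rightarrow> 'w \<Rightarrow> link) \<Rightarrow> (nat \<Rightarrow> 'w \<Rightarrow> real) \<Rightarrow> bool"
  where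
  "downlink_model V M X S G \<longleftrightarrow>
     (\<forall>i. X i \<in> M \<rightarrow>\<^sub>M borel \<and> S i \<in> M \<rightarrow>\<^sub>M count_space UNIV \<and> G i \<in> M \<rightarrow>\<^sub>M borel) \<and>
     (AE \<omega> in M. inj (\<lambda>i. X i \<omega>)) \<and>
     poisson_point_process M (scale_measure (ennreal (intensity V)) lborel) (\<lambda>\<omega>. range (\<lambda>i. X i \<omega>)) \<and>
     (\<forall>(n::nat) A s B. A \<in> sets (PiM UNIV (\<lambda>_. borel)) \<and> (\<forall>i<n. B i \<in> sets borel) \<longrightarrow>
        emeasure M {\<omega>\<in>space M. (\<lambda>i. X i \<omega>) \<in> A \<and> (\<forall>i<n. S i \<omega> = s i \<and> G i \<omega> \<in> B i)} =
        (\<integral>\<^sup>+\<omega>\<in>{\<omega>\<in>space M. (\<lambda>i. X i \<omega>) \<in> A}.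
           (\<Prod>i<n. ennreal (link_prob V (s i) (norm (X i \<omega>))) *
                   emeasure (rician (rician_factor (s i) (norm (X i \<omega>)))) (B i)) \<partial>M))"

definition link_loss ::
    "network \<Rightarrow> (nat \<Rightarrow> 'w \<Rightarrow> real \<times> real) \<Rightarrow> (nat \<Rightarrow> 'w \<Rightarrow> link) \<Rightarrow> nat \<Rightarrow> 'w \<Rightarrow> real" where
  "link_loss V X S i \<omega> = zeta V (S i \<omega>) (norm (X i \<omega>))"

text \<open>Ties have probability zero; breaking them by \<open>LEAST\<close> keeps the serving index measurable.\<close>

definition serving ::
    "network \<Rightarrow> (nat \<Rightarrow> 'w \<Rightarrow> real \<times> real) \<Rightarrow> (nat \<Rightarrow> 'w \<Rightarrow> link) \<Rightarrow> 'w \<Rightarrow> nat" where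
  "serving V X S \<omega> = (LEAST i. \<forall>j. link_loss V X S j \<omega> \<le> link_loss V X S i \<omega>)"

definition serving_dist ::
    "network \<Rightarrow> (nat \<Rightarrow> 'w \<Rightarrow> real \<times> real) \<Rightarrow> (nat \<Rightarrow> 'w \<Rightarrow> link) \<Rightarrow> 'w \<Rightarrow> real" where
  "serving_dist V X S \<omega> = norm (X (serving V X S \<omega>) \<omega>)"

definition serving_link ::
    "network \<Rightarrow> (nat \<Rightarrow> 'w \<Rightarrow> real \<times> real) \<Rightarrow> (nat \<Rightarrow> 'w \<Rightarrow> link) \<Rightarrow> 'w \<Rightarrow> link" where
  "serving_link V X S \<omega> = S (serving V X S \<omega>) \<omega>"

definition serving_gain ::
    "network \<Rightarrow> (nat \<Rightarrow> 'w \<Rightarrow> real \<times> real) \<Rightarrow> (nat \<Rightarrow> 'w \<Rightarrow> link) \<Rightarrow> (nat \<Rightarrow> 'w \<Rightarrow> real) \<Rightarrow> 'w \<Rightarrow> real" where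
  "serving_gain V X S G \<omega> = G (serving V X S \<omega>) \<omega>"

text \<open>The interference may be infinite, e.g. for a last path loss exponent of at most \<open>2\<close>.\<close>

definition interference ::
    "network \<Rightarrow> (nat \<Rightarrow> 'w \<Rightarrow> real \<times> real) \<Rightarrow> (nat \<Rightarrow> 'w \<Rightarrow> link) \<Rightarrow> (nat \<Rightarrow> 'w \<Rightarrow> real) \<Rightarrow> 'w \<Rightarrow> ennreal" where
  "interference V X S G \<omega> =
     (\<Sum>i. if i = serving V X S \<omega> then 0 else ennreal (tx_power V * link_loss V X S i \<omega> * G i \<omega>))"

definition SINR ::
    "network \<Rightarrow> (nat \<Rightarrow> 'w \<Rightarrow> real \<times> real) \<Rightarrow> (nat \<Rightarrow> 'w \<Rightarrow> link) \<Rightarrow> (nat \<Rightarrow> 'w \<Rightarrow> real) \<Rightarrow> 'w \<Rightarrow> ennreal" where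
  "SINR V X S G \<omega> =
     ennreal (tx_power V * link_loss V X S (serving V X S \<omega>) \<omega> * serving_gain V X S G \<omega>) /
     interference V X S G \<omega>"

definition coverage ::
    "network \<Rightarrow> 'w measure \<Rightarrow> (nat \<Rightarrow> 'w \<Rightarrow> real \<times> real) \<Rightarrow> (nat \<Rightarrow> 'w \<Rightarrow> link) \<Rightarrow> (nat \<Rightarrow> 'w \<Rightarrow> real) \<Rightarrow> real \<Rightarrow> real"
  where
  "coverage V M X S G \<gamma> = measure M {\<omega>\<in>space M. SINR V X S G \<omega> > ennreal \<gamma>}"

text \<open>\<open>\<kappa> s r\<close> is the joint law of \<open>(h, I\<^sub>r)\<close> given that the user is served over an \<open>s\<close>-link of length \<open>r\<close>.\<close>

definition serving_cond_law ::
    "network \<Rightarrow> 'w measure \<Rightarrow> (nat \<Rightarrow> 'w \<Rightarrow> real \<times> real) \<Rightarrow> (nat \<Rightarrow> 'w \<Rightarrow> link) \<Rightarrow> (nat \<Rightarrow> 'w \<Rightarrow> real) \<Rightarrow>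
     (link \<Rightarrow> real \<Rightarrow> (real \<times> ennreal) measure) \<Rightarrow> bool" where
  "serving_cond_law V M X S G \<kappa> \<longleftrightarrow>
     (\<forall>s. regular_cond_law M (\<lambda>\<omega>. serving_link V X S \<omega> = s) (serving_dist V X S)
            (\<lambda>\<omega>. (serving_gain V X S G \<omega>, interference V X S G \<omega>)) (borel \<Otimes>\<^sub>M borel) (\<kappa> s))"

definition cond_coverage ::
    "network \<Rightarrow> (link \<Rightarrow> real \<Rightarrow> (real \<times> ennreal) measure) \<Rightarrow> real \<Rightarrow> link \<Rightarrow> nat \<Rightarrow> real \<Rightarrow> real" where
  "cond_coverage V \<kappa> \<gamma> s n r =
     measure (\<kappa> s r) {(h, y). ennreal (tx_power V * zeta_piece V s n r * h) / y > ennreal \<gamma>}"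

text \<open>Meant for \<open>t > 0\<close>, where \<open>exp (- t * \<infinity>) = 0\<close>.\<close>

definition laplace_interference :: "(real \<times> ennreal) measure \<Rightarrow> real \<Rightarrow> real" where
  "laplace_interference \<mu> t =
     (\<integral>p. (if snd p = \<infinity> then 0 else exp (- t * enn2real (snd p))) \<partial>\<mu>)"

text \<open>For \<open>s = LOS\<close> this is \<open>r\<^sub>1\<close>, for \<open>s = NLOS\<close> it is \<open>r\<^sub>2\<close>.\<close>

definition equiv_dist :: "network \<Rightarrow> link \<Rightarrow> nat \<Rightarrow> real \<Rightarrow> real" where
  "equiv_dist V s n r = (THE u. 0 < u \<and> zeta V (other s) u = zeta_piece V s n r)"

definition serving_density :: "network \<Rightarrow> link \<Rightarrow> nat \<Rightarrow> real \<Rightarrow> real" where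
  "serving_density V s n r =
     exp (- (LBINT u=0..ereal (equiv_dist V s n r). link_prob V (other s) u * (2 * pi * u * intensity V))) *
     exp (- (LBINT u=0..ereal r. link_prob V s u * (2 * pi * u * intensity V))) *
     link_prob_piece V s n r * (2 * pi * r * intensity V)"

definition J :: "real \<Rightarrow> nat \<Rightarrow> nat \<Rightarrow> real" where
  "J K m k = exp (- K) * K ^ k * fact m * real (k choose m) / (fact k)\<^sup>2"

end

theory Submission
  imports Defs
begin

text \<open>
  Thinning the base stations by link type, the generating functional of the Poisson process gives the
  probability that there is no LOS station within distance \<open>a\<close> and no NLOS station within distance
  \<open>b\<close>. The serving station is the nearest of its own type, so the event that it is of type \<open>s\<close> with
  distance in \<open>(a, b]\<close> lies between two differences of such void events; refining partitions yields
  the density of the serving distance. Neither the serving index nor the interference depends on the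
  serving gain, so given the serving link and distance the gain is Rician and independent of the
  interference \<open>I\<close>. For an integer shape the gamma tail is a Poisson sum; hence \<open>Pr[h > x I]\<close> is a
  mixture of the terms \<open>E[(x I)^j exp (- x I)]\<close>, which are derivatives of the Laplace transform of \<open>I\<close>.
\<close>

section \<open>Rician gains and derivatives of Laplace transforms\<close>

text \<open>The Rician density is a Poisson mixture, with mean \<open>K\<close>, of unit-rate Erlang
  densities of integer shape. This is the origin of the series in \<open>k\<close>, and
  \<open>J\<close> is the mixture weight divided by \<open>fact (k - m)\<close>. The terms of the
  expanded tail are nonnegative, so Tonelli exchanges the series with the expectation; infinite
  interference carries no coverage and is cut out by a 0/1 weight. Two obstacles shape the rest. The
  LOS probability is merely measurable, so the mean counts need not be differentiable and the
  serving density cannot be read off as a pointwise derivative; comparison by partitions needs only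
  a Lipschitz bound. The serving index is random, so the law of its gain is not directly a statement
  about marks: the index is frozen at each value \<open>i\<close>, an event decided by locations and
  types, and the gain of station \<open>i\<close> is integrated out given everything else. Since
  \<kappa> is an arbitrary version of a conditional law, its Rician form is recovered only almost
  everywhere, by evaluating the same probabilities in two ways over all Borel sets of
  distances.\<close>

lemma rician_density_conv_erlang:
  assumes "0 \<le> K" "x \<noteq> 0"
  shows "ennreal (rician_density K x) =
    (\<Sum>k. ennreal (exp (- K) * K ^ k / fact k) * ennreal (erlang_density k 1 x))"
proof (cases "0 < x")
  case False
  then show ?thesis using assms by (simp add: rician_density_def erlang_density_def)
next
  case True
  define a where "a k = (K * x) ^ k / (fact k)\<^sup>2" for k :: nat
  have a0: "0 \<le> a k" for k using True assms by (simp add: a_def)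
  have le: "a k \<le> (K * x) ^ k / fact k" for k
  proof -
    have "(fact k :: real) * 1 \<le> fact k * fact k"
      by (intro mult_left_mono) auto
    then show ?thesis unfolding a_def power2_eq_square
      using True assms by (intro divide_left_mono) auto
  qed
  have "summable (\<lambda>k. (K * x) ^ k / fact k)"
    using summable_exp[of "K * x"] by (simp add: field_simps)
  then have "summable a" by (rule summable_comparison_test[rotated]) (use a0 le in auto)
  then have sm: "summable (\<lambda>k. exp (- K - x) * a k)" by (rule summable_mult)
  have "ennreal (rician_density K x) = ennreal (\<Sum>k. exp (- K - x) * a k)"
    using True \<open>summable a\<close> by (simp add: rician_density_def a_def[symmetric] suminf_mult)
  also have "\<dots> = (\<Sum>k. ennreal (exp (- K - x) * a k))"
    using sm a0 by (intro suminf_ennreal2[symmetric]) auto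
  also have "\<dots> = (\<Sum>k. ennreal (exp (- K) * K ^ k / fact k) * ennreal (erlang_density k 1 x))"
    using True assms
    by (intro suminf_cong, subst ennreal_mult[symmetric])
       (auto simp: a_def erlang_density_def exp_diff exp_minus field_simps power2_eq_square)
  finally show ?thesis .
qed

lemma measurable_rician_density2 [measurable]:
  "(\<lambda>p. rician_density (fst p) (snd p)) \<in> borel_measurable (borel \<Otimes>\<^sub>M borel)"
  unfolding rician_density_def by measurable

lemma measurable_rician_density [measurable]: "rician_density K \<in> borel_measurable borel"
  unfolding rician_density_def by measurable

lemma sets_rician [simp, measurable_cong]: "sets (rician K) = sets borel"
  by (simp add: rician_def)

lemma space_rician [simp]: "space (rician K) = UNIV"
  by (simp add: rician_def)

lemma emeasure_rician_mixture:
  assumes "0 \<le> K" and [measurable]: "A \<in> sets borel"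
  shows "emeasure (rician K) A =
    (\<Sum>k. ennreal (exp (- K) * K ^ k / fact k) * emeasure (density lborel (erlang_density k 1)) A)"
proof -
  \<comment> \<open>The expansion fails only at 0, where \<open>rician_density\<close> is 0 but the
    Erlang density of shape 1 is 1.\<close>
  have "AE x in lborel. x \<noteq> (0::real)" by (rule AE_lborel_singleton)
  then have "emeasure (rician K) A = (\<integral>\<^sup>+x. (\<Sum>k. ennreal (exp (- K) * K ^ k / fact k) *
      (ennreal (erlang_density k 1 x) * indicator A x)) \<partial>lborel)"
    unfolding rician_def
    by (subst emeasure_density)
       (auto intro!: nn_integral_cong_AE simp: rician_density_conv_erlang[OF assms(1)]
             ennreal_suminf_multc[symmetric] mult.assoc)
  also have "\<dots> = (\<Sum>k. \<integral>\<^sup>+x. ennreal (exp (- K) * K ^ k / fact k) *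
      (ennreal (erlang_density k 1 x) * indicator A x) \<partial>lborel)"
    by (rule nn_integral_suminf) measurable
  also have "\<dots> = (\<Sum>k. ennreal (exp (- K) * K ^ k / fact k) *
      emeasure (density lborel (erlang_density k 1)) A)"
    by (intro suminf_cong) (simp add: nn_integral_cmult emeasure_density)
  finally show ?thesis .
qed

lemma suminf_poisson_weights:
  assumes "0 \<le> K" shows "(\<Sum>k. ennreal (exp (- K) * K ^ k / fact k)) = 1"
proof -
  have "(\<lambda>k. exp (- K) * (K ^ k / fact k)) sums (exp (- K) * exp K)"
    using exp_converges[of K] by (intro sums_mult) (simp add: field_simps)
  then have "(\<lambda>k. exp (- K) * K ^ k / fact k) sums 1"
    by (simp add: exp_minus)
  then show ?thesis
    using assms by (subst suminf_ennreal2) (auto simp: sums_iff)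
qed

lemma prob_space_rician: "0 \<le> K \<Longrightarrow> prob_space (rician K)"
proof (intro prob_spaceI)
  assume K: "0 \<le> K"
  have "emeasure (density lborel (erlang_density k 1)) UNIV = 1" for k
    using prob_space.emeasure_space_1[OF prob_space_erlang_density[of 1 k]] by simp
  then have "emeasure (rician K) UNIV = (\<Sum>k. ennreal (exp (- K) * K ^ k / fact k) * 1)"
    unfolding emeasure_rician_mixture[OF K sets.top[of borel, unfolded space_borel]] by (simp only:)
  then show "emeasure (rician K) (space (rician K)) = 1"
    by (simp only: mult_1_right suminf_poisson_weights[OF K] space_rician)
qed

text \<open>Since \<open>fact m * (k choose m) = fact k / fact (k - m)\<close>,
  \<open>J K m k\<close> is the Poisson weight of \<open>k\<close> divided by
  \<open>fact (k - m)\<close>. Reversing the summation leaves, once \<open>e\<close> is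
  \<open>exp (- x)\<close>, the probability that a Poisson variable of mean \<open>x\<close> is at
  most \<open>k\<close>.\<close>

lemma J_sum_eq:
  "(\<Sum>m=0..k. J K m k * x ^ (k - m) * e) =
    exp (- K) * K ^ k / fact k * (\<Sum>n\<le>k. x ^ n * e / fact n)"
proof -
  have "(\<Sum>m=0..k. J K m k * x ^ (k - m) * e) =
      (\<Sum>m=0..k. exp (- K) * K ^ k / fact k * (x ^ (k - m) * e / fact (k - m)))"
  proof (rule sum.cong[OF refl])
    fix m assume "m \<in> {0..k}"
    then have "fact m * real (k choose m) = fact k / fact (k - m)"
      by (simp add: binomial_fact)
    then have "J K m k = exp (- K) * K ^ k * (fact k / fact (k - m)) / (fact k)\<^sup>2"
      by (metis J_def mult.assoc)
    then show "J K m k * x ^ (k - m) * e =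
        exp (- K) * K ^ k / fact k * (x ^ (k - m) * e / fact (k - m))"
      by (simp add: power2_eq_square mult_ac)
  qed
  also have "\<dots> = exp (- K) * K ^ k / fact k * (\<Sum>m\<le>k. x ^ (k - m) * e / fact (k - m))"
    by (simp add: sum_distrib_left atLeast0AtMost)
  also have "(\<Sum>m\<le>k. x ^ (k - m) * e / fact (k - m)) = (\<Sum>n\<le>k. x ^ n * e / fact n)"
    by (rule sum.reindex_bij_witness[of _ "\<lambda>m. k - m" "\<lambda>m. k - m"]) auto
  finally show ?thesis .
qed

text \<open>An Erlang variable of shape \<open>k + 1\<close> and rate 1 is the time of the
  \<open>(k + 1)\<close>-st point of a unit-rate Poisson process, so it exceeds \<open>x\<close>
  exactly when at most \<open>k\<close> points fall up to time \<open>x\<close>. The inner sum is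
  that probability times the mixture weight.\<close>

lemma emeasure_rician_greaterThan:
  assumes "0 \<le> K" "0 \<le> x"
  shows "emeasure (rician K) {x<..} = (\<Sum>k. ennreal (\<Sum>m=0..k. J K m k * x ^ (k - m) * exp (- x)))"
proof -
  have tail: "emeasure (density lborel (erlang_density k 1)) {x<..} =
      ennreal (\<Sum>n\<le>k. x ^ n * exp (- x) / fact n)" for k
  proof -
    interpret E: prob_space "density lborel (erlang_density k 1)"
      by (rule prob_space_erlang_density) simp
    have "emeasure (density lborel (erlang_density k 1)) {..x} = ennreal (erlang_CDF k 1 x)"
      by (simp add: emeasure_erlang_density)
    then have "E.prob {..x} = erlang_CDF k 1 x"
      by (metis E.emeasure_eq_measure erlang_CDF_nonneg ennreal_inj measure_nonneg zero_less_one)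
    moreover have "{x<..} = space (density lborel (erlang_density k 1)) - {..x}" by auto
    ultimately have "E.prob {x<..} = 1 - erlang_CDF k 1 x"
      by (simp only:) (subst E.prob_compl, auto)
    then show ?thesis using assms by (simp add: E.emeasure_eq_measure erlang_CDF_def)
  qed
  show ?thesis
    unfolding emeasure_rician_mixture[OF assms(1) borel_open[OF open_greaterThan]] tail J_sum_eq
    using assms by (intro suminf_cong ennreal_mult[symmetric]) (auto intro!: sum_nonneg)
qed

section \<open>Differentiation of Laplace transforms under the integral\<close>

lemma power_exp_le:
  fixes w t :: real assumes "0 \<le> w" "0 < t"
  shows "w ^ j * exp (- t * w) \<le> fact j / t ^ j"
proof -
  \<comment> \<open>A single term of the series of \<open>exp (t * w)\<close> bounds it from
    below.\<close>
  have "(\<Sum>n\<in>{j}. (t * w) ^ n /\<^sub>R fact n) \<le> (\<Sum>n. (t * w) ^ n /\<^sub>R fact n)"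
    using assms by (intro sum_le_suminf summable_exp_generic) auto
  then have "(t * w) ^ j / fact j \<le> exp (t * w)"
    by (simp add: exp_def field_simps)
  then show ?thesis using assms
    by (simp add: exp_minus field_simps power_mult_distrib)
qed

text \<open>A Taylor remainder quadratic in \<open>y - t\<close> whose other factor does not involve
  \<open>y\<close>, as long as \<open>y\<close> stays at or above \<open>s\<close>. For positive
  \<open>s\<close> the factor \<open>exp (- s * w)\<close> keeps the bound finite, uniformly in
  \<open>w\<close>, after multiplication by further powers of \<open>w\<close>.\<close>

lemma exp_second_order_bound:
  fixes w t y s :: real
  assumes "0 \<le> w" "s \<le> t" "s \<le> y"
  shows "\<bar>exp (- y * w) - exp (- t * w) + (y - t) * w * exp (- t * w)\<bar> \<le> (y - t)\<^sup>2 * (w\<^sup>2 * exp (- s * w))"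
proof -
  \<comment> \<open>Convexity: the graph of \<open>\<lambda>a. exp (- a * w)\<close> lies above its
    tangent at \<open>b\<close>. The tangent at \<open>t\<close> gives the lower bound on the
    remainder, the tangent at \<open>y\<close> the upper one.\<close>
  have tangent: "exp (- b * w) * (1 - (a - b) * w) \<le> exp (- a * w)" for a b
  proof -
    have "exp (- b * w) * (1 + (- ((a - b) * w))) \<le> exp (- b * w) * exp (- ((a - b) * w))"
      by (intro mult_left_mono exp_ge_add_one_self) auto
    also have "\<dots> = exp (- a * w)" by (simp add: exp_add[symmetric] algebra_simps)
    finally show ?thesis by simp
  qed
  have diff: "\<bar>exp (- a * w) - exp (- b * w)\<bar> \<le> \<bar>a - b\<bar> * (w * exp (- s * w))"
    if "s \<le> a" "s \<le> b" for a b
  proof -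
    have *: "exp (- a * w) - exp (- b * w) \<le> \<bar>a - b\<bar> * (w * exp (- s * w))" if "s \<le> a" for a b
    proof -
      have "exp (- a * w) - exp (- b * w) \<le> exp (- a * w) * ((b - a) * w)"
        using tangent[of a b] by (simp add: algebra_simps)
      also have "\<dots> \<le> exp (- s * w) * (\<bar>a - b\<bar> * w)"
      proof (cases "a \<le> b")
        case True
        with that assms show ?thesis by (intro mult_mono) (auto intro!: mult_right_mono)
      next
        case False
        then have "exp (- a * w) * ((b - a) * w) \<le> 0"
          using assms by (intro mult_nonneg_nonpos mult_nonpos_nonneg) auto
        also have "0 \<le> exp (- s * w) * (\<bar>a - b\<bar> * w)" using assms by simp
        finally show ?thesis .
      qed
      finally show ?thesis by (simp add: mult_ac)
    qed
    from *[OF that(1), of b] *[OF that(2), of a] show ?thesis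
      by (auto simp: abs_minus_commute abs_le_iff)
  qed
  have lower: "0 \<le> exp (- y * w) - exp (- t * w) + (y - t) * w * exp (- t * w)"
    using tangent[of t y] by (simp add: algebra_simps)
  have "exp (- y * w) - exp (- t * w) + (y - t) * w * exp (- t * w)
      \<le> (y - t) * w * (exp (- t * w) - exp (- y * w))"
    using tangent[of y t] by (simp add: algebra_simps)
  also have "\<dots> \<le> \<bar>y - t\<bar> * w * \<bar>exp (- t * w) - exp (- y * w)\<bar>"
    using assms by (metis abs_ge_self abs_mult abs_of_nonneg)
  also have "\<dots> \<le> \<bar>y - t\<bar> * w * (\<bar>t - y\<bar> * (w * exp (- s * w)))"
    using assms by (intro mult_left_mono diff) auto
  also have "\<dots> = \<bar>y - t\<bar>\<^sup>2 * (w\<^sup>2 * exp (- s * w))"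
    by (simp only: abs_minus_commute[of t y]) (simp add: power2_eq_square)
  finally show ?thesis using lower by simp
qed

text \<open>The weight \<open>e\<close> will be the indicator of finite interference. The error of
  the difference quotient is at most a constant times \<open>\<bar>y - t\<bar>\<close>, because the
  pointwise remainder is bounded uniformly over the sample space.\<close>

lemma has_field_derivative_weighted_laplace:
  fixes w e :: "'a \<Rightarrow> real"
  assumes "prob_space \<mu>" and [measurable]: "w \<in> borel_measurable \<mu>" "e \<in> borel_measurable \<mu>"
    and w: "\<And>p. 0 \<le> w p" and e: "\<And>p. \<bar>e p\<bar> \<le> 1" and t: "0 < t"
  shows "((\<lambda>t. \<integral>p. e p * ((- w p) ^ j * exp (- t * w p)) \<partial>\<mu>) has_field_derivative
           (\<integral>p. e p * ((- w p) ^ Suc j * exp (- t * w p)) \<partial>\<mu>)) (at t)"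
proof -
  interpret prob_space \<mu> by fact
  have bound: "norm (e p * ((- w p) ^ j * exp (- s * w p))) \<le> fact j / s ^ j" if "0 < s" for s j p
  proof -
    have "\<bar>e p\<bar> * (w p ^ j * exp (- s * w p)) \<le> 1 * (fact j / s ^ j)"
      using e[of p] w[of p] power_exp_le[OF w that, of p j] by (intro mult_mono) auto
    then show ?thesis
      using w[of p] by (simp add: abs_mult power_abs)
  qed
  have int: "integrable \<mu> (\<lambda>p. e p * ((- w p) ^ j * exp (- s * w p)))" if "0 < s" for s j
    by (rule integrable_const_bound[where B = "fact j / s ^ j"], rule AE_I2, rule bound[OF that]) measurable
  define F where "F j y = (\<integral>p. e p * ((- w p) ^ j * exp (- y * w p)) \<partial>\<mu>)" for j y
  \<comment> \<open>Any point strictly between 0 and \<open>t\<close> would do: it bounds the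
    exponents from below near \<open>t\<close>. Then \<open>C\<close> is the bound of
    \<open>power_exp_le\<close> for the power \<open>j + 2\<close>, the \<open>j\<close> factors of
    the integrand and two from the remainder.\<close>
  define s where "s = t / 2"
  define C where "C = fact (j + 2) / s ^ (j + 2)"
  have s: "0 < s" "s \<le> t" "s < t" using t by (auto simp: s_def)
  have est: "\<bar>F j y - F j t - (y - t) * F (Suc j) t\<bar> \<le> (y - t)\<^sup>2 * C" if y: "s \<le> y" for y
  proof -
    let ?g = "\<lambda>p. e p * ((- w p) ^ j * (exp (- y * w p) - exp (- t * w p) + (y - t) * w p * exp (- t * w p)))"
    have *: "?g p = e p * ((- w p) ^ j * exp (- y * w p)) - e p * ((- w p) ^ j * exp (- t * w p))
        - (y - t) * (e p * ((- w p) ^ Suc j * exp (- t * w p)))" for p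
      by (simp add: algebra_simps)
    note int' = int[of y j] int[of t j] int[of t "Suc j"]
    have gint: "integrable \<mu> ?g"
      unfolding * using s y t
      by (intro Bochner_Integration.integrable_diff integrable_mult_right int) auto
    have "(\<integral>p. ?g p \<partial>\<mu>) = F j y - F j t - (y - t) * F (Suc j) t"
      unfolding * F_def using s y t int'
      by (simp only: Bochner_Integration.integral_diff Bochner_Integration.integrable_diff
          integrable_mult_right integral_mult_right_zero)
    then have "\<bar>F j y - F j t - (y - t) * F (Suc j) t\<bar> = \<bar>\<integral>p. ?g p \<partial>\<mu>\<bar>" by simp
    also have "\<dots> \<le> (\<integral>p. \<bar>?g p\<bar> \<partial>\<mu>)" by (rule integral_abs_bound)
    also have "\<dots> \<le> (\<integral>p. (y - t)\<^sup>2 * C \<partial>\<mu>)"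
    proof (rule integral_mono)
      fix p
      have "\<bar>?g p\<bar> \<le> 1 * (w p ^ j * ((y - t)\<^sup>2 * ((w p)\<^sup>2 * exp (- s * w p))))"
        unfolding abs_mult using w[of p] e[of p] exp_second_order_bound[OF w, of s t y p] s y
        by (intro mult_mono) (auto simp: power_abs)
      also have "\<dots> = (y - t)\<^sup>2 * (w p ^ (j + 2) * exp (- s * w p))"
        by (simp only: power_add mult_1_left mult_ac)
      also have "\<dots> \<le> (y - t)\<^sup>2 * C"
        unfolding C_def using s w by (intro mult_left_mono power_exp_le) auto
      finally show "\<bar>?g p\<bar> \<le> (y - t)\<^sup>2 * C" .
    qed (use gint in auto)
    finally show ?thesis by (simp add: prob_space)
  qed
  have "((\<lambda>y. (F j y - F j t) / (y - t)) \<longlongrightarrow> F (Suc j) t) (at t)"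
  proof (rule LIM_zero_cancel, rule Lim_null_comparison[where g = "\<lambda>y. \<bar>y - t\<bar> * C"])
    have "eventually (\<lambda>y. y \<in> {s<..}) (at t)"
      using s by (intro eventually_at_in_open') auto
    then show "eventually (\<lambda>y. norm ((F j y - F j t) / (y - t) - F (Suc j) t) \<le> \<bar>y - t\<bar> * C) (at t)"
      using eventually_neq_at_within[of t t UNIV]
    proof eventually_elim
      case (elim y)
      then have "(F j y - F j t) / (y - t) - F (Suc j) t = (F j y - F j t - (y - t) * F (Suc j) t) / (y - t)"
        by (simp add: field_simps)
      also have "\<bar>\<dots>\<bar> \<le> ((y - t)\<^sup>2 * C) / \<bar>y - t\<bar>"
        unfolding abs_divide using est[of y] elim by (intro divide_right_mono) auto
      also have "\<dots> = \<bar>y - t\<bar> * C"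
        using elim by (simp add: power2_eq_square abs_if field_simps)
      finally show ?case by simp
    qed
    show "((\<lambda>y. \<bar>y - t\<bar> * C) \<longlongrightarrow> 0) (at t)"
      by (auto intro!: tendsto_eq_intros)
  qed
  then show ?thesis by (simp add: has_field_derivative_iff F_def)
qed

lemma deriv_funpow_weighted_laplace:
  fixes w e :: "'a \<Rightarrow> real"
  assumes "prob_space \<mu>" "w \<in> borel_measurable \<mu>" "e \<in> borel_measurable \<mu>"
    and "\<And>p. 0 \<le> w p" "\<And>p. \<bar>e p\<bar> \<le> 1" "0 < t"
  shows "(deriv ^^ j) (\<lambda>t. \<integral>p. e p * exp (- t * w p) \<partial>\<mu>) t =
         (\<integral>p. e p * ((- w p) ^ j * exp (- t * w p)) \<partial>\<mu>)"
  using \<open>0 < t\<close>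
proof (induction j arbitrary: t)
  case (Suc j)
  \<comment> \<open>\<open>deriv\<close> depends on the values near \<open>t\<close>, so the
    induction hypothesis, available for positive arguments only, is used on a whole
    neighbourhood.\<close>
  have "eventually (\<lambda>s. 0 < s) (nhds t)"
    using Suc.prems by (intro eventually_nhds_in_open[of "{0<..}", simplified]) auto
  then have "eventually (\<lambda>s. (deriv ^^ j) (\<lambda>t. \<integral>p. e p * exp (- t * w p) \<partial>\<mu>) s =
      (\<integral>p. e p * ((- w p) ^ j * exp (- s * w p)) \<partial>\<mu>)) (nhds t)"
    by eventually_elim (rule Suc.IH)
  from deriv_cong_ev[OF this refl] show ?case
    using has_field_derivative_weighted_laplace[OF assms(1-5) Suc.prems, of j]
    by (simp add: DERIV_imp_deriv)
qed simp

text \<open>Given the interference, coverage is a Rician tail at a multiple of it, with an expansion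
  into nonnegative terms \<open>a k p\<close>. Tonelli exchanges sum and integral, and each
  \<open>a k\<close> integrates to a finite combination of derivatives at \<gamma>. Summability
  follows because the total is at most 1.\<close>

lemma rician_coverage_sums:
  fixes \<mu> :: "(real \<times> ennreal) measure"
  assumes "prob_space \<mu>" and sets: "sets \<mu> = sets (borel \<Otimes>\<^sub>M borel)"
    and K: "0 \<le> K" and c: "0 < c" and \<gamma>: "0 < \<gamma>"
  shows "(\<lambda>k. \<Sum>m=0..k. J K m k * \<gamma> ^ (k - m) * (- 1) ^ (k - m) *
             (deriv ^^ (k - m)) (\<lambda>t. laplace_interference \<mu> (t / c)) \<gamma>)
         sums enn2real (\<integral>\<^sup>+p. emeasure (rician K) {h. ennreal \<gamma> < ennreal (c * h) / snd p} \<partial>\<mu>)"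
proof -
  interpret prob_space \<mu> by fact
  \<comment> \<open>Absorbing \<open>c\<close> here makes the derivatives of the statement
    derivatives in the threshold itself, with no chain rule.\<close>
  define w :: "real \<times> ennreal \<Rightarrow> real" where "w p = enn2real (snd p) / c" for p
  \<comment> \<open>\<open>enn2real\<close> sends infinity to 0, which would give
    \<open>exp 0 = 1\<close>; the weight restores the value 0 that
    \<open>laplace_interference\<close> assigns to infinite interference.\<close>
  define e :: "real \<times> ennreal \<Rightarrow> real" where "e p = (if snd p = \<infinity> then 0 else 1)" for p
  have [measurable]: "snd \<in> \<mu> \<rightarrow>\<^sub>M (borel :: ennreal measure)"
    using measurable_snd by (simp cong: measurable_cong_sets add: sets)
  have [measurable]: "w \<in> borel_measurable \<mu>" "e \<in> borel_measurable \<mu>"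
    unfolding w_def e_def by measurable
  have w: "0 \<le> w p" and e: "0 \<le> e p" "\<bar>e p\<bar> \<le> 1" for p
    using c by (auto simp: w_def e_def)
  define a where "a k p = e p * (\<Sum>m=0..k. J K m k * (\<gamma> * w p) ^ (k - m) * exp (- (\<gamma> * w p)))" for k p
  have J: "0 \<le> J K m k" for m k using K by (simp add: J_def)
  have a: "0 \<le> a k p" for k p
    unfolding a_def using J \<gamma> w[of p] e[of p] by (intro mult_nonneg_nonneg sum_nonneg) auto
  have lap: "laplace_interference \<mu> (t / c) = (\<integral>p. e p * exp (- t * w p) \<partial>\<mu>)" for t
    unfolding laplace_interference_def e_def w_def by (intro Bochner_Integration.integral_cong) auto
  have int: "integrable \<mu> (\<lambda>p. e p * ((\<gamma> * w p) ^ j * exp (- (\<gamma> * w p))))" for j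
  proof (rule integrable_const_bound[where B = "fact j"])
    show "AE p in \<mu>. norm (e p * ((\<gamma> * w p) ^ j * exp (- (\<gamma> * w p)))) \<le> fact j"
    proof (rule AE_I2)
      fix p
      have "e p * ((\<gamma> * w p) ^ j * exp (- (\<gamma> * w p))) \<le> 1 * fact j"
        using power_exp_le[of "\<gamma> * w p" 1 j] \<gamma> w[of p] e[of p] by (intro mult_mono) auto
      then show "norm (e p * ((\<gamma> * w p) ^ j * exp (- (\<gamma> * w p)))) \<le> fact j"
        using \<gamma> w[of p] e[of p] by simp
    qed
  qed measurable
  have aint: "integrable \<mu> (a k)" for k
  proof -
    have "a k = (\<lambda>p. \<Sum>m=0..k. J K m k * (e p * ((\<gamma> * w p) ^ (k - m) * exp (- (\<gamma> * w p)))))"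
      by (simp add: fun_eq_iff a_def sum_distrib_left mult_ac)
    then show ?thesis using int by simp
  qed
  have a_eq: "(\<integral>p. a k p \<partial>\<mu>) = (\<Sum>m=0..k. J K m k * \<gamma> ^ (k - m) * (- 1) ^ (k - m) *
             (deriv ^^ (k - m)) (\<lambda>t. laplace_interference \<mu> (t / c)) \<gamma>)" for k
  proof -
    have "(\<integral>p. a k p \<partial>\<mu>) = (\<integral>p. (\<Sum>m=0..k. J K m k * (e p * ((\<gamma> * w p) ^ (k - m) * exp (- (\<gamma> * w p))))) \<partial>\<mu>)"
      by (simp add: fun_eq_iff a_def sum_distrib_left mult_ac)
    also have "\<dots> = (\<Sum>m=0..k. J K m k * (\<integral>p. e p * ((\<gamma> * w p) ^ (k - m) * exp (- (\<gamma> * w p))) \<partial>\<mu>))"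
      using int by simp
    also have "\<dots> = (\<Sum>m=0..k. J K m k * \<gamma> ^ (k - m) * (- 1) ^ (k - m) *
             (deriv ^^ (k - m)) (\<lambda>t. laplace_interference \<mu> (t / c)) \<gamma>)"
    proof (rule sum.cong[OF refl])
      fix m assume "m \<in> {0..k}"
      let ?j = "k - m"
      have "(deriv ^^ ?j) (\<lambda>t. laplace_interference \<mu> (t / c)) \<gamma> =
          (\<integral>p. e p * ((- w p) ^ ?j * exp (- \<gamma> * w p)) \<partial>\<mu>)"
        unfolding lap by (rule deriv_funpow_weighted_laplace) (use w e \<gamma> in \<open>auto intro: prob_space_axioms\<close>)
      then have "\<gamma> ^ ?j * (- 1) ^ ?j * (deriv ^^ ?j) (\<lambda>t. laplace_interference \<mu> (t / c)) \<gamma> =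
          (\<integral>p. \<gamma> ^ ?j * (- 1) ^ ?j * (e p * ((- w p) ^ ?j * exp (- \<gamma> * w p))) \<partial>\<mu>)"
        by simp
      also have "\<dots> = (\<integral>p. e p * ((\<gamma> * w p) ^ ?j * exp (- (\<gamma> * w p))) \<partial>\<mu>)"
        by (intro Bochner_Integration.integral_cong refl)
           (simp add: power_mult_distrib power_minus[of "w _"] mult_ac)
      finally show "J K m k * (\<integral>p. e p * ((\<gamma> * w p) ^ ?j * exp (- (\<gamma> * w p))) \<partial>\<mu>) =
          J K m k * \<gamma> ^ ?j * (- 1) ^ ?j * (deriv ^^ ?j) (\<lambda>t. laplace_interference \<mu> (t / c)) \<gamma>"
        by (simp add: mult_ac)
    qed
    finally show ?thesis .
  qed
  have tail: "emeasure (rician K) {h. ennreal \<gamma> < ennreal (c * h) / snd p} = (\<Sum>k. ennreal (a k p))" for p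
  proof (cases "snd p = \<infinity>")
    case True
    then show ?thesis by (simp add: a_def e_def)
  next
    case False
    have "ennreal \<gamma> < ennreal (c * h) / snd p \<longleftrightarrow> \<gamma> * w p < h" for h
    proof -
      obtain y where y: "snd p = ennreal y" "0 \<le> y" using False by (cases "snd p") auto
      show ?thesis
      proof (cases "0 < y \<and> 0 < h")
        case True
        then show ?thesis using c \<gamma> y
          by (simp add: w_def divide_ennreal ennreal_less_iff field_simps)
      next
        case False
        \<comment> \<open>Boundary cases: zero interference makes the quotient infinite for every
          positive gain, and for a nonpositive gain \<open>ennreal\<close> truncates the numerator
          to 0.\<close>
        show ?thesis
        proof (cases "0 < h")
          case True
          then show ?thesis using False c \<gamma> y
            by (auto simp: w_def ennreal_divide_eq_top_iff)
        next
          case hneg: False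
          have "ennreal (c * h) = 0" using hneg c by (intro ennreal_neg) (simp add: mult_le_0_iff)
          moreover have "0 \<le> \<gamma> * w p" using \<gamma> w[of p] by simp
          ultimately show ?thesis using hneg by simp
        qed
      qed
    qed
    then have "{h. ennreal \<gamma> < ennreal (c * h) / snd p} = {\<gamma> * w p<..}" by auto
    then show ?thesis
      using False K \<gamma> w[of p] by (simp add: emeasure_rician_greaterThan a_def e_def)
  qed
  have "(\<integral>\<^sup>+p. emeasure (rician K) {h. ennreal \<gamma> < ennreal (c * h) / snd p} \<partial>\<mu>) =
      (\<integral>\<^sup>+p. (\<Sum>k. ennreal (a k p)) \<partial>\<mu>)"
    by (simp only: tail)
  also have "\<dots> = (\<Sum>k. \<integral>\<^sup>+p. ennreal (a k p) \<partial>\<mu>)"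
    using aint by (intro nn_integral_suminf) auto
  also have "\<dots> = (\<Sum>k. ennreal (\<integral>p. a k p \<partial>\<mu>))"
    using aint a by (intro suminf_cong nn_integral_eq_integral) auto
  finally have eq: "(\<integral>\<^sup>+p. emeasure (rician K) {h. ennreal \<gamma> < ennreal (c * h) / snd p} \<partial>\<mu>) =
      (\<Sum>k. ennreal (\<integral>p. a k p \<partial>\<mu>))" .
  have "(\<integral>\<^sup>+p. emeasure (rician K) {h. ennreal \<gamma> < ennreal (c * h) / snd p} \<partial>\<mu>) \<le> (\<integral>\<^sup>+p. 1 \<partial>\<mu>)"
    using prob_space.emeasure_le_1[OF prob_space_rician[OF K]] by (intro nn_integral_mono) auto
  also have "\<dots> = 1" by (simp add: emeasure_space_1)
  finally have "(\<Sum>k. ennreal (\<integral>p. a k p \<partial>\<mu>)) \<noteq> \<top>" unfolding eq by (auto simp: top_unique)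
  then have "summable (\<lambda>k. \<integral>p. a k p \<partial>\<mu>)"
    using a by (intro summable_suminf_not_top) (auto intro: integral_nonneg)
  then have "(\<lambda>k. \<integral>p. a k p \<partial>\<mu>) sums enn2real (\<Sum>k. ennreal (\<integral>p. a k p \<partial>\<mu>))"
    using a by (simp add: suminf_ennreal2 integral_nonneg suminf_nonneg summable_sums)
  then show ?thesis unfolding eq a_eq .
qed

section \<open>Disintegration along kernels\<close>

text \<open>Both sides integrate \<open>f\<close> against a finite measure on the product space, and
  the two measures agree on rectangles, an intersection-stable generator. The space \<open>N\<close>
  is general because it serves once for Borel distances and once for a sub-sigma-algebra of
  \<open>M\<close> with \<open>Z\<close> the identity.\<close>

lemma kernel_rectangle_extend:
  assumes M: "finite_measure M" and [measurable]: "Z \<in> M \<rightarrow>\<^sub>M N" "Y \<in> M \<rightarrow>\<^sub>M L" "\<kappa> \<in> N \<rightarrow>\<^sub>M prob_algebra L"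
    and E [measurable]: "Measurable.pred M E"
    and rect: "\<And>B C. B \<in> sets N \<Longrightarrow> C \<in> sets L \<Longrightarrow>
      emeasure M {\<omega>\<in>space M. E \<omega> \<and> Z \<omega> \<in> B \<and> Y \<omega> \<in> C} =
      (\<integral>\<^sup>+\<omega>\<in>{\<omega>\<in>space M. E \<omega> \<and> Z \<omega> \<in> B}. emeasure (\<kappa> (Z \<omega>)) C \<partial>M)"
    and f [measurable]: "f \<in> borel_measurable (N \<Otimes>\<^sub>M L)"
  shows "(\<integral>\<^sup>+\<omega>\<in>{\<omega>\<in>space M. E \<omega>}. f (Z \<omega>, Y \<omega>) \<partial>M) =
         (\<integral>\<^sup>+\<omega>\<in>{\<omega>\<in>space M. E \<omega>}. (\<integral>\<^sup>+y. f (Z \<omega>, y) \<partial>\<kappa> (Z \<omega>)) \<partial>M)"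
proof -
  interpret finite_measure M by fact
  have \<kappa> [measurable]: "\<kappa> \<in> N \<rightarrow>\<^sub>M subprob_algebra L" by (rule measurable_prob_algebraD) fact
  have \<kappa>Z: "prob_space (\<kappa> (Z \<omega>))" "sets (\<kappa> (Z \<omega>)) = sets L" if "\<omega> \<in> space M" for \<omega>
    using measurable_space[OF \<open>\<kappa> \<in> N \<rightarrow>\<^sub>M prob_algebra L\<close> measurable_space[OF \<open>Z \<in> M \<rightarrow>\<^sub>M N\<close> that]]
    by (auto simp: space_prob_algebra)
  define M' where "M' = density M (indicator {\<omega>\<in>space M. E \<omega>})"
  have M' [simp, measurable_cong]: "sets M' = sets M" by (simp add: M'_def)
  have spM': "space M' = space M" by (simp add: M'_def)
  \<comment> \<open>The law of the pair as predicted by the kernel: \<omega> from \<open>M\<close>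
    restricted to \<open>E\<close>, then \<open>y\<close> from
    \<open>\<kappa> (Z \<omega>)\<close>.\<close>
  define \<rho> where "\<rho> = M' \<bind> (\<lambda>\<omega>. distr (\<kappa> (Z \<omega>)) (N \<Otimes>\<^sub>M L) (\<lambda>y. (Z \<omega>, y)))"
  have ker [measurable]: "(\<lambda>\<omega>. distr (\<kappa> (Z \<omega>)) (N \<Otimes>\<^sub>M L) (\<lambda>y. (Z \<omega>, y))) \<in> M' \<rightarrow>\<^sub>M subprob_algebra (N \<Otimes>\<^sub>M L)"
    by (rule measurable_distr2[where M = L]) measurable
  have nn\<rho>: "(\<integral>\<^sup>+x. g x \<partial>\<rho>) = (\<integral>\<^sup>+\<omega>\<in>{\<omega>\<in>space M. E \<omega>}. (\<integral>\<^sup>+y. g (Z \<omega>, y) \<partial>\<kappa> (Z \<omega>)) \<partial>M)"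
    if [measurable]: "g \<in> borel_measurable (N \<Otimes>\<^sub>M L)" for g
  proof -
    have "(\<integral>\<^sup>+x. g x \<partial>\<rho>) = (\<integral>\<^sup>+\<omega>. (\<integral>\<^sup>+x. g x \<partial>distr (\<kappa> (Z \<omega>)) (N \<Otimes>\<^sub>M L) (\<lambda>y. (Z \<omega>, y))) \<partial>M')"
      unfolding \<rho>_def by (rule nn_integral_bind) measurable
    also have "\<dots> = (\<integral>\<^sup>+\<omega>. (\<integral>\<^sup>+y. g (Z \<omega>, y) \<partial>\<kappa> (Z \<omega>)) \<partial>M')"
    proof (intro nn_integral_cong nn_integral_distr)
      fix \<omega> assume "\<omega> \<in> space M'"
      then have "\<omega> \<in> space M" by (simp add: spM')
      then have "Z \<omega> \<in> space N"
        using \<open>Z \<in> M \<rightarrow>\<^sub>M N\<close> by (rule measurable_space[rotated])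
      then show "(\<lambda>y. (Z \<omega>, y)) \<in> \<kappa> (Z \<omega>) \<rightarrow>\<^sub>M N \<Otimes>\<^sub>M L"
        using \<kappa>Z(2)[OF \<open>\<omega> \<in> space M\<close>]
        by (intro measurable_Pair measurable_const measurable_ident_sets)
    qed measurable
    also have "\<dots> = (\<integral>\<^sup>+\<omega>. indicator {\<omega>\<in>space M. E \<omega>} \<omega> * (\<integral>\<^sup>+y. g (Z \<omega>, y) \<partial>\<kappa> (Z \<omega>)) \<partial>M)"
      unfolding M'_def
      by (rule nn_integral_density) (measurable, rule nn_integral_measurable_subprob_algebra2[of "\<lambda>\<omega> y. g (Z \<omega>, y)" M L "\<lambda>\<omega>. \<kappa> (Z \<omega>)"], measurable)
    finally show ?thesis by (simp add: mult.commute)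
  qed
  have sets\<rho> [measurable_cong]: "sets \<rho> = sets (N \<Otimes>\<^sub>M L)" if "space M \<noteq> {}"
    unfolding \<rho>_def by (rule sets_bind) (auto simp: spM' that)
  show ?thesis
  \<comment> \<open>The sigma-algebra of a \<open>bind\<close> is the expected one only over a
    nonempty space.\<close>
  proof (cases "space M = {}")
    case True
    then show ?thesis by (simp add: nn_integral_empty)
  next
    case False
    have ZY [measurable]: "(\<lambda>\<omega>. (Z \<omega>, Y \<omega>)) \<in> M' \<rightarrow>\<^sub>M N \<Otimes>\<^sub>M L" by measurable
    have eq: "distr M' (N \<Otimes>\<^sub>M L) (\<lambda>\<omega>. (Z \<omega>, Y \<omega>)) = \<rho>"
    proof (rule measure_eqI_generator_eq)
      let ?E = "{a \<times> b | a b. a \<in> sets N \<and> b \<in> sets L}"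
      show "Int_stable ?E" by (rule Int_stable_pair_measure_generator)
      show "?E \<subseteq> Pow (space N \<times> space L)" by (auto dest: sets.sets_into_space)
      show "sets (distr M' (N \<Otimes>\<^sub>M L) (\<lambda>\<omega>. (Z \<omega>, Y \<omega>))) = sigma_sets (space N \<times> space L) ?E"
        by (simp add: sets_pair_measure)
      show "sets \<rho> = sigma_sets (space N \<times> space L) ?E"
        by (simp add: sets\<rho>[OF False] sets_pair_measure)
      show "range (\<lambda>_::nat. space N \<times> space L) \<subseteq> ?E" by auto
      show "(\<Union>i::nat. space N \<times> space L) = space N \<times> space L" by simp
      have fin [simp]: "emeasure M' A \<noteq> \<top>" for A
      proof -
        have "emeasure M' (space M') \<le> emeasure M (space M)"
          unfolding M'_def by (subst emeasure_density) (auto intro!: nn_integral_mono[of M _ "\<lambda>_. 1", simplified] simp: indicator_def)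
        then show ?thesis using emeasure_space[of M' A] emeasure_finite
          by (auto simp: top_unique)
      qed
      show "emeasure (distr M' (N \<Otimes>\<^sub>M L) (\<lambda>\<omega>. (Z \<omega>, Y \<omega>))) (space N \<times> space L) \<noteq> \<infinity>"
        by (subst emeasure_distr[OF ZY]) simp_all
      fix R assume "R \<in> ?E"
      then obtain B C where R: "R = B \<times> C" and [measurable]: "B \<in> sets N" "C \<in> sets L" by auto
      have "emeasure (distr M' (N \<Otimes>\<^sub>M L) (\<lambda>\<omega>. (Z \<omega>, Y \<omega>))) R =
          emeasure M' {\<omega>\<in>space M. Z \<omega> \<in> B \<and> Y \<omega> \<in> C}"
        unfolding R by (subst emeasure_distr) (auto intro!: arg_cong[where f = "emeasure M'"] simp: spM')
      also have "\<dots> = (\<integral>\<^sup>+\<omega>. indicator {\<omega>\<in>space M. E \<omega> \<and> Z \<omega> \<in> B \<and> Y \<omega> \<in> C} \<omega> \<partial>M)"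
        unfolding M'_def
        by (subst emeasure_density) (simp, measurable, auto intro!: nn_integral_cong simp del: nn_integral_indicator split: split_indicator)
      also have "\<dots> = emeasure M {\<omega>\<in>space M. E \<omega> \<and> Z \<omega> \<in> B \<and> Y \<omega> \<in> C}"
        by (rule nn_integral_indicator) measurable
      also have "\<dots> = (\<integral>\<^sup>+\<omega>\<in>{\<omega>\<in>space M. E \<omega>}. (\<integral>\<^sup>+y. indicator R (Z \<omega>, y) \<partial>\<kappa> (Z \<omega>)) \<partial>M)"
        unfolding rect[OF \<open>B \<in> sets N\<close> \<open>C \<in> sets L\<close>]
      proof (intro nn_integral_cong)
        fix \<omega> assume "\<omega> \<in> space M"
        have "(\<integral>\<^sup>+y. indicator R (Z \<omega>, y) \<partial>\<kappa> (Z \<omega>)) = (\<integral>\<^sup>+y. indicator B (Z \<omega>) * indicator C y \<partial>\<kappa> (Z \<omega>))"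
          by (simp add: R indicator_times)
        also have "\<dots> = indicator B (Z \<omega>) * emeasure (\<kappa> (Z \<omega>)) C"
          using \<kappa>Z(2)[OF \<open>\<omega> \<in> space M\<close>] \<open>C \<in> sets L\<close>
          by (subst nn_integral_cmult_indicator) simp_all
        finally show "emeasure (\<kappa> (Z \<omega>)) C * indicator {\<omega> \<in> space M. E \<omega> \<and> Z \<omega> \<in> B} \<omega> =
            (\<integral>\<^sup>+ y. indicator R (Z \<omega>, y) \<partial>\<kappa> (Z \<omega>)) * indicator {\<omega> \<in> space M. E \<omega>} \<omega>"
          by (auto split: split_indicator)
      qed
      also have "\<dots> = (\<integral>\<^sup>+x. indicator R x \<partial>\<rho>)"
        by (rule nn\<rho>[symmetric]) (simp add: R)
      also have "\<dots> = emeasure \<rho> R"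
        by (rule nn_integral_indicator) (simp add: sets\<rho>[OF False] R)
      finally show "emeasure (distr M' (N \<Otimes>\<^sub>M L) (\<lambda>\<omega>. (Z \<omega>, Y \<omega>))) R = emeasure \<rho> R" .
    qed
    have "(\<integral>\<^sup>+\<omega>\<in>{\<omega>\<in>space M. E \<omega>}. f (Z \<omega>, Y \<omega>) \<partial>M) = (\<integral>\<^sup>+\<omega>. f (Z \<omega>, Y \<omega>) \<partial>M')"
      unfolding M'_def by (subst nn_integral_density) (auto simp: mult.commute)
    also have "\<dots> = (\<integral>\<^sup>+x. f x \<partial>distr M' (N \<Otimes>\<^sub>M L) (\<lambda>\<omega>. (Z \<omega>, Y \<omega>)))"
      by (rule nn_integral_distr[symmetric]) measurable
    also have "\<dots> = (\<integral>\<^sup>+\<omega>\<in>{\<omega>\<in>space M. E \<omega>}. (\<integral>\<^sup>+y. f (Z \<omega>, y) \<partial>\<kappa> (Z \<omega>)) \<partial>M)"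
      unfolding eq by (rule nn\<rho>) measurable
    finally show ?thesis .
  qed
qed

text \<open>Cut \<open>[a, b]\<close> into \<open>n + 1\<close> equal pieces: their common length
  pulls out of the sum of the increments and the differences of \<open>K\<close> telescope, which
  leaves a bound of order \<open>1 / (n + 1)\<close>. This takes the place of an argument by
  derivatives.\<close>

lemma additive_eq_of_lipschitz_monotone:
  fixes F K :: "real \<Rightarrow> real"
  assumes ab: "a \<le> b"
    and bd: "\<And>x y. a \<le> x \<Longrightarrow> x < y \<Longrightarrow> y \<le> b \<Longrightarrow> \<bar>F y - F x\<bar> \<le> C * (y - x) * (K x - K y)"
  shows "F b = F a"
proof -
  have le: "\<bar>F b - F a\<bar> \<le> C * (b - a) * (K a - K b) / real (Suc n)" for n
  proof (cases "a = b")
    case False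
    define h where "h = (b - a) / real (Suc n)"
    define x where "x i = a + real i * h" for i
    have h: "0 < h" using ab False by (simp add: h_def)
    have x0: "x 0 = a" and xn: "x (Suc n) = b" by (simp_all add: x_def h_def del: of_nat_Suc)
    have xi: "a \<le> x i" "x i < x (Suc i)" "x (Suc i) - x i = h" for i
      using h by (auto simp: x_def algebra_simps)
    have "x i \<le> b" if "i \<le> Suc n" for i
    proof -
      have "real i * h \<le> real (Suc n) * h" using that h by (intro mult_right_mono) auto
      then show ?thesis using xn by (simp add: x_def)
    qed
    then have "\<bar>F (x (Suc i)) - F (x i)\<bar> \<le> C * h * (K (x i) - K (x (Suc i)))" if "i < Suc n" for i
      using bd[of "x i" "x (Suc i)"] xi[of i] that by auto
    then have "(\<Sum>i<Suc n. \<bar>F (x (Suc i)) - F (x i)\<bar>) \<le> (\<Sum>i<Suc n. C * h * (K (x i) - K (x (Suc i))))"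
      by (intro sum_mono) auto
    also have "\<dots> = C * h * (K (x 0) - K (x (Suc n)))"
      unfolding sum_distrib_left[symmetric] by (subst sum_lessThan_telescope') (rule refl)
    also have "\<dots> = C * (b - a) * (K a - K b) / real (Suc n)"
      by (simp only: x0 xn h_def) simp
    finally have "(\<Sum>i<Suc n. \<bar>F (x (Suc i)) - F (x i)\<bar>) \<le> C * (b - a) * (K a - K b) / real (Suc n)" .
    moreover have "\<bar>F b - F a\<bar> \<le> (\<Sum>i<Suc n. \<bar>F (x (Suc i)) - F (x i)\<bar>)"
    proof -
      have "F b - F a = (\<Sum>i<Suc n. F (x (Suc i)) - F (x i))"
        by (subst sum_lessThan_telescope) (simp only: x0 xn)
      then show ?thesis by (metis sum_abs)
    qed
    ultimately show ?thesis by linarith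
  qed simp
  have "(\<lambda>n. C * (b - a) * (K a - K b) / real (Suc n)) \<longlonglongrightarrow> 0"
    by (rule LIMSEQ_Suc[OF lim_const_over_n])
  then have "\<bar>F b - F a\<bar> \<le> 0"
    by (rule LIMSEQ_le_const) (use le in auto)
  then show ?thesis by simp
qed

section \<open>The generating functional of a Poisson process\<close>

text \<open>With \<open>0 ^ 0 = 1\<close> the formula includes \<open>c = 0\<close>, where it is the
  void probability; the lowest level in \<open>poisson_pgfl\<close> is of that kind.\<close>

lemma (in prob_space) poisson_generating_function:
  fixes N :: "'a \<Rightarrow> nat"
  assumes [measurable]: "N \<in> M \<rightarrow>\<^sub>M count_space UNIV"
    and law: "\<And>k. prob {\<omega>\<in>space M. N \<omega> = k} = m ^ k / fact k * exp (- m)"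
    and "0 \<le> m" "0 \<le> c" "c \<le> 1"
  shows "expectation (\<lambda>\<omega>. c ^ N \<omega>) = exp (- ((1 - c) * m))"
proof -
  have "(\<integral>\<^sup>+\<omega>. ennreal (c ^ N \<omega>) \<partial>M) =
      (\<integral>\<^sup>+\<omega>. (\<Sum>k. ennreal (c ^ k) * indicator {\<omega>\<in>space M. N \<omega> = k} \<omega>) \<partial>M)"
  proof (rule nn_integral_cong)
    fix \<omega> assume "\<omega> \<in> space M"
    then have "(\<Sum>k. ennreal (c ^ k) * indicator {\<omega>\<in>space M. N \<omega> = k} \<omega>) =
        (\<Sum>k\<in>{N \<omega>}. ennreal (c ^ k) * indicator {\<omega>\<in>space M. N \<omega> = k} \<omega>)"
      by (intro suminf_finite) auto
    then show "ennreal (c ^ N \<omega>) = (\<Sum>k. ennreal (c ^ k) * indicator {\<omega>\<in>space M. N \<omega> = k} \<omega>)"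
      using \<open>\<omega> \<in> space M\<close> by simp
  qed
  also have "\<dots> = (\<Sum>k. ennreal (c ^ k) * emeasure M {\<omega>\<in>space M. N \<omega> = k})"
    by (subst nn_integral_suminf) (auto simp: nn_integral_cmult_indicator)
  also have "\<dots> = (\<Sum>k. ennreal ((c * m) ^ k / fact k * exp (- m)))"
    using assms(3,4) by (intro suminf_cong)
      (simp add: emeasure_eq_measure law ennreal_mult[symmetric] power_mult_distrib)
  also have "\<dots> = ennreal (exp (- ((1 - c) * m)))"
  proof (rule suminf_ennreal_eq)
    have "(\<lambda>k. (c * m) ^ k / fact k * exp (- m)) sums (exp (c * m) * exp (- m))"
      using exp_converges[of "c * m"] by (intro sums_mult2) (simp add: field_simps)
    then show "(\<lambda>k. (c * m) ^ k / fact k * exp (- m)) sums exp (- ((1 - c) * m))"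
      by (simp add: exp_add[symmetric] algebra_simps)
  qed (use assms in auto)
  finally show ?thesis
    using assms by (subst integral_eq_nn_integral) auto
qed

text \<open>The generating functional at a function with finitely many values: independence of the
  counts turns the expectation into a product of generating functions.\<close>

lemma poisson_pgfl_step:
  fixes \<Phi> :: "'w \<Rightarrow> 'b set" and B :: "nat \<Rightarrow> 'b set"
  assumes P: "poisson_point_process M \<mu> \<Phi>"
    and dj: "disjoint_family_on B {..<n}"
    and B: "\<And>j. j < n \<Longrightarrow> B j \<in> sets \<mu>" "\<And>j. j < n \<Longrightarrow> emeasure \<mu> (B j) < \<infinity>"
    and c: "\<And>j. j < n \<Longrightarrow> 0 \<le> c j" "\<And>j. j < n \<Longrightarrow> c j \<le> 1"
  shows "(\<integral>\<omega>. (\<Prod>j<n. c j ^ card (\<Phi> \<omega> \<inter> B j)) \<partial>M) = exp (- (\<Sum>j<n. (1 - c j) * measure \<mu> (B j)))"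
proof -
  interpret prob_space M using P by (simp add: poisson_point_process_def)
  have N: "(\<lambda>\<omega>. card (\<Phi> \<omega> \<inter> B j)) \<in> M \<rightarrow>\<^sub>M count_space UNIV"
    "prob {\<omega>\<in>space M. card (\<Phi> \<omega> \<inter> B j) = k} = measure \<mu> (B j) ^ k / fact k * exp (- measure \<mu> (B j))"
    if "j < n" for j k
    using P B[OF that] by (auto simp: poisson_point_process_def)
  have "indep_vars (\<lambda>_. count_space UNIV) (\<lambda>i \<omega>. card (\<Phi> \<omega> \<inter> B i)) {..<n}"
    using P[unfolded poisson_point_process_def, THEN conjunct2, THEN conjunct2, rule_format, of B n] dj B by blast
  then have "indep_vars (\<lambda>_. borel) (\<lambda>i \<omega>. c i ^ card (\<Phi> \<omega> \<inter> B i)) {..<n}"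
    by (rule indep_vars_compose2) auto
  then have "(\<integral>\<omega>. (\<Prod>j<n. c j ^ card (\<Phi> \<omega> \<inter> B j)) \<partial>M) = (\<Prod>j<n. \<integral>\<omega>. c j ^ card (\<Phi> \<omega> \<inter> B j) \<partial>M)"
  proof (rule indep_vars_lebesgue_integral[rotated])
    fix i assume "i \<in> {..<n}"
    then have i: "i < n" by simp
    note [measurable] = N(1)[OF i]
    show "integrable M (\<lambda>\<omega>. c i ^ card (\<Phi> \<omega> \<inter> B i))"
      using c[OF i] by (intro integrable_const_bound[where B = 1]) (auto simp: power_le_one)
  qed simp
  also have "\<dots> = (\<Prod>j<n. exp (- ((1 - c j) * measure \<mu> (B j))))"
    using N c by (intro prod.cong refl poisson_generating_function) auto
  also have "\<dots> = exp (- (\<Sum>j<n. (1 - c j) * measure \<mu> (B j)))"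
    by (simp add: exp_sum sum_negf[symmetric])
  finally show ?thesis .
qed

text \<open>The limit runs over finite products because the marks are specified for finitely many
  stations at a time. Outside \<open>K\<close> the factors are 1, so almost surely only finitely
  many others occur and the products are eventually constant. The expectation of their limit is
  found by a second approximation, rounding \<open>v\<close> down to finitely many values.\<close>

lemma poisson_pgfl:
  fixes X :: "nat \<Rightarrow> 'w \<Rightarrow> 'b" and v :: "'b \<Rightarrow> real"
  assumes P: "poisson_point_process M \<mu> (\<lambda>\<omega>. range (\<lambda>i. X i \<omega>))"
    and inj: "AE \<omega> in M. inj (\<lambda>i. X i \<omega>)"
    and X [measurable]: "\<And>i. X i \<in> M \<rightarrow>\<^sub>M \<mu>"
    and K [measurable]: "K \<in> sets \<mu>" and finK: "emeasure \<mu> K < \<infinity>"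
    and v [measurable]: "v \<in> borel_measurable \<mu>"
    and v0: "\<And>x. 0 \<le> v x" and v1: "\<And>x. v x \<le> 1" and vK: "\<And>x. x \<notin> K \<Longrightarrow> v x = 1"
  shows "(\<lambda>n. \<integral>\<omega>. (\<Prod>i<n. v (X i \<omega>)) \<partial>M) \<longlonglongrightarrow> exp (- (\<integral>x. 1 - v x \<partial>\<mu>))"
proof -
  interpret prob_space M using P by (simp add: poisson_point_process_def)
  define I where "I \<omega> = {i. X i \<omega> \<in> K}" for \<omega>
  have "AE \<omega> in M. finite (range (\<lambda>i. X i \<omega>) \<inter> K)"
    using P K finK by (auto simp: poisson_point_process_def)
  \<comment> \<open>Finitely many points in \<open>K\<close> give finitely many indices only because
    the enumeration is injective.\<close>
  with inj have fin: "AE \<omega> in M. finite (I \<omega>) \<and> inj (\<lambda>i. X i \<omega>)"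
  proof eventually_elim
    case (elim \<omega>)
    have "(\<lambda>i. X i \<omega>) ` I \<omega> = range (\<lambda>i. X i \<omega>) \<inter> K" by (auto simp: I_def)
    with elim show ?case by (metis finite_imageD inj_on_subset subset_UNIV)
  qed
  have prod01: "0 \<le> (\<Prod>i\<in>A. f i)" "(\<Prod>i\<in>A. f i) \<le> 1"
    if "\<And>i. i \<in> A \<Longrightarrow> 0 \<le> f i \<and> f i \<le> (1::real)" for A :: "nat set" and f
    using that by (auto intro: prod_nonneg prod_le_1)
  \<comment> \<open>A limit is measurable at once; almost surely it equals the product over the
    random index set \<open>I \<omega>\<close>.\<close>
  define g where "g \<omega> = lim (\<lambda>n. \<Prod>i<n. v (X i \<omega>))" for \<omega>
  have [measurable]: "g \<in> borel_measurable M" unfolding g_def by measurable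
  have conv: "(\<lambda>n. \<Prod>i<n. v (X i \<omega>)) \<longlonglongrightarrow> (\<Prod>i\<in>I \<omega>. v (X i \<omega>))" if "finite (I \<omega>)" for \<omega>
  proof (rule tendsto_eventually)
    obtain k where k: "I \<omega> \<subseteq> {..<k}" using finite_nat_bounded[OF \<open>finite (I \<omega>)\<close>] by blast
    have "(\<Prod>i<n. v (X i \<omega>)) = (\<Prod>i\<in>I \<omega>. v (X i \<omega>))" if "k \<le> n" for n
      using k that by (intro prod.mono_neutral_right) (auto simp: I_def vK)
    then show "eventually (\<lambda>n. (\<Prod>i<n. v (X i \<omega>)) = (\<Prod>i\<in>I \<omega>. v (X i \<omega>))) sequentially"
      unfolding eventually_sequentially by blast
  qed
  have g: "g \<omega> = (\<Prod>i\<in>I \<omega>. v (X i \<omega>))" if "finite (I \<omega>)" for \<omega>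
    unfolding g_def by (rule limI[OF conv[OF that]])
  have lim1: "(\<lambda>n. \<integral>\<omega>. (\<Prod>i<n. v (X i \<omega>)) \<partial>M) \<longlonglongrightarrow> (\<integral>\<omega>. g \<omega> \<partial>M)"
  proof (rule integral_dominated_convergence[where w = "\<lambda>_. 1"])
    show "AE \<omega> in M. (\<lambda>n. \<Prod>i<n. v (X i \<omega>)) \<longlonglongrightarrow> g \<omega>"
      using fin by eventually_elim (use conv g in auto)
    show "AE \<omega> in M. norm (\<Prod>i<n. v (X i \<omega>)) \<le> 1" for n
      using prod01[of "{..<n}"] v0 v1 by (auto simp: abs_of_nonneg)
  qed auto
  \<comment> \<open>The numerator obtained when \<open>v\<close> is rounded down to a multiple of
    \<open>1 / (m + 1)\<close>.\<close>
  define lvl where "lvl m x = nat \<lfloor>real (Suc m) * v x\<rfloor>" for m x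
  have [measurable]: "lvl m \<in> \<mu> \<rightarrow>\<^sub>M count_space UNIV" for m unfolding lvl_def by measurable
  have lvl_le: "real (lvl m x) \<le> real (Suc m) * v x" "real (Suc m) * v x - 1 \<le> real (lvl m x)" for m x
  proof -
    have "0 \<le> \<lfloor>real (Suc m) * v x\<rfloor>" using v0[of x] by (simp del: of_nat_Suc)
    then have "real (lvl m x) = of_int \<lfloor>real (Suc m) * v x\<rfloor>" by (simp add: lvl_def del: of_nat_Suc)
    then show "real (lvl m x) \<le> real (Suc m) * v x" "real (Suc m) * v x - 1 \<le> real (lvl m x)"
      by linarith+
  qed
  have lvl_Suc: "lvl m x \<le> Suc m" for m x
  proof -
    have "real (Suc m) * v x \<le> real (Suc m)" using v1[of x] by (simp add: mult_left_le del: of_nat_Suc)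
    with lvl_le(1)[of m x] show ?thesis by linarith
  qed
  define q where "q m x = real (lvl m x) / real (Suc m)" for m x
  have q01: "0 \<le> q m x" "q m x \<le> 1" for m x
    using lvl_Suc[of m x] by (auto simp: q_def divide_le_eq_1 simp del: of_nat_Suc)
  have [measurable]: "q m \<in> borel_measurable \<mu>" for m unfolding q_def by measurable
  have qlim: "(\<lambda>m. q m x) \<longlonglongrightarrow> v x" for x
  proof (rule tendsto_sandwich[of "\<lambda>m. v x - 1 / real (Suc m)" _ _ "\<lambda>_. v x"])
    show "\<forall>\<^sub>F m in sequentially. v x - 1 / real (Suc m) \<le> q m x"
    proof (intro always_eventually allI)
      fix m
      have "v x - 1 / real (Suc m) = (real (Suc m) * v x - 1) / real (Suc m)"
        by (simp add: field_simps del: of_nat_Suc)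
      also have "\<dots> \<le> q m x"
        unfolding q_def using lvl_le(2)[of m x] by (intro divide_right_mono) auto
      finally show "v x - 1 / real (Suc m) \<le> q m x" .
    qed
    show "\<forall>\<^sub>F m in sequentially. q m x \<le> v x"
      using lvl_le(1)[of _ x]
      by (intro always_eventually allI) (simp add: q_def pos_divide_le_eq mult.commute del: of_nat_Suc)
    show "(\<lambda>m. v x - 1 / real (Suc m)) \<longlonglongrightarrow> v x"
      using tendsto_diff[OF tendsto_const LIMSEQ_Suc[OF lim_const_over_n[of 1]], of "v x"] by simp
  qed simp
  \<comment> \<open>Intersecting with \<open>K\<close> gives the level sets finite measure; points
    outside \<open>K\<close> contribute the factor 1 anyway.\<close>
  define B where "B m j = {x\<in>K. lvl m x = j}" for m j
  have Bs [measurable]: "B m j \<in> sets \<mu>" for m j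
  proof -
    have "B m j = K \<inter> (lvl m -` {j} \<inter> space \<mu>)" using sets.sets_into_space[OF K] by (auto simp: B_def)
    also have "\<dots> \<in> sets \<mu>" by measurable
    finally show ?thesis .
  qed
  have Bfin: "emeasure \<mu> (B m j) < \<infinity>" for m j
    using emeasure_mono[of "B m j" K \<mu>] finK by (auto simp: B_def)
  let ?\<Phi> = "\<lambda>\<omega>. range (\<lambda>i. X i \<omega>)"
  have Bm [measurable]: "(\<lambda>\<omega>. card (?\<Phi> \<omega> \<inter> B m j)) \<in> M \<rightarrow>\<^sub>M count_space UNIV" for m j
    using P Bs Bfin by (auto simp: poisson_point_process_def)
  \<comment> \<open>Levels run from 0 to \<open>m + 1\<close>, the top one being attained where
    \<open>v\<close> is 1.\<close>
  define s where "s m \<omega> = (\<Prod>j<Suc (Suc m). (real j / real (Suc m)) ^ card (?\<Phi> \<omega> \<inter> B m j))" for m \<omega>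
  have s_eq: "s m \<omega> = (\<Prod>i\<in>I \<omega>. q m (X i \<omega>))" if "finite (I \<omega>)" "inj (\<lambda>i. X i \<omega>)" for m \<omega>
  proof -
    have "card (?\<Phi> \<omega> \<inter> B m j) = card {i\<in>I \<omega>. lvl m (X i \<omega>) = j}" for j
    proof -
      have "?\<Phi> \<omega> \<inter> B m j = (\<lambda>i. X i \<omega>) ` {i\<in>I \<omega>. lvl m (X i \<omega>) = j}" by (auto simp: B_def I_def)
      then show ?thesis using that(2) by (metis card_image inj_on_subset subset_UNIV)
    qed
    then have "s m \<omega> = (\<Prod>j<Suc (Suc m). \<Prod>i\<in>{i\<in>I \<omega>. lvl m (X i \<omega>) = j}. q m (X i \<omega>))"
      unfolding s_def by (intro prod.cong refl) (simp add: q_def)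
    also have "\<dots> = (\<Prod>i\<in>I \<omega>. q m (X i \<omega>))"
      using that lvl_Suc by (intro prod.group) (auto simp: less_Suc_eq_le)
    finally show ?thesis .
  qed
  have lim2: "(\<lambda>m. \<integral>\<omega>. s m \<omega> \<partial>M) \<longlonglongrightarrow> (\<integral>\<omega>. g \<omega> \<partial>M)"
  proof (rule integral_dominated_convergence[where w = "\<lambda>_. 1"])
    show "AE \<omega> in M. (\<lambda>m. s m \<omega>) \<longlonglongrightarrow> g \<omega>"
      using fin
    proof eventually_elim
      case (elim \<omega>)
      have "(\<lambda>m. \<Prod>i\<in>I \<omega>. q m (X i \<omega>)) \<longlonglongrightarrow> (\<Prod>i\<in>I \<omega>. v (X i \<omega>))"
        by (intro tendsto_prod qlim)
      with elim show ?case by (simp add: s_eq g)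
    qed
    show "AE \<omega> in M. norm (s m \<omega>) \<le> 1" for m
      using fin by eventually_elim (use prod01 q01 in \<open>auto simp: s_eq abs_of_nonneg\<close>)
    show "s m \<in> borel_measurable M" for m unfolding s_def by measurable
  qed auto
  have intq: "(\<Sum>j<Suc (Suc m). (1 - real j / real (Suc m)) * measure \<mu> (B m j)) = (\<integral>x. (1 - q m x) * indicator K x \<partial>\<mu>)" for m
  proof -
    have "(1 - q m x) * indicator K x = (\<Sum>j<Suc (Suc m). (1 - real j / real (Suc m)) * indicator (B m j) x)" for x
    proof -
      have "(\<Sum>j<Suc (Suc m). (1 - real j / real (Suc m)) * indicator (B m j) x) =
          (\<Sum>j<Suc (Suc m). if lvl m x = j then (1 - real j / real (Suc m)) * indicator K x else 0)"
        by (intro sum.cong refl) (auto simp: B_def indicator_def)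
      also have "\<dots> = (1 - q m x) * indicator K x"
        using lvl_Suc[of m x] by (subst sum.delta') (auto simp: q_def less_Suc_eq_le)
      finally show ?thesis by simp
    qed
    then have "(\<integral>x. (1 - q m x) * indicator K x \<partial>\<mu>) =
        (\<integral>x. (\<Sum>j<Suc (Suc m). (1 - real j / real (Suc m)) * indicator (B m j) x) \<partial>\<mu>)"
      by (simp only:)
    also have "\<dots> = (\<Sum>j<Suc (Suc m). (\<integral>x. (1 - real j / real (Suc m)) * indicator (B m j) x \<partial>\<mu>))"
      using Bfin by (intro Bochner_Integration.integral_sum integrable_mult_right) (simp add: less_top)
    also have "\<dots> = (\<Sum>j<Suc (Suc m). (1 - real j / real (Suc m)) * measure \<mu> (B m j))"
      using sets.sets_into_space[OF Bs] by (intro sum.cong refl) (simp add: Int_absorb2)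
    finally show ?thesis by simp
  qed
  have s_int: "(\<integral>\<omega>. s m \<omega> \<partial>M) = exp (- (\<integral>x. (1 - q m x) * indicator K x \<partial>\<mu>))" for m
    unfolding s_def intq[symmetric]
    by (rule poisson_pgfl_step[OF P])
       (use Bs Bfin in \<open>auto simp: disjoint_family_on_def B_def divide_le_eq_1 simp del: of_nat_Suc\<close>)
  have "(\<lambda>m. \<integral>x. (1 - q m x) * indicator K x \<partial>\<mu>) \<longlonglongrightarrow> (\<integral>x. (1 - v x) * indicator K x \<partial>\<mu>)"
  proof (rule integral_dominated_convergence[where w = "indicator K"])
    show "AE x in \<mu>. (\<lambda>m. (1 - q m x) * indicator K x) \<longlonglongrightarrow> (1 - v x) * indicator K x"
      by (intro AE_I2 tendsto_intros qlim)
    show "AE x in \<mu>. norm ((1 - q m x) * indicator K x) \<le> indicator K x" for m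
      using q01 by (intro AE_I2) (auto simp: indicator_def)
  qed (use finK in auto)
  then have "(\<lambda>m. \<integral>\<omega>. s m \<omega> \<partial>M) \<longlonglongrightarrow> exp (- (\<integral>x. (1 - v x) * indicator K x \<partial>\<mu>))"
    unfolding s_int by (intro tendsto_intros)
  then have "(\<integral>\<omega>. g \<omega> \<partial>M) = exp (- (\<integral>x. (1 - v x) * indicator K x \<partial>\<mu>))"
    using LIMSEQ_unique lim2 by blast
  also have "(\<integral>x. (1 - v x) * indicator K x \<partial>\<mu>) = (\<integral>x. 1 - v x \<partial>\<mu>)"
    by (intro Bochner_Integration.integral_cong) (auto simp: indicator_def vK)
  finally show ?thesis using lim1 by simp
qed

section \<open>Independent marking\<close>

lemma UNIV_link: "(UNIV :: link set) = {LOS, NLOS}"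
  using link.exhaust by blast

instance link :: finite
  by standard (simp add: UNIV_link)

lemma rician_factor_nonneg [simp]: "0 \<le> rician_factor s r"
  by (cases s) (simp_all add: from_dB_def)

lemma measurable_rician_factor [measurable]: "rician_factor s \<in> borel_measurable borel"
proof (cases s)
  case LOS
  have "rician_factor LOS = (\<lambda>r. from_dB (13 - 0.03 * (1000 * r)))" by auto
  then show ?thesis using LOS by (simp add: from_dB_def)
next
  case NLOS
  have "rician_factor NLOS = (\<lambda>r. from_dB 0)" by auto
  then show ?thesis using NLOS by simp
qed

lemma measurable_rician:
  assumes [measurable]: "f \<in> borel_measurable M" and f: "\<And>x. 0 \<le> f x"
  shows "(\<lambda>x. rician (f x)) \<in> M \<rightarrow>\<^sub>M prob_algebra borel"
proof (rule measurable_prob_algebraI)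
  show "prob_space (rician (f x))" for x using f by (rule prob_space_rician)
  show "(\<lambda>x. rician (f x)) \<in> M \<rightarrow>\<^sub>M subprob_algebra borel"
  proof (rule measurable_subprob_algebra)
    show "subprob_space (rician (f x))" for x
      using f by (intro prob_space_imp_subprob_space prob_space_rician)
    fix A :: "real set" assume [measurable]: "A \<in> sets borel"
    have [measurable]: "(\<lambda>p. rician_density (f (fst p)) (snd p)) \<in> borel_measurable (M \<Otimes>\<^sub>M borel)"
      by (rule measurable_compose[OF _ measurable_rician_density2, of "\<lambda>p. (f (fst p), snd p)", simplified]) measurable
    have "(\<lambda>x. \<integral>\<^sup>+y. ennreal (rician_density (f x) y) * indicator A y \<partial>lborel) \<in> borel_measurable M"
      by (rule lborel.borel_measurable_nn_integral) (simp add: split_beta')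
    then show "(\<lambda>x. emeasure (rician (f x)) A) \<in> borel_measurable M"
      unfolding rician_def by (subst emeasure_density) auto
  qed simp
qed

locale downlink =
  fixes V :: network and M :: "'w measure"
    and X :: "nat \<Rightarrow> 'w \<Rightarrow> real \<times> real" and S :: "nat \<Rightarrow> 'w \<Rightarrow> link" and G :: "nat \<Rightarrow> 'w \<Rightarrow> real"
  assumes valid: "valid_network V" and model: "downlink_model V M X S G"
begin

lemma poisson: "poisson_point_process M (scale_measure (ennreal (intensity V)) lborel) (\<lambda>\<omega>. range (\<lambda>i. X i \<omega>))"
  using model by (simp add: downlink_model_def)

sublocale prob_space M
  using poisson by (simp add: poisson_point_process_def)

lemma measurable_X [measurable]: "X i \<in> M \<rightarrow>\<^sub>M borel"
  and measurable_S [measurable]: "S i \<in> M \<rightarrow>\<^sub>M count_space UNIV"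
  and measurable_G [measurable]: "G i \<in> M \<rightarrow>\<^sub>M borel"
  using model by (simp_all add: downlink_model_def)

abbreviation "locations \<omega> \<equiv> (\<lambda>i. X i \<omega>)"

lemma measurable_locations [measurable]: "locations \<in> M \<rightarrow>\<^sub>M Pi\<^sub>M UNIV (\<lambda>_. borel)"
  by (rule measurable_PiM_single') (auto simp: space_PiM)

lemma measurable_los_prob [measurable]: "los_prob V \<in> borel_measurable borel"
  using valid by (simp add: valid_network_def)

lemma measurable_link_prob [measurable]: "link_prob V s \<in> borel_measurable borel"
proof (cases s)
  case LOS
  have "link_prob V LOS = los_prob V" by auto
  then show ?thesis using LOS by simp
next
  case NLOS
  have "link_prob V NLOS = (\<lambda>r. 1 - los_prob V r)" by auto
  then show ?thesis using NLOS by simp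
qed

lemma breakpoint_nonneg: "n \<le> pieces V \<Longrightarrow> 0 \<le> breakpoint V n"
proof (induction n)
  case 0
  then show ?case using valid by (simp add: valid_network_def)
next
  case (Suc n)
  then have "breakpoint V n < breakpoint V (Suc n)" using valid by (simp add: valid_network_def)
  with Suc show ?case by (simp add: order.strict_implies_order order.trans)
qed

lemma on_piece_pos:
  assumes "n \<in> {1..pieces V}" "on_piece V n r" shows "0 < r"
proof -
  have "0 \<le> breakpoint V (n - 1)" using assms by (intro breakpoint_nonneg) auto
  also have "\<dots> < ereal r" using assms by (simp add: on_piece_def)
  finally show ?thesis by simp
qed

lemma piecewise_nonpos: "r \<le> 0 \<Longrightarrow> piecewise V f r = 0"
  unfolding piecewise_def by (rule sum.neutral) (use on_piece_pos in force)

lemma link_prob_nonneg: "0 \<le> link_prob V s r" and link_prob_le_1: "link_prob V s r \<le> 1"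
proof -
  have "los_prob V r \<in> {0..1}"
    using valid by (cases "0 < r") (auto simp: valid_network_def los_prob_def piecewise_nonpos)
  then show "0 \<le> link_prob V s r" "link_prob V s r \<le> 1" by (cases s; simp)+
qed

lemma sum_link_prob: "(\<Sum>s\<in>UNIV. link_prob V s r) = 1"
  by (simp add: UNIV_link)

lemma measurable_emeasure_rician_factor [measurable]:
  assumes [measurable]: "B \<in> sets borel" "f \<in> borel_measurable N"
  shows "(\<lambda>x. emeasure (rician (rician_factor s (f x))) B) \<in> borel_measurable N"
  by (rule measurable_compose[OF measurable_prob_algebraD[OF measurable_rician] measurable_emeasure_subprob_algebra])
     simp_all

text \<open>The conditional probability, given the locations \<open>x\<close>, that each of the
  first \<open>n\<close> stations meets the constraints \<open>A i s\<close> and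
  \<open>B i s\<close> belonging to its own type \<open>s\<close>. Type-dependent location sets are
  what exclusion discs of different radii require.\<close>

definition mark_weight :: "nat \<Rightarrow> (nat \<Rightarrow> link \<Rightarrow> (real \<times> real) set) \<Rightarrow> (nat \<Rightarrow> link \<Rightarrow> real set) \<Rightarrow> (nat \<Rightarrow> real \<times> real) \<Rightarrow> ennreal" where
  "mark_weight n A B x = (\<Prod>i<n. \<Sum>s\<in>UNIV. indicator (A i s) (x i) * ennreal (link_prob V s (norm (x i))) *
     emeasure (rician (rician_factor s (norm (x i)))) (B i s))"

lemma measurable_mark_weight [measurable]:
  assumes [measurable]: "\<And>i s. A i s \<in> sets borel" "\<And>i s. B i s \<in> sets borel"
  shows "mark_weight n A B \<in> borel_measurable (Pi\<^sub>M UNIV (\<lambda>_. borel))"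
  unfolding mark_weight_def by measurable

text \<open>The model speaks about one fixed assignment of types. The event is split over all
  assignments \<sigma>, each absorbing its location constraints into \<open>A' \<sigma>\<close>, and
  the distributive law turns the sum of products over \<sigma> back into a product of sums.\<close>

lemma emeasure_marks:
  assumes A0 [measurable]: "A0 \<in> sets (Pi\<^sub>M UNIV (\<lambda>_. borel))"
    and A [measurable]: "\<And>i s. A i s \<in> sets borel" and B [measurable]: "\<And>i s. B i s \<in> sets borel"
  shows "emeasure M {\<omega>\<in>space M. locations \<omega> \<in> A0 \<and> (\<forall>i<n. X i \<omega> \<in> A i (S i \<omega>) \<and> G i \<omega> \<in> B i (S i \<omega>))} =
    (\<integral>\<^sup>+\<omega>\<in>{\<omega>\<in>space M. locations \<omega> \<in> A0}. mark_weight n A B (locations \<omega>) \<partial>M)"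
proof -
  define \<Sigma> where "\<Sigma> = (\<Pi>\<^sub>E i\<in>{..<n}. (UNIV :: link set))"
  have \<Sigma>: "finite \<Sigma>" by (auto simp: \<Sigma>_def intro!: finite_PiE)
  define A' where "A' \<sigma> = A0 \<inter> {x. \<forall>i<n. x i \<in> A i (\<sigma> i)}" for \<sigma> :: "nat \<Rightarrow> link"
  have A' [measurable]: "A' \<sigma> \<in> sets (Pi\<^sub>M UNIV (\<lambda>_. borel))" for \<sigma>
  proof -
    have "{x\<in>space (Pi\<^sub>M UNIV (\<lambda>_. borel)). \<forall>i<n. x i \<in> A i (\<sigma> i)} \<in> sets (Pi\<^sub>M UNIV (\<lambda>_. borel))"
      by measurable
    then show ?thesis unfolding A'_def by (simp add: space_PiM)
  qed
  define D where "D \<sigma> = {\<omega>\<in>space M. locations \<omega> \<in> A' \<sigma> \<and> (\<forall>i<n. S i \<omega> = \<sigma> i \<and> G i \<omega> \<in> B i (\<sigma> i))}" for \<sigma>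
  have D_sets: "D \<sigma> \<in> sets M" for \<sigma>
    unfolding D_def by measurable
  have "{\<omega>\<in>space M. locations \<omega> \<in> A0 \<and> (\<forall>i<n. X i \<omega> \<in> A i (S i \<omega>) \<and> G i \<omega> \<in> B i (S i \<omega>))} = (\<Union>\<sigma>\<in>\<Sigma>. D \<sigma>)"
  proof (intro equalityI subsetI)
    fix \<omega> assume \<omega>: "\<omega> \<in> {\<omega>\<in>space M. locations \<omega> \<in> A0 \<and> (\<forall>i<n. X i \<omega> \<in> A i (S i \<omega>) \<and> G i \<omega> \<in> B i (S i \<omega>))}"
    then have "\<omega> \<in> D (restrict (\<lambda>i. S i \<omega>) {..<n})" by (auto simp: D_def A'_def)
    moreover have "restrict (\<lambda>i. S i \<omega>) {..<n} \<in> \<Sigma>" by (auto simp: \<Sigma>_def)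
    ultimately show "\<omega> \<in> (\<Union>\<sigma>\<in>\<Sigma>. D \<sigma>)" by blast
  qed (auto simp: D_def A'_def)
  moreover have "disjoint_family_on D \<Sigma>"
    unfolding disjoint_family_on_def
  proof (intro ballI impI)
    fix \<sigma> \<tau> assume "\<sigma> \<in> \<Sigma>" "\<tau> \<in> \<Sigma>" "\<sigma> \<noteq> \<tau>"
    then obtain i where "i < n" "\<sigma> i \<noteq> \<tau> i"
      unfolding \<Sigma>_def by (metis PiE_ext lessThan_iff)
    then show "D \<sigma> \<inter> D \<tau> = {}" by (auto simp: D_def)
  qed
  ultimately have "emeasure M {\<omega>\<in>space M. locations \<omega> \<in> A0 \<and> (\<forall>i<n. X i \<omega> \<in> A i (S i \<omega>) \<and> G i \<omega> \<in> B i (S i \<omega>))} =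
      (\<Sum>\<sigma>\<in>\<Sigma>. emeasure M (D \<sigma>))"
    using D_sets \<Sigma> by (simp add: sum_emeasure image_subset_iff)
  also have "\<dots> = (\<Sum>\<sigma>\<in>\<Sigma>. \<integral>\<^sup>+\<omega>\<in>{\<omega>\<in>space M. locations \<omega> \<in> A' \<sigma>}.
      (\<Prod>i<n. ennreal (link_prob V (\<sigma> i) (norm (X i \<omega>))) *
         emeasure (rician (rician_factor (\<sigma> i) (norm (X i \<omega>)))) (B i (\<sigma> i))) \<partial>M)"
  proof (intro sum.cong refl)
    fix \<sigma>
    show "emeasure M (D \<sigma>) = (\<integral>\<^sup>+\<omega>\<in>{\<omega>\<in>space M. locations \<omega> \<in> A' \<sigma>}.
      (\<Prod>i<n. ennreal (link_prob V (\<sigma> i) (norm (X i \<omega>))) *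
         emeasure (rician (rician_factor (\<sigma> i) (norm (X i \<omega>)))) (B i (\<sigma> i))) \<partial>M)"
      unfolding D_def
      using model[unfolded downlink_model_def, THEN conjunct2, THEN conjunct2, THEN conjunct2, rule_format,
          of "A' \<sigma>" n "\<lambda>i. B i (\<sigma> i)" \<sigma>] A' B by blast
  qed
  also have "\<dots> = (\<Sum>\<sigma>\<in>\<Sigma>. \<integral>\<^sup>+\<omega>\<in>{\<omega>\<in>space M. locations \<omega> \<in> A0}.
      (\<Prod>i<n. indicator (A i (\<sigma> i)) (X i \<omega>) * ennreal (link_prob V (\<sigma> i) (norm (X i \<omega>))) *
         emeasure (rician (rician_factor (\<sigma> i) (norm (X i \<omega>)))) (B i (\<sigma> i))) \<partial>M)"
  proof (intro sum.cong refl nn_integral_cong)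
    fix \<sigma> \<omega> assume "\<omega> \<in> space M"
    let ?p = "\<lambda>i. ennreal (link_prob V (\<sigma> i) (norm (X i \<omega>))) *
         emeasure (rician (rician_factor (\<sigma> i) (norm (X i \<omega>)))) (B i (\<sigma> i))"
    show "(\<Prod>i<n. ?p i) * indicator {\<omega>\<in>space M. locations \<omega> \<in> A' \<sigma>} \<omega> =
        (\<Prod>i<n. indicator (A i (\<sigma> i)) (X i \<omega>) * ennreal (link_prob V (\<sigma> i) (norm (X i \<omega>))) *
         emeasure (rician (rician_factor (\<sigma> i) (norm (X i \<omega>)))) (B i (\<sigma> i))) * indicator {\<omega>\<in>space M. locations \<omega> \<in> A0} \<omega>"
    proof (cases "\<forall>i<n. X i \<omega> \<in> A i (\<sigma> i)")
      case True
      then have "(\<Prod>i<n. indicator (A i (\<sigma> i)) (X i \<omega>) * ennreal (link_prob V (\<sigma> i) (norm (X i \<omega>))) *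
         emeasure (rician (rician_factor (\<sigma> i) (norm (X i \<omega>)))) (B i (\<sigma> i))) = (\<Prod>i<n. ?p i)"
        by (intro prod.cong) auto
      moreover have "locations \<omega> \<in> A' \<sigma> \<longleftrightarrow> locations \<omega> \<in> A0" using True by (auto simp: A'_def)
      ultimately show ?thesis by (simp add: indicator_def)
    next
      case False
      then obtain i where i: "i < n" "X i \<omega> \<notin> A i (\<sigma> i)" by blast
      then have "(\<Prod>i<n. indicator (A i (\<sigma> i)) (X i \<omega>) * ennreal (link_prob V (\<sigma> i) (norm (X i \<omega>))) *
         emeasure (rician (rician_factor (\<sigma> i) (norm (X i \<omega>)))) (B i (\<sigma> i))) = 0"
        by (intro prod_zero bexI[of _ i]) auto
      moreover have "locations \<omega> \<notin> A' \<sigma>" using False by (auto simp: A'_def)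
      ultimately show ?thesis by simp
    qed
  qed
  also have "\<dots> = (\<integral>\<^sup>+\<omega>\<in>{\<omega>\<in>space M. locations \<omega> \<in> A0}. mark_weight n A B (locations \<omega>) \<partial>M)"
    unfolding mark_weight_def \<Sigma>_def[symmetric]
    by (subst nn_integral_sum[symmetric]) (auto simp: prod_sum_PiE \<Sigma>_def sum_distrib_right intro!: nn_integral_cong)
  finally show ?thesis .
qed

text \<open>\<open>emeasure_marks\<close> says that two measures on sequences of locations agree on
  every measurable set, so their integrals of \<phi> agree as well.\<close>

lemma nn_integral_marks:
  assumes A [measurable]: "\<And>i s. A i s \<in> sets borel" and B [measurable]: "\<And>i s. B i s \<in> sets borel"
    and \<phi> [measurable]: "\<phi> \<in> borel_measurable (Pi\<^sub>M UNIV (\<lambda>_. borel))"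
  shows "(\<integral>\<^sup>+\<omega>\<in>{\<omega>\<in>space M. \<forall>i<n. X i \<omega> \<in> A i (S i \<omega>) \<and> G i \<omega> \<in> B i (S i \<omega>)}. \<phi> (locations \<omega>) \<partial>M) =
    (\<integral>\<^sup>+\<omega>. \<phi> (locations \<omega>) * mark_weight n A B (locations \<omega>) \<partial>M)"
proof -
  let ?E = "{\<omega>\<in>space M. \<forall>i<n. X i \<omega> \<in> A i (S i \<omega>) \<and> G i \<omega> \<in> B i (S i \<omega>)}"
  let ?P = "Pi\<^sub>M UNIV (\<lambda>_::nat. borel :: (real \<times> real) measure)"
  have E [measurable]: "?E \<in> sets M"
  proof -
    have "?E = {\<omega>\<in>space M. \<forall>i<n. \<exists>s\<in>UNIV. S i \<omega> = s \<and> X i \<omega> \<in> A i s \<and> G i \<omega> \<in> B i s}" by auto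
    also have "\<dots> \<in> sets M" by measurable
    finally show ?thesis .
  qed
  have eq: "distr (density M (indicator ?E)) ?P locations = distr (density M (\<lambda>\<omega>. mark_weight n A B (locations \<omega>))) ?P locations"
  proof (rule measure_eqI)
    fix A0 assume "A0 \<in> sets (distr (density M (indicator ?E)) ?P locations)"
    then have [measurable]: "A0 \<in> sets ?P" by simp
    have "emeasure (distr (density M (indicator ?E)) ?P locations) A0 =
        (\<integral>\<^sup>+\<omega>. indicator ?E \<omega> * indicator (locations -` A0 \<inter> space M) \<omega> \<partial>M)"
      by (subst emeasure_distr, simp, simp, subst emeasure_density) auto
    also have "\<dots> = (\<integral>\<^sup>+\<omega>. indicator {\<omega>\<in>space M. locations \<omega> \<in> A0 \<and> (\<forall>i<n. X i \<omega> \<in> A i (S i \<omega>) \<and> G i \<omega> \<in> B i (S i \<omega>))} \<omega> \<partial>M)"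
      by (intro nn_integral_cong) (auto split: split_indicator)
    also have "\<dots> = emeasure M {\<omega>\<in>space M. locations \<omega> \<in> A0 \<and> (\<forall>i<n. X i \<omega> \<in> A i (S i \<omega>) \<and> G i \<omega> \<in> B i (S i \<omega>))}"
    proof (rule nn_integral_indicator)
      have "{\<omega>\<in>space M. locations \<omega> \<in> A0 \<and> (\<forall>i<n. X i \<omega> \<in> A i (S i \<omega>) \<and> G i \<omega> \<in> B i (S i \<omega>))} =
          ?E \<inter> (locations -` A0 \<inter> space M)" by auto
      also have "\<dots> \<in> sets M" by measurable
      finally show "{\<omega>\<in>space M. locations \<omega> \<in> A0 \<and> (\<forall>i<n. X i \<omega> \<in> A i (S i \<omega>) \<and> G i \<omega> \<in> B i (S i \<omega>))} \<in> sets M" .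
    qed
    also have "\<dots> = (\<integral>\<^sup>+\<omega>\<in>{\<omega>\<in>space M. locations \<omega> \<in> A0}. mark_weight n A B (locations \<omega>) \<partial>M)"
      by (rule emeasure_marks) measurable
    also have "\<dots> = (\<integral>\<^sup>+\<omega>. mark_weight n A B (locations \<omega>) * indicator (locations -` A0 \<inter> space M) \<omega> \<partial>M)"
      by (intro nn_integral_cong) (auto split: split_indicator)
    also have "\<dots> = emeasure (distr (density M (\<lambda>\<omega>. mark_weight n A B (locations \<omega>))) ?P locations) A0"
      by (subst emeasure_distr, simp, simp, subst emeasure_density) auto
    finally show "emeasure (distr (density M (indicator ?E)) ?P locations) A0 =
      emeasure (distr (density M (\<lambda>\<omega>. mark_weight n A B (locations \<omega>))) ?P locations) A0" .
  qed simp
  have "(\<integral>\<^sup>+\<omega>\<in>?E. \<phi> (locations \<omega>) \<partial>M) = (\<integral>\<^sup>+x. \<phi> x \<partial>distr (density M (indicator ?E)) ?P locations)"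
    by (subst nn_integral_distr, simp, simp, subst nn_integral_density) (auto simp: mult.commute)
  also have "\<dots> = (\<integral>\<^sup>+\<omega>. \<phi> (locations \<omega>) * mark_weight n A B (locations \<omega>) \<partial>M)"
    unfolding eq by (subst nn_integral_distr, simp, simp, subst nn_integral_density) (auto simp: mult.commute)
  finally show ?thesis .
qed

section \<open>Independence of one gain from all other marks\<close>

definition mark_event :: "nat \<Rightarrow> (nat \<Rightarrow> real \<times> real) set \<Rightarrow> (nat \<Rightarrow> link \<Rightarrow> real set) \<Rightarrow> 'w set" where
  "mark_event n L B = {\<omega>\<in>space M. locations \<omega> \<in> L \<and> (\<forall>j<n. G j \<omega> \<in> B j (S j \<omega>))}"

text \<open>For station \<open>i\<close> only the type is constrained (through an empty \<open>B i s\<close>), never the gain.\<close>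

definition other_marks_events :: "nat \<Rightarrow> 'w set set" where
  "other_marks_events i = {mark_event n L B | n L B.
     L \<in> sets (Pi\<^sub>M UNIV (\<lambda>_. borel)) \<and> (\<forall>j s. B j s \<in> sets borel) \<and> (\<forall>s. B i s \<in> {UNIV, {}})}"

text \<open>The information contained in all locations, all types and all gains except that of
  station \<open>i\<close>. It is generated by an intersection-stable family of events whose
  probabilities the model determines, so that measures can be compared on that family.\<close>

definition other_marks :: "nat \<Rightarrow> 'w measure" where
  "other_marks i = sigma (space M) (other_marks_events i)"

lemma UNIV_in_sets_PiM: "UNIV \<in> sets (Pi\<^sub>M UNIV (\<lambda>_::nat. borel :: (real \<times> real) measure))"
  using sets.top[of "Pi\<^sub>M UNIV (\<lambda>_::nat. borel :: (real \<times> real) measure)"] by (simp add: space_PiM)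

lemma other_marks_eventsI:
  assumes "L \<in> sets (Pi\<^sub>M UNIV (\<lambda>_. borel))" "\<And>j s. B j s \<in> sets borel" "\<And>s. B i s \<in> {UNIV, {}}"
    "D = mark_event n L B"
  shows "D \<in> other_marks_events i"
  unfolding other_marks_events_def using assms by blast

lemma other_marks_eventsE:
  assumes "D \<in> other_marks_events i"
  obtains L n B where "D = mark_event n L B"
    "L \<in> sets (Pi\<^sub>M UNIV (\<lambda>_. borel))" "\<And>j s. B j s \<in> sets borel" "\<And>s. B i s \<in> {UNIV, {}}"
  using assms unfolding other_marks_events_def by blast

lemma mark_event_sets:
  assumes [measurable]: "L \<in> sets (Pi\<^sub>M UNIV (\<lambda>_. borel))" "\<And>j s. B j s \<in> sets borel"
  shows "mark_event n L B \<in> sets M"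
proof -
  have "mark_event n L B =
      {\<omega>\<in>space M. locations \<omega> \<in> L \<and> (\<forall>j<n. \<exists>s\<in>UNIV. S j \<omega> = s \<and> G j \<omega> \<in> B j s)}"
    by (auto simp: mark_event_def)
  also have "\<dots> \<in> sets M" by measurable
  finally show ?thesis .
qed

lemma other_marks_events_sets: "other_marks_events i \<subseteq> sets M"
  by (auto elim!: other_marks_eventsE intro: mark_event_sets)

lemma other_marks_events_Pow: "other_marks_events i \<subseteq> Pow (space M)"
  by (auto elim!: other_marks_eventsE simp: mark_event_def)

lemma space_other_marks [simp]: "space (other_marks i) = space M"
  using other_marks_events_Pow by (simp add: other_marks_def space_measure_of)

lemma sets_other_marks: "sets (other_marks i) = sigma_sets (space M) (other_marks_events i)"
  using other_marks_events_Pow by (simp add: other_marks_def sets_measure_of)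

lemma subalgebra_other_marks: "subalgebra M (other_marks i)"
  unfolding subalgebra_def sets_other_marks
  using sets.sigma_sets_subset[OF other_marks_events_sets] by simp

lemma Int_stable_other_marks_events: "Int_stable (other_marks_events i)"
proof (rule Int_stableI)
  fix D D' assume *: "D \<in> other_marks_events i" "D' \<in> other_marks_events i"
  obtain A0 n B where
    D: "D = mark_event n A0 B"
    and A0: "A0 \<in> sets (Pi\<^sub>M UNIV (\<lambda>_. borel))" and B: "\<And>j s. B j s \<in> sets borel" "\<And>s. B i s \<in> {UNIV, {}}"
    using *(1) by (rule other_marks_eventsE) blast
  obtain A0' n' B' where
    D': "D' = mark_event n' A0' B'"
    and A0': "A0' \<in> sets (Pi\<^sub>M UNIV (\<lambda>_. borel))" and B': "\<And>j s. B' j s \<in> sets borel" "\<And>s. B' i s \<in> {UNIV, {}}"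
    using *(2) by (rule other_marks_eventsE) blast
  show "D \<inter> D' \<in> other_marks_events i"
  proof (rule other_marks_eventsI)
    \<comment> \<open>Beyond its own length an event imposes no constraint, so each is padded with
      \<open>UNIV\<close> to the common length.\<close>
    let ?B = "\<lambda>j s. (if j < n then B j s else UNIV) \<inter> (if j < n' then B' j s else UNIV)"
    show "A0 \<inter> A0' \<in> sets (Pi\<^sub>M UNIV (\<lambda>_. borel))" using A0 A0' by (rule sets.Int)
    show "?B j s \<in> sets borel" for j s using B B' by auto
    show "?B i s \<in> {UNIV, {}}" for s using B(2)[of s] B'(2)[of s] by auto
    show "D \<inter> D' = mark_event (max n n') (A0 \<inter> A0') ?B"
    proof -
      have "(\<forall>j<max n n'. G j \<omega> \<in> ?B j (S j \<omega>)) \<longleftrightarrow>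
          (\<forall>j<n. G j \<omega> \<in> B j (S j \<omega>)) \<and> (\<forall>j<n'. G j \<omega> \<in> B' j (S j \<omega>))" for \<omega>
      proof -
        have "G j \<omega> \<in> ?B j (S j \<omega>) \<longleftrightarrow> (j < n \<longrightarrow> G j \<omega> \<in> B j (S j \<omega>)) \<and> (j < n' \<longrightarrow> G j \<omega> \<in> B' j (S j \<omega>))" for j
          by simp
        then show ?thesis by (simp only: less_max_iff_disj) blast
      qed
      then show ?thesis unfolding D D' mark_event_def by (simp only: Int_iff) blast
    qed
  qed
qed

lemma measurable_other_marks_X [measurable]: "X j \<in> other_marks i \<rightarrow>\<^sub>M borel"
proof (rule measurableI)
  fix A :: "(real \<times> real) set" assume [measurable]: "A \<in> sets borel"
  have "{x\<in>space (Pi\<^sub>M UNIV (\<lambda>_. borel)). x j \<in> A} \<in> sets (Pi\<^sub>M UNIV (\<lambda>_. borel))" by measurable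
  then have "X j -` A \<inter> space (other_marks i) \<in> other_marks_events i"
    by (rule other_marks_eventsI[where B = "\<lambda>_ _. UNIV" and n = 0]) (auto simp: space_PiM mark_event_def)
  then show "X j -` A \<inter> space (other_marks i) \<in> sets (other_marks i)"
    by (auto simp: sets_other_marks)
qed simp

lemma measurable_other_marks_S [measurable]: "S j \<in> other_marks i \<rightarrow>\<^sub>M count_space UNIV"
proof (rule measurable_count_space_eq2[THEN iffD2, OF finite, rule_format], intro conjI ballI)
  fix s
  \<comment> \<open>Type \<open>s\<close> at station \<open>j\<close> is encoded by forbidding every
    gain under the other type; the sets used are \<open>UNIV\<close> or empty, so this is a
    generating event even when \<open>j = i\<close>.\<close>
  have "S j -` {s} \<inter> space (other_marks i) \<in> other_marks_events i"
    by (rule other_marks_eventsI[where L = UNIV and n = "Suc j" and B = "\<lambda>k t. if k = j \<and> t \<noteq> s then {} else UNIV"])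
       (auto simp: mark_event_def UNIV_in_sets_PiM)
  then show "S j -` {s} \<inter> space (other_marks i) \<in> sets (other_marks i)"
    by (auto simp: sets_other_marks)
qed simp

lemma measurable_other_marks_G:
  assumes "j \<noteq> i" shows "G j \<in> other_marks i \<rightarrow>\<^sub>M borel"
proof (rule measurableI)
  fix A :: "real set" assume "A \<in> sets borel"
  then have "G j -` A \<inter> space (other_marks i) \<in> other_marks_events i"
    using assms
    by (intro other_marks_eventsI[where L = UNIV and n = "Suc j" and B = "\<lambda>k t. if k = j then A else UNIV"])
       (auto simp: mark_event_def UNIV_in_sets_PiM)
  then show "G j -` A \<inter> space (other_marks i) \<in> sets (other_marks i)"
    by (auto simp: sets_other_marks)
qed simp

text \<open>The candidate for the law of \<open>G i\<close> given \<open>other_marks i\<close>: it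
  depends on \<omega> only through the type and the location of station \<open>i\<close>, both
  measurable for that sigma-algebra.\<close>

definition gain_law :: "nat \<Rightarrow> 'w \<Rightarrow> real measure" where
  "gain_law i \<omega> = rician (rician_factor (S i \<omega>) (norm (X i \<omega>)))"

lemma measurable_gain_law:
  assumes [measurable]: "X i \<in> N \<rightarrow>\<^sub>M borel" "S i \<in> N \<rightarrow>\<^sub>M count_space UNIV"
  shows "gain_law i \<in> N \<rightarrow>\<^sub>M prob_algebra borel"
proof -
  have [measurable]: "(\<lambda>\<omega>. rician_factor (S i \<omega>) (norm (X i \<omega>))) \<in> borel_measurable N"
    by (rule measurable_compose_countable'[where f = "\<lambda>s \<omega>. rician_factor s (norm (X i \<omega>))" and g = "S i" and I = UNIV]) auto
  show ?thesis unfolding gain_law_def by (rule measurable_rician) simp_all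
qed

text \<open>Both sides become integrals over the locations with the same factor \<open>R\<close> for
  the other stations. At station \<open>i\<close> each type is either unconstrained or excluded, so
  the probability of that constraint and the probability of \<open>C\<close> multiply.\<close>

lemma gain_rectangle_event:
  assumes D: "D \<in> other_marks_events i" and C [measurable]: "C \<in> sets borel"
  shows "emeasure M {\<omega>\<in>D. G i \<omega> \<in> C} = (\<integral>\<^sup>+\<omega>\<in>D. emeasure (gain_law i \<omega>) C \<partial>M)"
proof -
  obtain A0 n B0 where D0: "D = mark_event n A0 B0"
    and A0 [measurable]: "A0 \<in> sets (Pi\<^sub>M UNIV (\<lambda>_. borel))"
    and B0: "\<And>j s. B0 j s \<in> sets borel" "\<And>s. B0 i s \<in> {UNIV, {}}"
    using D by (rule other_marks_eventsE) blast
  \<comment> \<open>Long enough to include station \<open>i\<close> even when the event constrains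
    fewer stations.\<close>
  define N where "N = Suc (max n i)"
  define B where "B j s = (if j < n then B0 j s else UNIV)" for j s
  have B [measurable]: "B j s \<in> sets borel" and Bi: "B i s \<in> {UNIV, {}}" for j s
    using B0(1)[of j s] B0(2)[of s] by (auto simp: B_def)
  have iN: "i < N" by (simp add: N_def)
  have DB: "D = {\<omega>\<in>space M. locations \<omega> \<in> A0 \<and> (\<forall>j<N. G j \<omega> \<in> B j (S j \<omega>))}"
    unfolding D0 B_def N_def mark_event_def by auto
  define U where "U = (\<lambda>(_::nat) (_::link). UNIV :: (real \<times> real) set)"
  have U [measurable]: "U j s \<in> sets borel" for j s by (simp add: U_def)
  define R where "R x = (\<Prod>j\<in>{..<N} - {i}. \<Sum>s\<in>UNIV. indicator (U j s) (x j) * ennreal (link_prob V s (norm (x j))) *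
     emeasure (rician (rician_factor s (norm (x j)))) (B j s))" for x
  have mw: "mark_weight N U B' x = (\<Sum>s\<in>UNIV. ennreal (link_prob V s (norm (x i))) *
      emeasure (rician (rician_factor s (norm (x i)))) (B' i s)) * R x"
    if "\<And>j s. j \<noteq> i \<Longrightarrow> B' j s = B j s" for B' x
  proof -
    have "mark_weight N U B' x = (\<Sum>s\<in>UNIV. indicator (U i s) (x i) * ennreal (link_prob V s (norm (x i))) *
      emeasure (rician (rician_factor s (norm (x i)))) (B' i s)) *
      (\<Prod>j\<in>{..<N} - {i}. \<Sum>s\<in>UNIV. indicator (U j s) (x j) * ennreal (link_prob V s (norm (x j))) *
     emeasure (rician (rician_factor s (norm (x j)))) (B' j s))"
      unfolding mark_weight_def using iN by (intro prod.remove) auto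
    also have "(\<Prod>j\<in>{..<N} - {i}. \<Sum>s\<in>UNIV. indicator (U j s) (x j) * ennreal (link_prob V s (norm (x j))) *
     emeasure (rician (rician_factor s (norm (x j)))) (B' j s)) = R x"
      unfolding R_def using that by (intro prod.cong sum.cong refl) auto
    finally show ?thesis by (simp add: U_def)
  qed
  define BC where "BC j s = (if j = i then B i s \<inter> C else B j s)" for j s
  have BC [measurable]: "BC j s \<in> sets borel" for j s by (simp add: BC_def)
  have "emeasure M {\<omega>\<in>D. G i \<omega> \<in> C} =
      emeasure M {\<omega>\<in>space M. locations \<omega> \<in> A0 \<and> (\<forall>j<N. X j \<omega> \<in> U j (S j \<omega>) \<and> G j \<omega> \<in> BC j (S j \<omega>))}"
    using iN by (intro arg_cong[where f = "emeasure M"]) (auto simp: DB BC_def U_def)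
  also have "\<dots> = (\<integral>\<^sup>+\<omega>\<in>{\<omega>\<in>space M. locations \<omega> \<in> A0}. mark_weight N U BC (locations \<omega>) \<partial>M)"
    by (rule emeasure_marks) measurable
  also have "\<dots> = (\<integral>\<^sup>+\<omega>. (\<Sum>s\<in>UNIV. ennreal (link_prob V s (norm (X i \<omega>))) *
      emeasure (rician (rician_factor s (norm (X i \<omega>)))) (B i s \<inter> C)) * R (locations \<omega>) * indicator A0 (locations \<omega>) \<partial>M)"
    by (intro nn_integral_cong) (auto simp: mw BC_def split: split_indicator)
  finally have lhs: "emeasure M {\<omega>\<in>D. G i \<omega> \<in> C} = \<dots>" .
  \<comment> \<open>\<open>gain_law\<close> depends on the type of station \<open>i\<close>; fixing
    that type to be \<open>s\<close> leaves an integrand in the locations alone, to which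
    \<open>nn_integral_marks\<close> applies.\<close>
  define Bs where "Bs s j t = (if j = i \<and> t \<noteq> s then {} else B j t)" for s t :: link and j
  have Bs [measurable]: "Bs s j t \<in> sets borel" for s j t by (simp add: Bs_def)
  define \<phi> where "\<phi> s x = emeasure (rician (rician_factor s (norm (x i)))) C * indicator A0 x" for s and x :: "nat \<Rightarrow> real \<times> real"
  have [measurable]: "\<phi> s \<in> borel_measurable (Pi\<^sub>M UNIV (\<lambda>_. borel))" for s unfolding \<phi>_def by measurable
  have [measurable]: "D \<in> sets M" using D other_marks_events_sets by auto
  have [measurable]: "R \<in> borel_measurable (Pi\<^sub>M UNIV (\<lambda>_. borel))" unfolding R_def by measurable
  have "(\<integral>\<^sup>+\<omega>\<in>D. emeasure (gain_law i \<omega>) C \<partial>M) =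
      (\<integral>\<^sup>+\<omega>. (\<Sum>s\<in>UNIV. \<phi> s (locations \<omega>) * indicator {\<omega>\<in>space M. \<forall>j<N. X j \<omega> \<in> U j (S j \<omega>) \<and> G j \<omega> \<in> Bs s j (S j \<omega>)} \<omega>) \<partial>M)"
  proof (rule nn_integral_cong)
    fix \<omega> assume \<omega>: "\<omega> \<in> space M"
    have "(\<Sum>s\<in>UNIV. \<phi> s (locations \<omega>) * indicator {\<omega>\<in>space M. \<forall>j<N. X j \<omega> \<in> U j (S j \<omega>) \<and> G j \<omega> \<in> Bs s j (S j \<omega>)} \<omega>) =
       (\<Sum>s\<in>{S i \<omega>}. \<phi> s (locations \<omega>) * indicator {\<omega>\<in>space M. \<forall>j<N. X j \<omega> \<in> U j (S j \<omega>) \<and> G j \<omega> \<in> Bs s j (S j \<omega>)} \<omega>)"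
      using iN by (intro sum.mono_neutral_right) (auto simp: Bs_def indicator_def)
    also have "\<dots> = emeasure (gain_law i \<omega>) C * indicator D \<omega>"
      using \<omega> by (auto simp: \<phi>_def gain_law_def DB U_def Bs_def indicator_def)
    finally show "emeasure (gain_law i \<omega>) C * indicator D \<omega> =
      (\<Sum>s\<in>UNIV. \<phi> s (locations \<omega>) * indicator {\<omega>\<in>space M. \<forall>j<N. X j \<omega> \<in> U j (S j \<omega>) \<and> G j \<omega> \<in> Bs s j (S j \<omega>)} \<omega>)" by simp
  qed
  also have "\<dots> = (\<Sum>s\<in>UNIV. \<integral>\<^sup>+\<omega>\<in>{\<omega>\<in>space M. \<forall>j<N. X j \<omega> \<in> U j (S j \<omega>) \<and> G j \<omega> \<in> Bs s j (S j \<omega>)}. \<phi> s (locations \<omega>) \<partial>M)"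
  proof (rule nn_integral_sum)
    fix s
    have "{\<omega>\<in>space M. \<forall>j<N. X j \<omega> \<in> U j (S j \<omega>) \<and> G j \<omega> \<in> Bs s j (S j \<omega>)} \<in> sets M"
      using mark_event_sets[of UNIV "Bs s" N, OF UNIV_in_sets_PiM Bs] by (simp add: mark_event_def U_def)
    then show "(\<lambda>\<omega>. \<phi> s (locations \<omega>) * indicator {\<omega>\<in>space M. \<forall>j<N. X j \<omega> \<in> U j (S j \<omega>) \<and> G j \<omega> \<in> Bs s j (S j \<omega>)} \<omega>) \<in> borel_measurable M"
      by measurable
  qed
  also have "\<dots> = (\<Sum>s\<in>UNIV. \<integral>\<^sup>+\<omega>. \<phi> s (locations \<omega>) * mark_weight N U (Bs s) (locations \<omega>) \<partial>M)"
    by (intro sum.cong refl nn_integral_marks) measurable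
  also have "\<dots> = (\<integral>\<^sup>+\<omega>. (\<Sum>s\<in>UNIV. \<phi> s (locations \<omega>) * mark_weight N U (Bs s) (locations \<omega>)) \<partial>M)"
    by (rule nn_integral_sum[symmetric]) measurable
  also have "\<dots> = (\<integral>\<^sup>+\<omega>. (\<Sum>s\<in>UNIV. ennreal (link_prob V s (norm (X i \<omega>))) *
      emeasure (rician (rician_factor s (norm (X i \<omega>)))) (B i s \<inter> C)) * R (locations \<omega>) * indicator A0 (locations \<omega>) \<partial>M)"
  proof (rule nn_integral_cong)
    fix \<omega> assume \<omega>: "\<omega> \<in> space M"
    let ?\<rho> = "\<lambda>s. emeasure (rician (rician_factor s (norm (X i \<omega>))))"
    let ?p = "\<lambda>s. ennreal (link_prob V s (norm (X i \<omega>)))"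
    have "\<phi> s (locations \<omega>) * mark_weight N U (Bs s) (locations \<omega>) =
       (?p s * ?\<rho> s (B i s \<inter> C)) * (R (locations \<omega>) * indicator A0 (locations \<omega>))" for s
    proof -
      have "(\<Sum>t\<in>UNIV. ?p t * ?\<rho> t (Bs s i t)) = (\<Sum>t\<in>{s}. ?p t * ?\<rho> t (Bs s i t))"
        by (rule sum.mono_neutral_right) (auto simp: Bs_def)
      then have "(\<Sum>t\<in>UNIV. ?p t * ?\<rho> t (Bs s i t)) = ?p s * ?\<rho> s (B i s)"
        by (simp add: Bs_def)
      \<comment> \<open>This product rule is where \<open>B i s\<close> has to be
        \<open>UNIV\<close> or empty.\<close>
      moreover have "?\<rho> s C * ?\<rho> s (B i s) = ?\<rho> s (B i s \<inter> C)"
        using Bi[of s] prob_space.emeasure_space_1[OF prob_space_rician[OF rician_factor_nonneg, of s "norm (X i \<omega>)"]] by auto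
      moreover have "mark_weight N U (Bs s) (locations \<omega>) = (\<Sum>t\<in>UNIV. ?p t * ?\<rho> t (Bs s i t)) * R (locations \<omega>)"
        by (rule mw) (simp add: Bs_def)
      ultimately show ?thesis by (simp add: \<phi>_def mult_ac)
    qed
    then show "(\<Sum>s\<in>UNIV. \<phi> s (locations \<omega>) * mark_weight N U (Bs s) (locations \<omega>)) =
       (\<Sum>s\<in>UNIV. ?p s * ?\<rho> s (B i s \<inter> C)) * R (locations \<omega>) * indicator A0 (locations \<omega>)"
      by (simp add: sum_distrib_right mult.assoc)
  qed
  finally show ?thesis unfolding lhs by simp
qed

text \<open>For fixed \<open>C\<close> both sides are finite measures in \<open>D\<close>, so
  agreement on the generating events passes to the whole sigma-algebra.\<close>

lemma gain_rectangle:
  assumes D: "D \<in> sets (other_marks i)" and C [measurable]: "C \<in> sets borel"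
  shows "emeasure M {\<omega>\<in>D. G i \<omega> \<in> C} = (\<integral>\<^sup>+\<omega>\<in>D. emeasure (gain_law i \<omega>) C \<partial>M)"
proof -
  let ?F = "other_marks i"
  note sub = subalgebra_other_marks[of i]
  have [measurable]: "(\<lambda>\<omega>. emeasure (gain_law i \<omega>) C) \<in> borel_measurable M"
    by (rule measurable_compose[OF measurable_prob_algebraD[OF measurable_gain_law] measurable_emeasure_subprob_algebra]) simp_all
  have le1: "emeasure (gain_law i \<omega>) C \<le> 1" for \<omega>
    unfolding gain_law_def by (rule prob_space.emeasure_le_1[OF prob_space_rician]) simp
  define P1 where "P1 = density M (indicator {\<omega>\<in>space M. G i \<omega> \<in> C})"
  define P2 where "P2 = density M (\<lambda>\<omega>. emeasure (gain_law i \<omega>) C)"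
  have sub1: "subalgebra P1 ?F" and sub2: "subalgebra P2 ?F"
    using sub by (auto simp: P1_def P2_def subalgebra_def)
  have DM: "D \<in> sets M" if "D \<in> sets ?F" for D using that sub by (auto simp: subalgebra_def)
  have P1: "emeasure P1 D = emeasure M {\<omega>\<in>D. G i \<omega> \<in> C}" if "D \<in> sets ?F" for D
  proof -
    have [measurable]: "D \<in> sets M" using that by (rule DM)
    have "emeasure P1 D = (\<integral>\<^sup>+\<omega>. indicator ({\<omega>\<in>space M. G i \<omega> \<in> C} \<inter> D) \<omega> \<partial>M)"
      unfolding P1_def
      by (subst emeasure_density, simp, simp, intro nn_integral_cong) (auto split: split_indicator)
    also have "\<dots> = emeasure M ({\<omega>\<in>space M. G i \<omega> \<in> C} \<inter> D)" by (rule nn_integral_indicator) measurable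
    also have "{\<omega>\<in>space M. G i \<omega> \<in> C} \<inter> D = {\<omega>\<in>D. G i \<omega> \<in> C}"
      using sets.sets_into_space[OF \<open>D \<in> sets M\<close>] by auto
    finally show ?thesis .
  qed
  have P2: "emeasure P2 D = (\<integral>\<^sup>+\<omega>\<in>D. emeasure (gain_law i \<omega>) C \<partial>M)" if "D \<in> sets ?F" for D
    unfolding P2_def using DM[OF that] by (subst emeasure_density) auto
  have "restr_to_subalg P1 ?F = restr_to_subalg P2 ?F"
  proof (rule measure_eqI_generator_eq[OF Int_stable_other_marks_events other_marks_events_Pow])
    show "sets (restr_to_subalg P1 ?F) = sigma_sets (space M) (other_marks_events i)"
      "sets (restr_to_subalg P2 ?F) = sigma_sets (space M) (other_marks_events i)"
      using sub1 sub2 by (simp_all add: sets_restr_to_subalg sets_other_marks)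
    have "space M \<in> other_marks_events i"
      by (rule other_marks_eventsI[where L = UNIV and n = 0 and B = "\<lambda>_ _. UNIV"])
         (auto simp: mark_event_def UNIV_in_sets_PiM)
    then show "range (\<lambda>_::nat. space M) \<subseteq> other_marks_events i" by auto
    show "(\<Union>_::nat. space M) = space M" by simp
    have "emeasure M {\<omega>\<in>space M. G i \<omega> \<in> C} \<noteq> \<infinity>" by (simp add: emeasure_eq_measure)
    then show "emeasure (restr_to_subalg P1 ?F) (space M) \<noteq> \<infinity>"
      using P1[of "space M"] sets.top[of ?F] by (simp add: emeasure_restr_to_subalg[OF sub1])
    fix E assume E: "E \<in> other_marks_events i"
    then have "E \<in> sets ?F" by (auto simp: sets_other_marks)
    then show "emeasure (restr_to_subalg P1 ?F) E = emeasure (restr_to_subalg P2 ?F) E"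
      by (simp only: emeasure_restr_to_subalg[OF sub1] emeasure_restr_to_subalg[OF sub2] P1 P2 gain_rectangle_event[OF E C])
  qed
  then have "emeasure (restr_to_subalg P1 ?F) D = emeasure (restr_to_subalg P2 ?F) D" by simp
  then show ?thesis
    using D by (simp only: emeasure_restr_to_subalg[OF sub1] emeasure_restr_to_subalg[OF sub2] P1 P2)
qed

text \<open>Independence in integrated form: \<open>f\<close> may involve every location, every type
  and every other gain, while its last argument is averaged over the Rician law. It will be applied
  on the event that station \<open>i\<close> serves.\<close>

lemma nn_integral_gain:
  assumes f: "f \<in> borel_measurable (other_marks i \<Otimes>\<^sub>M borel)"
  shows "(\<integral>\<^sup>+\<omega>. f (\<omega>, G i \<omega>) \<partial>M) = (\<integral>\<^sup>+\<omega>. (\<integral>\<^sup>+h. f (\<omega>, h) \<partial>gain_law i \<omega>) \<partial>M)"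
proof -
  have "(\<integral>\<^sup>+\<omega>\<in>{\<omega>\<in>space M. True}. f (\<omega>, G i \<omega>) \<partial>M) =
      (\<integral>\<^sup>+\<omega>\<in>{\<omega>\<in>space M. True}. (\<integral>\<^sup>+h. f (\<omega>, h) \<partial>gain_law i \<omega>) \<partial>M)"
  proof (rule kernel_rectangle_extend[OF finite_measure_axioms _ measurable_G _ _ _ f])
    show "(\<lambda>\<omega>. \<omega>) \<in> M \<rightarrow>\<^sub>M other_marks i"
      using subalgebra_other_marks[of i] by (auto simp: subalgebra_def intro!: measurableI)
    show "gain_law i \<in> other_marks i \<rightarrow>\<^sub>M prob_algebra borel"
      by (rule measurable_gain_law) measurable
    fix D C assume D: "D \<in> sets (other_marks i)" and C: "C \<in> sets (borel :: real measure)"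
    have "{\<omega>\<in>space M. True \<and> \<omega> \<in> D \<and> G i \<omega> \<in> C} = {\<omega>\<in>D. G i \<omega> \<in> C}" "{\<omega>\<in>space M. True \<and> \<omega> \<in> D} = D"
      using sets.sets_into_space[OF D] by auto
    then show "emeasure M {\<omega>\<in>space M. True \<and> \<omega> \<in> D \<and> G i \<omega> \<in> C} =
      (\<integral>\<^sup>+\<omega>\<in>{\<omega>\<in>space M. True \<and> \<omega> \<in> D}. emeasure (gain_law i \<omega>) C \<partial>M)"
      using gain_rectangle[OF D C] by simp
  qed simp
  then show ?thesis by simp
qed

end

section \<open>Path loss and expected numbers of base stations\<close>

text \<open>Polar coordinates without a change of variables: for nonnegative \<open>a\<close> both
  measures give \<open>{..a}\<close> the area \<open>pi * a\<^sup>2\<close> of a disc. For negative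
  \<open>u\<close> the density is 0 through the truncation in \<open>ennreal\<close>.\<close>

lemma distr_norm_plane:
  "distr lborel borel (norm :: real \<times> real \<Rightarrow> real) = density lborel (\<lambda>u. ennreal (2 * pi * u))"
proof (rule measure_eqI_generator_eq)
  let ?E = "range (\<lambda>a::real. {..a})"
  show "Int_stable ?E" by (auto simp: Int_stable_def)
  show "?E \<subseteq> Pow UNIV" by simp
  show "sets (distr lborel borel (norm :: real \<times> real \<Rightarrow> real)) = sigma_sets UNIV ?E"
    "sets (density lborel (\<lambda>u. ennreal (2 * pi * u))) = sigma_sets UNIV ?E"
    by (simp_all add: borel_eq_atMost)
  show "range (\<lambda>n. {..real n}) \<subseteq> ?E" by auto
  show "(\<Union>n. {..real n}) = UNIV" using real_arch_simple by auto
  have d: "emeasure (distr lborel borel (norm :: real \<times> real \<Rightarrow> real)) {..a} =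
      (if 0 \<le> a then ennreal (pi * a\<^sup>2) else 0)" for a
  proof -
    have "(norm :: real \<times> real \<Rightarrow> real) -` {..a} = cball 0 a" by auto
    then show ?thesis
      by (auto simp: emeasure_distr emeasure_cball unit_ball_vol_2 power2_eq_square)
  qed
  then show "emeasure (distr lborel borel (norm :: real \<times> real \<Rightarrow> real)) {..real n} \<noteq> \<infinity>" for n
    by simp
  fix R assume "R \<in> ?E"
  then obtain a where R: "R = {..a}" by auto
  have "emeasure (density lborel (\<lambda>u. ennreal (2 * pi * u))) {..a} =
      (\<integral>\<^sup>+u. ennreal (2 * pi * u) * indicator {0..a} u \<partial>lborel)"
    by (subst emeasure_density) (auto intro!: nn_integral_cong simp: indicator_def ennreal_eq_0_iff mult_le_0_iff)
  also have "\<dots> = (if 0 \<le> a then ennreal (pi * a\<^sup>2) else 0)"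
  proof (cases "0 \<le> a")
    case True
    have "(\<integral>\<^sup>+u. ennreal (2 * pi * u) * indicator {0..a} u \<partial>lborel) = pi * a\<^sup>2 - pi * 0\<^sup>2"
      by (rule nn_integral_FTC_Icc) (use True in \<open>auto intro!: derivative_eq_intros\<close>)
    then show ?thesis using True by simp
  qed simp
  finally show "emeasure (distr lborel borel (norm :: real \<times> real \<Rightarrow> real)) R =
      emeasure (density lborel (\<lambda>u. ennreal (2 * pi * u))) R"
    unfolding R d ..
qed

lemma nn_integral_norm_plane:
  assumes [measurable]: "\<phi> \<in> borel_measurable borel"
  shows "(\<integral>\<^sup>+x. \<phi> (norm (x :: real \<times> real)) \<partial>lborel) = (\<integral>\<^sup>+u. ennreal (2 * pi * u) * \<phi> u \<partial>lborel)"
proof -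
  have "(\<integral>\<^sup>+x. \<phi> (norm (x :: real \<times> real)) \<partial>lborel) =
      (\<integral>\<^sup>+u. \<phi> u \<partial>distr lborel borel (norm :: real \<times> real \<Rightarrow> real))"
    by (subst nn_integral_distr) auto
  then show ?thesis
    unfolding distr_norm_plane by (subst (asm) nn_integral_density) auto
qed

context downlink
begin

text \<open>The intensity of the distances of type-\<open>s\<close> stations: the circumference of
  the circle of radius \<open>u\<close> times the intensity of the process, thinned by
  \<open>link_prob\<close>.\<close>

definition rate :: "link \<Rightarrow> real \<Rightarrow> real" where
  "rate s u = link_prob V s u * (2 * pi * u * intensity V)"

definition mean_count :: "link \<Rightarrow> real \<Rightarrow> real" where
  "mean_count s a = enn2real (\<integral>\<^sup>+u. ennreal (rate s u) * indicator {0<..a} u \<partial>lborel)"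

lemma intensity_pos: "0 < intensity V"
  using valid by (simp add: valid_network_def)

lemma measurable_rate [measurable]: "rate s \<in> borel_measurable borel"
  unfolding rate_def by measurable

lemma rate_nonneg: "0 \<le> u \<Longrightarrow> 0 \<le> rate s u"
  unfolding rate_def using link_prob_nonneg[of s u] intensity_pos by (intro mult_nonneg_nonneg) auto

lemma rate_le: "0 \<le> u \<Longrightarrow> rate s u \<le> 2 * pi * u * intensity V"
  unfolding rate_def using link_prob_le_1[of s u] link_prob_nonneg[of s u] intensity_pos
  by (intro mult_left_le_one_le) auto

text \<open>Serves twice: it makes the integral in \<open>mean_count\<close> finite, so that
  \<open>enn2real\<close> loses nothing, and it yields the Lipschitz bound
  \<open>mean_count_lipschitz\<close>.\<close>

lemma nn_integral_rate_le:
  assumes "0 \<le> a" "a \<le> b"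
  shows "(\<integral>\<^sup>+u. ennreal (rate s u) * indicator {a<..b} u \<partial>lborel) \<le> ennreal (2 * pi * b * intensity V * (b - a))"
proof -
  have C: "0 \<le> 2 * pi * b * intensity V" using assms intensity_pos by simp
  have "(\<integral>\<^sup>+u. ennreal (rate s u) * indicator {a<..b} u \<partial>lborel) \<le>
      (\<integral>\<^sup>+u. ennreal (2 * pi * b * intensity V) * indicator {a<..b} u \<partial>lborel)"
  proof (intro nn_integral_mono)
    fix u
    have "rate s u \<le> 2 * pi * b * intensity V" if "a < u" "u \<le> b"
    proof -
      have "rate s u \<le> 2 * pi * u * intensity V" using that assms by (intro rate_le) auto
      also have "\<dots> \<le> 2 * pi * b * intensity V"
        using that intensity_pos by (intro mult_right_mono mult_left_mono) auto
      finally show ?thesis .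
    qed
    then show "ennreal (rate s u) * indicator {a<..b} u \<le> ennreal (2 * pi * b * intensity V) * indicator {a<..b} u"
      by (auto simp: indicator_def intro: ennreal_leI)
  qed
  also have "\<dots> = ennreal (2 * pi * b * intensity V * (b - a))"
    using assms C by (simp add: nn_integral_cmult_indicator ennreal_mult)
  finally show ?thesis .
qed

lemma nn_integral_rate:
  assumes "0 \<le> a" "a \<le> b"
  shows "(\<integral>\<^sup>+u. ennreal (rate s u) * indicator {a<..b} u \<partial>lborel) = ennreal (mean_count s b - mean_count s a)"
proof -
  have fin: "(\<integral>\<^sup>+u. ennreal (rate s u) * indicator {0<..c} u \<partial>lborel) = ennreal (mean_count s c)" if "0 \<le> c" for c
    unfolding mean_count_def using nn_integral_rate_le[of 0 c s] that by (simp add: top_unique less_top le_less_trans)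
  have "ennreal (mean_count s b) = (\<integral>\<^sup>+u. ennreal (rate s u) * indicator {0<..a} u + ennreal (rate s u) * indicator {a<..b} u \<partial>lborel)"
    unfolding fin[OF order.trans[OF assms], symmetric] using assms
    by (intro nn_integral_cong) (auto simp: indicator_def)
  also have "\<dots> = ennreal (mean_count s a) + (\<integral>\<^sup>+u. ennreal (rate s u) * indicator {a<..b} u \<partial>lborel)"
    using fin[OF assms(1)] by (subst nn_integral_add) auto
  finally have *: "ennreal (mean_count s b) = ennreal (mean_count s a) + (\<integral>\<^sup>+u. ennreal (rate s u) * indicator {a<..b} u \<partial>lborel)" .
  then show ?thesis
    by (simp add: ennreal_minus[symmetric] mean_count_def)
qed

lemma mean_count_nonneg: "0 \<le> mean_count s a"
  by (simp add: mean_count_def)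

lemma mean_count_0: "a \<le> 0 \<Longrightarrow> mean_count s a = 0"
  by (simp add: mean_count_def)

lemma mean_count_mono: "mono (mean_count s)"
proof (rule monoI)
  fix a b :: real assume ab: "a \<le> b"
  show "mean_count s a \<le> mean_count s b"
  proof (cases "0 \<le> b")
    case True
    show ?thesis unfolding mean_count_def
      using ab nn_integral_rate_le[of 0 b s] True
      by (intro enn2real_mono nn_integral_mono) (auto simp: indicator_def top_unique less_top le_less_trans)
  next
    case False
    then show ?thesis using ab by (simp add: mean_count_0)
  qed
qed

lemma measurable_mean_count [measurable]: "mean_count s \<in> borel_measurable borel"
  by (rule borel_measurable_mono[OF mean_count_mono])

lemma mean_count_lipschitz:
  assumes "0 \<le> a" "a \<le> b"
  shows "mean_count s b - mean_count s a \<le> 2 * pi * b * intensity V * (b - a)"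
  using nn_integral_rate_le[OF assms, of s] intensity_pos assms
  unfolding nn_integral_rate[OF assms] by (subst (asm) ennreal_le_iff) auto

lemma interval_integral_rate:
  assumes "0 \<le> a"
  shows "(LBINT u=0..ereal a. link_prob V s u * (2 * pi * u * intensity V)) = mean_count s a"
proof -
  have "(LBINT u=0..ereal a. link_prob V s u * (2 * pi * u * intensity V)) = (\<integral>u. indicator {0<..a} u * rate s u \<partial>lborel)"
    using interval_integral_Ioc[of 0 a "rate s"] assms
    by (simp add: rate_def set_lebesgue_integral_def zero_ereal_def)
  also have "\<dots> = mean_count s a"
    unfolding mean_count_def using rate_nonneg
    by (subst integral_eq_nn_integral)
       (auto simp: indicator_def intro!: arg_cong[where f = enn2real] nn_integral_cong AE_I2)
  finally show ?thesis .
qed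

lemma breakpoint_mono: "m \<le> n \<Longrightarrow> n \<le> pieces V \<Longrightarrow> breakpoint V m \<le> breakpoint V n"
proof (induction n rule: dec_induct)
  case (step n)
  then have "breakpoint V n < breakpoint V (Suc n)" using valid by (simp add: valid_network_def)
  with step show ?case by (simp add: order.strict_implies_order order.trans)
qed simp

lemma on_piece_unique:
  assumes "n \<in> {1..pieces V}" "m \<in> {1..pieces V}" "on_piece V n r" "on_piece V m r"
  shows "m = n"
proof -
  have "\<not> i < j" if "i \<in> {1..pieces V}" "j \<in> {1..pieces V}" "on_piece V i r" "on_piece V j r" for i j
  proof
    assume "i < j"
    have "ereal r \<le> breakpoint V i" using that by (simp add: on_piece_def)
    also have "\<dots> \<le> breakpoint V (j - 1)" using \<open>i < j\<close> that by (intro breakpoint_mono) auto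
    also have "\<dots> < ereal r" using that by (simp add: on_piece_def)
    finally show False by simp
  qed
  with assms show ?thesis by (metis nat_neq_iff)
qed

lemma on_piece_exists:
  assumes "0 < r" shows "\<exists>n\<in>{1..pieces V}. on_piece V n r"
proof -
  define n where "n = (LEAST n. ereal r \<le> breakpoint V n)"
  have N: "ereal r \<le> breakpoint V (pieces V)" using valid by (simp add: valid_network_def)
  then have 1: "ereal r \<le> breakpoint V n" unfolding n_def by (rule LeastI)
  have 2: "n \<le> pieces V" unfolding n_def using N by (rule Least_le)
  have "breakpoint V 0 = 0" using valid by (simp add: valid_network_def)
  then have 3: "n \<noteq> 0" using 1 assms by (metis ereal_less(2) not_less)
  then have "\<not> ereal r \<le> breakpoint V (n - 1)" unfolding n_def by (intro not_less_Least) auto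
  with 1 2 3 show ?thesis by (intro bexI[of _ n]) (auto simp: on_piece_def)
qed

lemma piecewise_on_piece:
  assumes "n \<in> {1..pieces V}" "on_piece V n r" shows "piecewise V f r = f n r"
proof -
  have "piecewise V f r = (\<Sum>m=1..pieces V. if m = n then f n r else 0)"
    unfolding piecewise_def using assms on_piece_unique by (intro sum.cong) auto
  also have "\<dots> = f n r" using assms by simp
  finally show ?thesis .
qed

lemma measurable_on_piece [measurable]: "Measurable.pred borel (on_piece V n)"
  unfolding on_piece_def by measurable

lemma measurable_zeta_piece [measurable]: "zeta_piece V s n \<in> borel_measurable borel"
  unfolding zeta_piece_def by measurable

lemma measurable_zeta [measurable]: "zeta V s \<in> borel_measurable borel"
  unfolding zeta_def piecewise_def by measurable

lemma zeta_piece_pos: "n \<in> {1..pieces V} \<Longrightarrow> 0 < r \<Longrightarrow> 0 < zeta_piece V s n r"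
  using valid by (simp add: valid_network_def zeta_piece_def)

lemma tx_power_pos: "0 < tx_power V"
  using valid by (simp add: valid_network_def)

section \<open>Equal-loss distances and the density of the serving distance\<close>

lemma zeta_less_iff: "0 < u \<Longrightarrow> 0 < v \<Longrightarrow> zeta V s u < zeta V s v \<longleftrightarrow> v < u"
  using valid unfolding valid_network_def monotone_on_def
  by (metis greaterThan_iff less_asym linorder_neqE)

lemma zeta_le_iff: "0 < u \<Longrightarrow> 0 < v \<Longrightarrow> zeta V s u \<le> zeta V s v \<longleftrightarrow> v \<le> u"
  using zeta_less_iff[of v u s] by (meson not_less)

text \<open>Stated through \<open>zeta\<close>, so that no piece index occurs. The value 0 off the
  positive axis makes the function monotone on the whole line, and its measurability is derived from
  monotonicity.\<close>

definition equal_loss_dist :: "link \<Rightarrow> real \<Rightarrow> real" where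
  "equal_loss_dist s r = (if 0 < r then THE u. 0 < u \<and> zeta V (other s) u = zeta V s r else 0)"

lemma equal_loss_dist:
  assumes "0 < r"
  shows "0 < equal_loss_dist s r" "zeta V (other s) (equal_loss_dist s r) = zeta V s r"
proof -
  have "\<exists>!u. 0 < u \<and> zeta V (other s) u = zeta V s r"
  proof (rule ex_ex1I)
    show "\<exists>u. 0 < u \<and> zeta V (other s) u = zeta V s r"
      using valid assms by (auto simp: valid_network_def)
    show "u = v" if "0 < u \<and> zeta V (other s) u = zeta V s r" "0 < v \<and> zeta V (other s) v = zeta V s r" for u v
      using that zeta_less_iff[of u v "other s"] zeta_less_iff[of v u "other s"] by (metis linorder_neqE less_irrefl)
  qed
  from theI'[OF this] assms show "0 < equal_loss_dist s r" "zeta V (other s) (equal_loss_dist s r) = zeta V s r"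
    by (simp_all add: equal_loss_dist_def)
qed

lemma equal_loss_dist_less: "0 < r \<Longrightarrow> r < t \<Longrightarrow> equal_loss_dist s r < equal_loss_dist s t"
  using equal_loss_dist[of r s] equal_loss_dist[of t s] zeta_less_iff[of t r s]
    zeta_less_iff[of "equal_loss_dist s t" "equal_loss_dist s r" "other s"] by simp

lemma equal_loss_dist_nonneg: "0 \<le> equal_loss_dist s r"
  using equal_loss_dist(1)[of r s] by (cases "0 < r") (auto simp: equal_loss_dist_def)

lemma equal_loss_dist_mono: "mono (equal_loss_dist s)"
proof (rule monoI)
  fix r t :: real assume "r \<le> t"
  then show "equal_loss_dist s r \<le> equal_loss_dist s t"
    using equal_loss_dist_less[of r t s] equal_loss_dist_nonneg[of s t]
    by (cases "0 < r"; cases "r = t") (auto simp: equal_loss_dist_def)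
qed

lemma measurable_equal_loss_dist [measurable]: "equal_loss_dist s \<in> borel_measurable borel"
  by (rule borel_measurable_mono[OF equal_loss_dist_mono])

text \<open>For positive \<open>r\<close>, the probability that no station is at least as strong as
  an \<open>s\<close>-link of length \<open>r\<close>: none of type \<open>s\<close> within
  \<open>r\<close> and none of the other type within the equal-loss distance.
  \<open>prob_clear_event\<close> justifies the formula.\<close>

definition void_prob :: "link \<Rightarrow> real \<Rightarrow> real" where
  "void_prob s r = exp (- mean_count s r - mean_count (other s) (equal_loss_dist s r))"

lemma measurable_void_prob [measurable]: "void_prob s \<in> borel_measurable borel"
  unfolding void_prob_def by measurable

lemma void_prob_pos: "0 < void_prob s r"
  by (simp add: void_prob_def)

lemma void_prob_antimono: "r \<le> t \<Longrightarrow> void_prob s t \<le> void_prob s r"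
  using monoD[OF mean_count_mono, of r t s] monoD[OF equal_loss_dist_mono, of r t s]
    monoD[OF mean_count_mono, of "equal_loss_dist s r" "equal_loss_dist s t" "other s"]
  by (simp add: void_prob_def)

text \<open>The serving density freed from its piece index, so that one function on the whole line
  can be compared with the law of the distance.\<close>

definition dist_density :: "link \<Rightarrow> real \<Rightarrow> real" where
  "dist_density s r = (if 0 < r then void_prob s r * rate s r else 0)"

lemma measurable_dist_density [measurable]: "dist_density s \<in> borel_measurable borel"
  unfolding dist_density_def by measurable

lemma dist_density_nonneg: "0 \<le> dist_density s r"
  using rate_nonneg[of r s] void_prob_pos[of s r] by (simp add: dist_density_def)

lemma serving_density_eq:
  assumes n: "n \<in> {1..pieces V}" and r: "on_piece V n r"
  shows "serving_density V s n r = dist_density s r"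
proof -
  have "0 < r" using assms by (rule on_piece_pos)
  have z: "zeta V s r = zeta_piece V s n r"
    unfolding zeta_def using assms by (rule piecewise_on_piece)
  then have e: "equiv_dist V s n r = equal_loss_dist s r"
    using \<open>0 < r\<close> by (simp add: equiv_dist_def equal_loss_dist_def)
  have "link_prob_piece V s n r = link_prob V s r"
    by (cases s) (simp_all add: los_prob_def piecewise_on_piece[OF assms])
  then show ?thesis
    using \<open>0 < r\<close> equal_loss_dist_nonneg[of s r]
    unfolding serving_density_def e interval_integral_rate[OF equal_loss_dist_nonneg]
      interval_integral_rate[OF less_imp_le[OF \<open>0 < r\<close>]]
    by (simp add: dist_density_def void_prob_def rate_def exp_diff exp_minus field_simps)
qed

section \<open>Measurability of the serving quantities\<close>

lemma measurable_link_loss [measurable (raw)]: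
  assumes [measurable]: "X i \<in> N \<rightarrow>\<^sub>M borel" "S i \<in> N \<rightarrow>\<^sub>M count_space UNIV"
  shows "link_loss V X S i \<in> borel_measurable N"
proof -
  have "(\<lambda>\<omega>. zeta V (S i \<omega>) (norm (X i \<omega>))) \<in> borel_measurable N"
    by (rule measurable_compose_countable'[where f = "\<lambda>s \<omega>. zeta V s (norm (X i \<omega>))" and g = "S i" and I = UNIV]) auto
  then show ?thesis by (simp add: link_loss_def [abs_def])
qed

text \<open>The serving index depends on locations and types only. The space \<open>N\<close> is
  arbitrary so that this applies to \<open>other_marks i\<close>, which lacks the gain of station
  \<open>i\<close>, as well as to \<open>M\<close>.\<close>

lemma measurable_serving:
  assumes "\<And>i. X i \<in> N \<rightarrow>\<^sub>M borel" "\<And>i. S i \<in> N \<rightarrow>\<^sub>M count_space UNIV"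
  shows "serving V X S \<in> N \<rightarrow>\<^sub>M count_space UNIV"
proof -
  have [measurable]: "link_loss V X S i \<in> borel_measurable N" for i
    using assms by (rule measurable_link_loss)
  have "(\<lambda>\<omega>. LEAST i. \<forall>j. link_loss V X S j \<omega> \<le> link_loss V X S i \<omega>) \<in> N \<rightarrow>\<^sub>M count_space UNIV"
    by measurable
  then show ?thesis by (simp add: serving_def [abs_def])
qed

lemma measurable_serving_M [measurable]: "serving V X S \<in> M \<rightarrow>\<^sub>M count_space UNIV"
  by (rule measurable_serving) auto

lemma measurable_serving_dist [measurable]: "serving_dist V X S \<in> borel_measurable M"
proof -
  have "(\<lambda>\<omega>. norm (X (serving V X S \<omega>) \<omega>)) \<in> borel_measurable M"
    by (rule measurable_compose_countable'[where f = "\<lambda>i \<omega>. norm (X i \<omega>)" and g = "serving V X S" and I = UNIV]) auto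
  then show ?thesis by (simp add: serving_dist_def [abs_def])
qed

lemma measurable_serving_gain [measurable]: "serving_gain V X S G \<in> borel_measurable M"
proof -
  have "(\<lambda>\<omega>. G (serving V X S \<omega>) \<omega>) \<in> borel_measurable M"
    by (rule measurable_compose_countable'[where f = "\<lambda>i \<omega>. G i \<omega>" and g = "serving V X S" and I = UNIV]) auto
  then show ?thesis by (simp add: serving_gain_def [abs_def])
qed

lemma measurable_serving_link [measurable]: "serving_link V X S \<in> M \<rightarrow>\<^sub>M count_space UNIV"
proof -
  have "(\<lambda>\<omega>. S (serving V X S \<omega>) \<omega>) \<in> M \<rightarrow>\<^sub>M count_space UNIV"
    by (rule measurable_compose_countable'[where f = "\<lambda>i \<omega>. S i \<omega>" and g = "serving V X S" and I = UNIV]) auto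
  then show ?thesis by (simp add: serving_link_def [abs_def])
qed

lemma measurable_interference [measurable]: "interference V X S G \<in> borel_measurable M"
  unfolding interference_def [abs_def] by measurable

end

section \<open>The law of the serving link and distance\<close>

context downlink
begin

lemma sum_link: "(\<Sum>s\<in>UNIV. f s) = f s + f (other s)" for f :: "link \<Rightarrow> 'a::comm_monoid_add"
  by (cases s) (simp_all add: UNIV_link add.commute)

lemma other_neq [simp]: "other s \<noteq> s" "s \<noteq> other s"
  by (cases s; simp)+

lemma neq_other: "t \<noteq> s \<Longrightarrow> t = other s"
  by (cases s; cases t) auto

text \<open>Given its location \<open>x\<close>, a station avoids the exclusion disc of its own type
  with probability \<open>v x\<close>, independently over stations, so the generating functional at
  \<open>v\<close> is the answer. Polar coordinates split the integral of \<open>1 - v x\<close>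
  into the mean counts of the two types.\<close>

lemma void_probability:
  assumes \<rho>: "\<And>s. 0 \<le> \<rho> s"
  shows "prob {\<omega>\<in>space M. \<forall>i. \<rho> (S i \<omega>) < norm (X i \<omega>)} = exp (- (\<Sum>s\<in>UNIV. mean_count s (\<rho> s)))"
proof -
  define v where "v x = (\<Sum>s\<in>UNIV. indicator {\<rho> s<..} (norm x) * link_prob V s (norm x))" for x :: "real \<times> real"
  define E where "E n = {\<omega>\<in>space M. \<forall>i<n. \<rho> (S i \<omega>) < norm (X i \<omega>)}" for n
  let ?\<mu> = "scale_measure (ennreal (intensity V)) (lborel :: (real \<times> real) measure)"
  have v_compl: "1 - v x = (\<Sum>s\<in>UNIV. indicator {..\<rho> s} (norm x) * link_prob V s (norm x))" for x
    unfolding v_def sum_link_prob[of "norm x", symmetric] sum_subtractf[symmetric]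
    by (intro sum.cong refl) (auto simp: indicator_def)
  have v0: "0 \<le> v x" for x
    unfolding v_def using link_prob_nonneg by (intro sum_nonneg) auto
  have v1: "v x \<le> 1" for x
  proof -
    have "0 \<le> 1 - v x"
      unfolding v_compl using link_prob_nonneg by (intro sum_nonneg) auto
    then show ?thesis by simp
  qed
  have v_meas [measurable]: "v \<in> borel_measurable borel" unfolding v_def by measurable
  have E_sets: "E n \<in> sets M" for n
  proof -
    have "E n = {\<omega>\<in>space M. \<forall>i<n. \<exists>s\<in>UNIV. S i \<omega> = s \<and> \<rho> s < norm (X i \<omega>)}"
      by (auto simp: E_def)
    also have "\<dots> \<in> sets M" by measurable
    finally show ?thesis .
  qed
  have E_prob: "prob (E n) = (\<integral>\<omega>. (\<Prod>i<n. v (X i \<omega>)) \<partial>M)" for n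
  proof -
    have "emeasure M (E n) = emeasure M {\<omega>\<in>space M. locations \<omega> \<in> UNIV \<and>
        (\<forall>i<n. X i \<omega> \<in> (\<lambda>i s. {x. \<rho> s < norm x}) i (S i \<omega>) \<and> G i \<omega> \<in> (\<lambda>i s. UNIV) i (S i \<omega>))}"
      by (simp add: E_def)
    also have "\<dots> = (\<integral>\<^sup>+\<omega>\<in>{\<omega>\<in>space M. locations \<omega> \<in> UNIV}.
        mark_weight n (\<lambda>i s. {x. \<rho> s < norm x}) (\<lambda>i s. UNIV) (locations \<omega>) \<partial>M)"
      by (rule emeasure_marks) (auto simp: UNIV_in_sets_PiM)
    also have "\<dots> = (\<integral>\<^sup>+\<omega>. ennreal (\<Prod>i<n. v (X i \<omega>)) \<partial>M)"
    proof (intro nn_integral_cong)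
      fix \<omega> assume "\<omega> \<in> space M"
      have one: "emeasure (rician (rician_factor s r)) UNIV = 1" for s r
        using prob_space.emeasure_space_1[OF prob_space_rician[OF rician_factor_nonneg]] by simp
      have "mark_weight n (\<lambda>i s. {x. \<rho> s < norm x}) (\<lambda>i s. UNIV) (locations \<omega>) =
          (\<Prod>i<n. ennreal (v (X i \<omega>)))"
        unfolding mark_weight_def one
      proof (intro prod.cong refl)
        fix i
        have "ennreal (v (X i \<omega>)) = (\<Sum>s\<in>UNIV. ennreal (indicator {\<rho> s<..} (norm (X i \<omega>)) * link_prob V s (norm (X i \<omega>))))"
          unfolding v_def using link_prob_nonneg by (intro sum_ennreal[symmetric]) auto
        also have "\<dots> = (\<Sum>s\<in>UNIV. indicator {x. \<rho> s < norm x} (X i \<omega>) * ennreal (link_prob V s (norm (X i \<omega>))) * 1)"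
          by (intro sum.cong refl) (auto simp: indicator_def)
        finally show "(\<Sum>s\<in>UNIV. indicator {x. \<rho> s < norm x} (X i \<omega>) * ennreal (link_prob V s (norm (X i \<omega>))) * 1) = ennreal (v (X i \<omega>))" ..
      qed
      also have "\<dots> = ennreal (\<Prod>i<n. v (X i \<omega>))" using v0 by (simp add: prod_ennreal)
      finally show "mark_weight n (\<lambda>i s. {x. \<rho> s < norm x}) (\<lambda>i s. UNIV) (locations \<omega>) *
          indicator {\<omega>\<in>space M. locations \<omega> \<in> UNIV} \<omega> = ennreal (\<Prod>i<n. v (X i \<omega>))"
        using \<open>\<omega> \<in> space M\<close> by simp
    qed
    finally show ?thesis
      by (subst integral_eq_nn_integral) (auto simp: measure_def v0 intro!: AE_I2 prod_nonneg)
  qed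
  have "(\<lambda>n. prob (E n)) \<longlonglongrightarrow> prob (\<Inter>n. E n)"
    using E_sets by (intro finite_Lim_measure_decseq) (auto simp: decseq_def E_def)
  moreover have "(\<lambda>n. prob (E n)) \<longlonglongrightarrow> exp (- (\<integral>x. 1 - v x \<partial>?\<mu>))"
    unfolding E_prob
  proof (rule poisson_pgfl[OF poisson])
    show "AE \<omega> in M. inj (\<lambda>i. X i \<omega>)" using model by (simp add: downlink_model_def)
    show "X i \<in> M \<rightarrow>\<^sub>M ?\<mu>" for i by measurable
    \<comment> \<open>The sum of the radii is at least each of them, so \<open>v\<close> is 1
      outside this ball.\<close>
    let ?K = "cball (0 :: real \<times> real) (\<Sum>s\<in>UNIV. \<rho> s)"
    show "?K \<in> sets ?\<mu>" by simp
    have "emeasure lborel ?K < \<infinity>" by (rule emeasure_bounded_finite) simp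
    then show "emeasure ?\<mu> ?K < \<infinity>" by (simp add: ennreal_mult_less_top)
    show "v \<in> borel_measurable ?\<mu>" by measurable
    show "v x = 1" if "x \<notin> ?K" for x
    proof -
      have "\<rho> s < norm x" for s
        using that \<rho>[of s] \<rho>[of "other s"] by (simp add: sum_link[of \<rho> s])
      then show ?thesis unfolding v_def using sum_link_prob[of "norm x"] by simp
    qed
  qed (use v0 v1 in auto)
  ultimately have "prob (\<Inter>n. E n) = exp (- (\<integral>x. 1 - v x \<partial>?\<mu>))" by (rule LIMSEQ_unique)
  moreover have "(\<Inter>n. E n) = {\<omega>\<in>space M. \<forall>i. \<rho> (S i \<omega>) < norm (X i \<omega>)}"
    by (auto simp: E_def)
  moreover have "(\<integral>x. 1 - v x \<partial>?\<mu>) = (\<Sum>s\<in>UNIV. mean_count s (\<rho> s))"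
  proof -
    define q where "q u = (\<Sum>s\<in>UNIV. indicator {..\<rho> s} u * link_prob V s u)" for u
    have [measurable]: "q \<in> borel_measurable borel" unfolding q_def by measurable
    have q0: "0 \<le> q u" for u unfolding q_def using link_prob_nonneg by (intro sum_nonneg) auto
    have "(\<integral>\<^sup>+x. ennreal (1 - v x) \<partial>?\<mu>) = ennreal (intensity V) * (\<integral>\<^sup>+x. ennreal (q (norm x)) \<partial>(lborel :: (real \<times> real) measure))"
      unfolding v_compl q_def by (rule nn_integral_scale_measure) measurable
    also have "\<dots> = ennreal (intensity V) * (\<integral>\<^sup>+u. ennreal (2 * pi * u) * ennreal (q u) \<partial>lborel)"
      by (subst nn_integral_norm_plane) auto
    also have "\<dots> = (\<integral>\<^sup>+u. ennreal (intensity V) * (ennreal (2 * pi * u) * ennreal (q u)) \<partial>lborel)"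
      by (rule nn_integral_cmult[symmetric]) measurable
    also have "\<dots> = (\<integral>\<^sup>+u. (\<Sum>s\<in>UNIV. ennreal (rate s u) * indicator {0<..\<rho> s} u) \<partial>lborel)"
    proof (rule nn_integral_cong)
      fix u
      show "ennreal (intensity V) * (ennreal (2 * pi * u) * ennreal (q u)) = (\<Sum>s\<in>UNIV. ennreal (rate s u) * indicator {0<..\<rho> s} u)"
      proof (cases "0 < u")
        case True
        then have "ennreal (intensity V) * (ennreal (2 * pi * u) * ennreal (q u)) = ennreal (\<Sum>s\<in>UNIV. indicator {0<..\<rho> s} u * rate s u)"
        proof -
          have "intensity V * (2 * pi * u * q u) = (\<Sum>s\<in>UNIV. indicator {0<..\<rho> s} u * rate s u)"
            unfolding q_def sum_distrib_left
            using True by (intro sum.cong refl) (auto simp: rate_def indicator_def)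
          moreover have "ennreal (intensity V) * (ennreal (2 * pi * u) * ennreal (q u)) = ennreal (intensity V * (2 * pi * u * q u))"
            using True intensity_pos q0[of u] by (simp add: ennreal_mult)
          ultimately show ?thesis by simp
        qed
        also have "\<dots> = (\<Sum>s\<in>UNIV. ennreal (indicator {0<..\<rho> s} u * rate s u))"
          using rate_nonneg[of u] True by (intro sum_ennreal[symmetric]) auto
        also have "\<dots> = (\<Sum>s\<in>UNIV. ennreal (rate s u) * indicator {0<..\<rho> s} u)"
          by (intro sum.cong refl) (auto simp: indicator_def)
        finally show ?thesis .
      next
        case False
        then show ?thesis by (simp add: ennreal_neg mult_le_0_iff)
      qed
    qed
    also have "\<dots> = (\<Sum>s\<in>UNIV. ennreal (mean_count s (\<rho> s)))"
      by (subst nn_integral_sum) (auto simp: nn_integral_rate[OF order.refl \<rho>] mean_count_0)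
    also have "\<dots> = ennreal (\<Sum>s\<in>UNIV. mean_count s (\<rho> s))"
      by (simp add: sum_ennreal mean_count_nonneg)
    finally show ?thesis
      using v1 by (subst integral_eq_nn_integral) (auto simp: sum_nonneg mean_count_nonneg)
  qed
  ultimately show ?thesis by simp
qed

definition clear_event :: "link \<Rightarrow> real \<Rightarrow> real \<Rightarrow> 'w set" where
  "clear_event s a c = {\<omega>\<in>space M. \<forall>i. (if S i \<omega> = s then a else c) < norm (X i \<omega>)}"

lemma clear_event_sets [measurable]: "clear_event s a c \<in> sets M"
  unfolding clear_event_def by measurable

lemma prob_clear_event:
  assumes "0 \<le> a" "0 \<le> c"
  shows "prob (clear_event s a c) = exp (- mean_count s a - mean_count (other s) c)"
proof -
  have "prob (clear_event s a c) = exp (- (\<Sum>t\<in>UNIV. mean_count t (if t = s then a else c)))"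
    unfolding clear_event_def using assms by (intro void_probability) auto
  then show ?thesis by (simp only: sum_link[of _ s] other_neq if_True if_False refl) simp
qed

text \<open>What makes the strongest link exist: local finiteness provides a nearest station of each
  type present, and \<open>zeta\<close> is strictly decreasing only on positive distances, being 0
  at the origin by default.\<close>

definition regular_point :: "'w \<Rightarrow> bool" where
  "regular_point \<omega> \<longleftrightarrow> (\<forall>i. 0 < norm (X i \<omega>)) \<and> (\<forall>k::nat. finite {i. norm (X i \<omega>) \<le> real k})"

lemma AE_regular_point: "AE \<omega> in M. regular_point \<omega>"
proof -
  let ?\<mu> = "scale_measure (ennreal (intensity V)) (lborel :: (real \<times> real) measure)"
  have pp: "AE \<omega> in M. finite (range (\<lambda>i. X i \<omega>) \<inter> B)" if "B \<in> sets borel" "emeasure lborel B < \<infinity>" for B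
    using poisson that by (simp add: poisson_point_process_def ennreal_mult_less_top)
  have inj: "AE \<omega> in M. inj (\<lambda>i. X i \<omega>)" using model by (simp add: downlink_model_def)
  have "AE \<omega> in M. finite (range (\<lambda>i. X i \<omega>) \<inter> cball 0 (real k))" for k :: nat
    by (rule pp, simp, rule emeasure_bounded_finite, simp)
  then have "AE \<omega> in M. \<forall>k::nat. finite (range (\<lambda>i. X i \<omega>) \<inter> cball 0 (real k))"
    by (simp add: AE_all_countable)
  \<comment> \<open>With both radii 0 the event says that no station sits at the origin, and its
    probability is \<open>exp 0\<close>.\<close>
  moreover have "AE \<omega> in M. \<omega> \<in> clear_event LOS 0 0"
    using prob_clear_event[of 0 0 LOS] by (subst prob_eq_1[symmetric]) (auto simp: mean_count_0)
  ultimately show ?thesis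
    using inj
  proof eventually_elim
    case (elim \<omega>)
    have "finite {i. norm (X i \<omega>) \<le> real k}" for k :: nat
    proof -
      have "(\<lambda>i. X i \<omega>) ` {i. norm (X i \<omega>) \<le> real k} \<subseteq> range (\<lambda>i. X i \<omega>) \<inter> cball 0 (real k)" by auto
      with elim(1) have "finite ((\<lambda>i. X i \<omega>) ` {i. norm (X i \<omega>) \<le> real k})" by (meson finite_subset)
      then show ?thesis using elim(3) by (metis finite_imageD inj_on_subset subset_UNIV)
    qed
    with elim(2) show ?case by (auto simp: regular_point_def clear_event_def split: if_splits)
  qed
qed

lemma nearest_exists:
  assumes "regular_point \<omega>" "i0 \<in> A"
  shows "\<exists>i\<in>A. \<forall>j\<in>A. norm (X i \<omega>) \<le> norm (X j \<omega>)"
proof -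
  obtain k :: nat where k: "norm (X i0 \<omega>) \<le> real k" using real_arch_simple by blast
  let ?B = "A \<inter> {i. norm (X i \<omega>) \<le> real k}"
  have "finite ?B" "?B \<noteq> {}" using assms k by (auto simp: regular_point_def)
  note B = this
  define i where "i = arg_min_on (\<lambda>i. norm (X i \<omega>)) ?B"
  have i: "i \<in> A" "norm (X i \<omega>) \<le> real k"
    using arg_min_if_finite(1)[OF B, of "\<lambda>i. norm (X i \<omega>)"] by (auto simp: i_def)
  have "norm (X i \<omega>) \<le> norm (X j \<omega>)" if "j \<in> A" for j
  proof (cases "norm (X j \<omega>) \<le> real k")
    case True
    then show ?thesis unfolding i_def using that B by (intro arg_min_least) auto
  qed (use i in linarith)
  then show ?thesis using i by blast
qed

text \<open>\<open>LEAST\<close> is meaningful only if some station attains the maximum. Within one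
  type the nearest station does, since \<open>zeta\<close> decreases, and the better of at most two
  such stations maximises overall.\<close>

lemma serving_maximal:
  assumes "regular_point \<omega>"
  shows "link_loss V X S j \<omega> \<le> link_loss V X S (serving V X S \<omega>) \<omega>"
proof -
  have pos: "0 < norm (X i \<omega>)" for i using assms by (simp add: regular_point_def)
  have near: "\<exists>i. S i \<omega> = s \<and> (\<forall>j. S j \<omega> = s \<longrightarrow> link_loss V X S j \<omega> \<le> link_loss V X S i \<omega>)"
    if "S i0 \<omega> = s" for i0 s
    using nearest_exists[OF assms, of i0 "{i. S i \<omega> = s}"] that zeta_le_iff[OF pos pos, of s]
    by (auto simp: link_loss_def)
  have "\<exists>i. \<forall>j. link_loss V X S j \<omega> \<le> link_loss V X S i \<omega>"
  \<comment> \<open>One of the two types may be absent.\<close>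
  proof (cases "\<exists>i0. S i0 \<omega> \<noteq> S 0 \<omega>")
    case True
    then obtain i0 where i0: "S i0 \<omega> = other (S 0 \<omega>)" using neq_other by metis
    obtain i where i: "\<forall>j. S j \<omega> = S 0 \<omega> \<longrightarrow> link_loss V X S j \<omega> \<le> link_loss V X S i \<omega>"
      using near[OF refl, of 0] by auto
    obtain i' where i': "\<forall>j. S j \<omega> = other (S 0 \<omega>) \<longrightarrow> link_loss V X S j \<omega> \<le> link_loss V X S i' \<omega>"
      using near[OF i0] by auto
    have "link_loss V X S j \<omega> \<le> link_loss V X S i \<omega> \<or> link_loss V X S j \<omega> \<le> link_loss V X S i' \<omega>" for j
      using i i' neq_other by metis
    then show ?thesis by (metis le_cases order.trans)
  next
    case False
    then show ?thesis using near[OF refl, of 0] by auto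
  qed
  from LeastI_ex[OF this] show ?thesis by (simp add: serving_def)
qed

section \<open>Two-sided bounds on the law of the serving distance\<close>

definition dist_event :: "link \<Rightarrow> real \<Rightarrow> real \<Rightarrow> 'w set" where
  "dist_event s a b = {\<omega>\<in>space M. serving_link V X S \<omega> = s \<and> a < serving_dist V X S \<omega> \<and> serving_dist V X S \<omega> \<le> b}"

lemma dist_event_sets [measurable]: "dist_event s a b \<in> sets M"
  unfolding dist_event_def by measurable

text \<open>No station is stronger than the serving one, which is weaker than an
  \<open>s\<close>-link of length \<open>a\<close>; this clears both discs. The serving station
  itself lies within \<open>b\<close>, so it violates the subtracted event.\<close>

lemma dist_event_upper:
  assumes \<omega>: "regular_point \<omega>" and "0 < a" "\<omega> \<in> dist_event s a b"
  shows "\<omega> \<in> clear_event s a (equal_loss_dist s a) - clear_event s b (equal_loss_dist s a)"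
proof -
  have pos: "0 < norm (X i \<omega>)" for i using \<omega> by (simp add: regular_point_def)
  define i where "i = serving V X S \<omega>"
  have i: "S i \<omega> = s" "a < norm (X i \<omega>)" "norm (X i \<omega>) \<le> b" "\<omega> \<in> space M"
    using assms by (auto simp: dist_event_def serving_link_def serving_dist_def i_def)
  have max: "zeta V (S j \<omega>) (norm (X j \<omega>)) \<le> zeta V s (norm (X i \<omega>))" for j
    using serving_maximal[OF \<omega>, of j] i by (simp add: link_loss_def i_def)
  have "a < norm (X j \<omega>)" if "S j \<omega> = s" for j
    using max[of j] that zeta_le_iff[OF pos pos, of s j i] i by simp
  moreover have "equal_loss_dist s a < norm (X j \<omega>)" if "S j \<omega> \<noteq> s" for j
  proof -
    have "zeta V (other s) (norm (X j \<omega>)) \<le> zeta V s (norm (X i \<omega>))"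
      using max[of j] neq_other[OF that] by simp
    also have "\<dots> < zeta V s a" using i assms pos[of i] by (subst zeta_less_iff) auto
    also have "\<dots> = zeta V (other s) (equal_loss_dist s a)" using assms by (simp add: equal_loss_dist)
    finally show ?thesis using zeta_less_iff[OF pos equal_loss_dist(1)] assms by simp
  qed
  ultimately show ?thesis
    using i by (auto simp: clear_event_def intro!: exI[of _ i])
qed

text \<open>Some type-\<open>s\<close> station lies within \<open>b\<close>, and every station of
  the other type is weaker than an \<open>s\<close>-link of length \<open>b\<close>, so type
  \<open>s\<close> wins. Compared with \<open>dist_event_upper\<close>, only the disc cleared of the
  other type changes, from the one for \<open>a\<close> to the one for \<open>b\<close>.\<close>

lemma dist_event_lower:
  assumes \<omega>: "regular_point \<omega>" and "0 < a" "a \<le> b"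
    and in_ev: "\<omega> \<in> clear_event s a (equal_loss_dist s b) - clear_event s b (equal_loss_dist s b)"
  shows "\<omega> \<in> dist_event s a b"
proof -
  have pos: "0 < norm (X i \<omega>)" for i using \<omega> by (simp add: regular_point_def)
  define i where "i = serving V X S \<omega>"
  have sp: "\<omega> \<in> space M" and s: "\<And>j. S j \<omega> = s \<Longrightarrow> a < norm (X j \<omega>)"
    and o: "\<And>j. S j \<omega> \<noteq> s \<Longrightarrow> equal_loss_dist s b < norm (X j \<omega>)"
    using in_ev by (auto simp: clear_event_def split: if_splits)
  obtain j where j: "S j \<omega> = s" "norm (X j \<omega>) \<le> b"
    using in_ev sp o by (auto simp: clear_event_def not_less split: if_splits)
  have max: "zeta V s (norm (X j \<omega>)) \<le> zeta V (S i \<omega>) (norm (X i \<omega>))"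
    using serving_maximal[OF \<omega>, of j] j by (simp add: link_loss_def i_def)
  have Si: "S i \<omega> = s"
  proof (rule ccontr)
    assume n: "S i \<omega> \<noteq> s"
    have "zeta V (other s) (norm (X i \<omega>)) < zeta V (other s) (equal_loss_dist s b)"
      using o[OF n] zeta_less_iff[OF pos equal_loss_dist(1)] assms by simp
    also have "\<dots> = zeta V s b" using assms by (simp add: equal_loss_dist)
    also have "\<dots> \<le> zeta V s (norm (X j \<omega>))" using j pos assms by (subst zeta_le_iff) auto
    finally show False using max neq_other[OF n] by simp
  qed
  then have "norm (X i \<omega>) \<le> norm (X j \<omega>)" using max zeta_le_iff[OF pos pos] by simp
  then show ?thesis
    using s[OF Si] Si j sp by (simp add: dist_event_def serving_link_def serving_dist_def i_def[symmetric])
qed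

text \<open>The tangent inequality for \<open>exp\<close> at either end point. It turns differences
  of void probabilities into multiples of differences of \<open>mean_count\<close>.\<close>

lemma exp_diff_bounds:
  fixes x y :: real assumes "x \<le> y"
  shows "exp (- y) * (y - x) \<le> exp (- x) - exp (- y)" "exp (- x) - exp (- y) \<le> exp (- x) * (y - x)"
proof -
  have "exp (- y) * (1 + (y - x)) \<le> exp (- y) * exp (y - x)"
    by (intro mult_left_mono exp_ge_add_one_self) auto
  then show "exp (- y) * (y - x) \<le> exp (- x) - exp (- y)"
    by (simp add: exp_add[symmetric] algebra_simps)
  have "exp (- x) * (1 + (x - y)) \<le> exp (- x) * exp (x - y)"
    by (intro mult_left_mono exp_ge_add_one_self) auto
  then show "exp (- x) - exp (- y) \<le> exp (- x) * (y - x)"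
    by (simp add: exp_add[symmetric] algebra_simps)
qed

lemma prob_clear_diff:
  assumes "0 \<le> a" "a \<le> b" "0 \<le> c"
  shows "prob (clear_event s a c - clear_event s b c) =
    (exp (- mean_count s a) - exp (- mean_count s b)) * exp (- mean_count (other s) c)"
proof -
  have "clear_event s b c \<subseteq> clear_event s a c"
    using assms by (force simp: clear_event_def split: if_splits)
  then have "prob (clear_event s a c - clear_event s b c) = prob (clear_event s a c) - prob (clear_event s b c)"
    by (intro finite_measure_Diff) auto
  then show ?thesis
    using assms by (simp add: prob_clear_event exp_diff exp_minus field_simps)
qed

lemma prob_dist_event_bounds:
  assumes "0 < a" "a \<le> b"
  shows "void_prob s b * (mean_count s b - mean_count s a) \<le> prob (dist_event s a b)"
    and "prob (dist_event s a b) \<le> void_prob s a * (mean_count s b - mean_count s a)"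
proof -
  have le: "mean_count s a \<le> mean_count s b" using monoD[OF mean_count_mono] assms by simp
  have vp: "void_prob s r = exp (- mean_count s r) * exp (- mean_count (other s) (equal_loss_dist s r))" for r
    by (simp add: void_prob_def exp_diff exp_minus field_simps)
  have "void_prob s b * (mean_count s b - mean_count s a) \<le>
      (exp (- mean_count s a) - exp (- mean_count s b)) * exp (- mean_count (other s) (equal_loss_dist s b))"
    using mult_right_mono[OF exp_diff_bounds(1)[OF le], of "exp (- mean_count (other s) (equal_loss_dist s b))"]
    by (simp only: vp mult_ac exp_ge_zero)
  also have "\<dots> = prob (clear_event s a (equal_loss_dist s b) - clear_event s b (equal_loss_dist s b))"
    using assms equal_loss_dist_nonneg by (simp add: prob_clear_diff)
  also have "\<dots> \<le> prob (dist_event s a b)"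
    using AE_regular_point dist_event_lower[OF _ assms]
    by (intro finite_measure_mono_AE) auto
  finally show "void_prob s b * (mean_count s b - mean_count s a) \<le> prob (dist_event s a b)" .
  have "prob (dist_event s a b) \<le> prob (clear_event s a (equal_loss_dist s a) - clear_event s b (equal_loss_dist s a))"
    using AE_regular_point dist_event_upper[OF _ assms(1)]
    by (intro finite_measure_mono_AE) auto
  also have "\<dots> = (exp (- mean_count s a) - exp (- mean_count s b)) * exp (- mean_count (other s) (equal_loss_dist s a))"
    using assms equal_loss_dist_nonneg by (simp add: prob_clear_diff)
  also have "\<dots> \<le> void_prob s a * (mean_count s b - mean_count s a)"
    using mult_right_mono[OF exp_diff_bounds(2)[OF le], of "exp (- mean_count (other s) (equal_loss_dist s a))"]
    by (simp only: vp mult_ac exp_ge_zero)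
  finally show "prob (dist_event s a b) \<le> void_prob s a * (mean_count s b - mean_count s a)" .
qed

definition dist_mass :: "link \<Rightarrow> real \<Rightarrow> real \<Rightarrow> ennreal" where
  "dist_mass s a b = (\<integral>\<^sup>+r. ennreal (dist_density s r) * indicator {a<..b} r \<partial>lborel)"

text \<open>\<open>void_prob\<close> decreases, so it may be replaced by its values at the end
  points. The bounds are the same as in \<open>prob_dist_event_bounds\<close>, which is what
  confines the probability and the integral to a common interval.\<close>

lemma dist_mass_bounds:
  assumes "0 < a" "a \<le> b"
  shows "ennreal (void_prob s b * (mean_count s b - mean_count s a)) \<le> dist_mass s a b"
    and "dist_mass s a b \<le> ennreal (void_prob s a * (mean_count s b - mean_count s a))"
proof -
  have le: "mean_count s a \<le> mean_count s b" using monoD[OF mean_count_mono] assms by simp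
  have c: "(\<integral>\<^sup>+r. ennreal c * (ennreal (rate s r) * indicator {a<..b} r) \<partial>lborel) =
      ennreal (c * (mean_count s b - mean_count s a))" if "0 \<le> c" for c
    using that le assms by (subst nn_integral_cmult) (auto simp: nn_integral_rate ennreal_mult)
  have d: "ennreal (dist_density s r) = ennreal (void_prob s r) * ennreal (rate s r)" if "0 < r" for r
    using that rate_nonneg[of r s] by (simp add: dist_density_def ennreal_mult void_prob_pos less_imp_le)
  show "ennreal (void_prob s b * (mean_count s b - mean_count s a)) \<le> dist_mass s a b"
    unfolding c[OF less_imp_le[OF void_prob_pos], symmetric] dist_mass_def
    using assms by (intro nn_integral_mono)
      (auto simp: indicator_def d intro!: mult_right_mono ennreal_leI void_prob_antimono)
  show "dist_mass s a b \<le> ennreal (void_prob s a * (mean_count s b - mean_count s a))"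
    unfolding c[OF less_imp_le[OF void_prob_pos], symmetric] dist_mass_def
    using assms by (intro nn_integral_mono)
      (auto simp: indicator_def d intro!: mult_right_mono ennreal_leI void_prob_antimono)
qed

lemma prob_dist_event_additive:
  assumes "a \<le> b" "b \<le> c"
  shows "prob (dist_event s a c) = prob (dist_event s a b) + prob (dist_event s b c)"
proof -
  have "dist_event s a c = dist_event s a b \<union> dist_event s b c" "dist_event s a b \<inter> dist_event s b c = {}"
    using assms by (auto simp: dist_event_def)
  then show ?thesis by (simp add: finite_measure_Union)
qed

lemma dist_mass_additive:
  assumes "a \<le> b" "b \<le> c"
  shows "dist_mass s a c = dist_mass s a b + dist_mass s b c"
proof -
  have "dist_mass s a c = (\<integral>\<^sup>+r. ennreal (dist_density s r) * indicator {a<..b} r + ennreal (dist_density s r) * indicator {b<..c} r \<partial>lborel)"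
    unfolding dist_mass_def using assms by (intro nn_integral_cong) (auto simp: indicator_def)
  then show ?thesis unfolding dist_mass_def by (subst (asm) nn_integral_add) auto
qed

text \<open>Probability and integral lie in a common interval of length at most
  \<open>C (y - x) (void_prob s x - void_prob s y)\<close>, so that they agree by refining partitions;
  this needs neither continuity of the densities nor differentiability of \<open>mean_count\<close>.\<close>

lemma prob_dist_event:
  assumes a: "0 < a" and ab: "a \<le> b"
  shows "ennreal (prob (dist_event s a b)) = dist_mass s a b"
proof -
  have lt: "dist_mass s x y < \<top>" if "0 < x" "x \<le> y" for x y
    using dist_mass_bounds(2)[OF that, of s] by (rule le_less_trans) simp
  then have fin: "dist_mass s x y = ennreal (enn2real (dist_mass s x y))" if "0 < x" "x \<le> y" for x y
    using that by simp
  define F where "F t = prob (dist_event s a t) - enn2real (dist_mass s a t)" for t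
  have "F b = F a"
  \<comment> \<open>The constant is the Lipschitz constant of \<open>mean_count\<close> on
    \<open>[0, b]\<close>; the differences of \<open>void_prob\<close> come from the gap between the
    common bounds.\<close>
  proof (rule additive_eq_of_lipschitz_monotone[OF ab, where C = "2 * pi * b * intensity V" and K = "void_prob s"])
    fix x y assume xy: "a \<le> x" "x < y" "y \<le> b"
    have x: "0 < x" "x \<le> y" using xy a by auto
    have add: "dist_mass s a y = dist_mass s a x + dist_mass s x y"
      using xy by (intro dist_mass_additive) auto
    have "enn2real (dist_mass s a y) = enn2real (dist_mass s a x) + enn2real (dist_mass s x y)"
      unfolding add using lt[of a x] lt[of x y] xy a by (intro enn2real_plus) auto
    then have F: "F y - F x = prob (dist_event s x y) - enn2real (dist_mass s x y)"
      using prob_dist_event_additive[of a x y s] xy by (simp add: F_def)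
    let ?d = "mean_count s y - mean_count s x"
    have d: "0 \<le> ?d" using monoD[OF mean_count_mono] x by simp
    have "void_prob s y * ?d \<le> enn2real (dist_mass s x y)"
      using dist_mass_bounds(1)[OF x, of s] fin[OF x] by (metis enn2real_nonneg ennreal_le_iff)
    moreover have "enn2real (dist_mass s x y) \<le> void_prob s x * ?d"
      using dist_mass_bounds(2)[OF x, of s] fin[OF x] d void_prob_pos[of s x]
      by (metis ennreal_le_iff less_imp_le mult_nonneg_nonneg)
    ultimately have "\<bar>F y - F x\<bar> \<le> ?d * (void_prob s x - void_prob s y)"
      unfolding F using prob_dist_event_bounds[OF x, of s] by (simp add: algebra_simps)
    also have "\<dots> \<le> 2 * pi * b * intensity V * (y - x) * (void_prob s x - void_prob s y)"
    proof (rule mult_right_mono)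
      have "?d \<le> 2 * pi * y * intensity V * (y - x)" using x by (intro mean_count_lipschitz) auto
      also have "\<dots> \<le> 2 * pi * b * intensity V * (y - x)"
        using x xy intensity_pos by (intro mult_right_mono mult_left_mono) auto
      finally show "?d \<le> 2 * pi * b * intensity V * (y - x)" .
    qed (use void_prob_antimono[of x y s] x in simp)
    finally show "\<bar>F y - F x\<bar> \<le> 2 * pi * b * intensity V * (y - x) * (void_prob s x - void_prob s y)" .
  qed
  moreover have "dist_event s a a = {}"
    by (auto simp: dist_event_def)
  then have "F a = 0"
    by (simp add: F_def dist_mass_def)
  ultimately show ?thesis
    using fin[OF a ab] by (simp add: F_def)
qed

text \<open>Half-lines determine the law, but \<open>prob_dist_event\<close> covers only bounded
  intervals with positive left end point. Such intervals exhaust \<open>{max x 0<..}\<close>, and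
  neither side charges nonpositive distances.\<close>

lemma serving_dist_law:
  "distr (density M (indicator {\<omega>\<in>space M. serving_link V X S \<omega> = s})) borel (serving_dist V X S) =
   density lborel (\<lambda>r. ennreal (dist_density s r))" (is "?Q = ?D")
proof (rule measure_eqI_lessThan)
  let ?L = "{\<omega>\<in>space M. serving_link V X S \<omega> = s}"
  have Q: "emeasure ?Q B = emeasure M {\<omega>\<in>space M. serving_link V X S \<omega> = s \<and> serving_dist V X S \<omega> \<in> B}"
    if [measurable]: "B \<in> sets borel" for B
  proof -
    have "emeasure ?Q B = (\<integral>\<^sup>+\<omega>. indicator ?L \<omega> * indicator (serving_dist V X S -` B \<inter> space M) \<omega> \<partial>M)"
      by (subst emeasure_distr, simp, simp, subst emeasure_density) auto
    also have "\<dots> = (\<integral>\<^sup>+\<omega>. indicator {\<omega>\<in>space M. serving_link V X S \<omega> = s \<and> serving_dist V X S \<omega> \<in> B} \<omega> \<partial>M)"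
      by (intro nn_integral_cong) (auto split: split_indicator)
    also have "\<dots> = emeasure M {\<omega>\<in>space M. serving_link V X S \<omega> = s \<and> serving_dist V X S \<omega> \<in> B}"
      by (rule nn_integral_indicator) measurable
    finally show ?thesis .
  qed
  show "emeasure ?Q {x<..} < \<infinity>" for x
    by (subst Q) (auto simp: emeasure_eq_measure)
  fix x :: real
  define l where "l n = max x (1 / real (Suc n))" for n
  have l: "0 < l n" "l (Suc n) \<le> l n" for n
  proof -
    show "0 < l n" by (simp add: l_def less_max_iff_disj)
    have "1 / real (Suc (Suc n)) \<le> 1 / real (Suc n)" by (intro divide_left_mono) auto
    then show "l (Suc n) \<le> l n" unfolding l_def by (intro max.mono order.refl)
  qed
  then have l_mono: "decseq l" by (simp add: decseq_Suc_iff)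
  define I where "I n = {l n<..real n}" for n
  have I_inc: "incseq I"
  proof (rule incseq_SucI)
    fix n
    show "I n \<subseteq> I (Suc n)" using l(2)[of n] by (auto simp: I_def)
  qed
  have I_UN: "(\<Union>n. I n) = {max x 0<..}"
  proof (intro equalityI subsetI)
    fix y assume "y \<in> {max x 0<..}"
    then have y: "x < y" "0 < y" by auto
    obtain n1 where n1: "inverse (real (Suc n1)) < y" using reals_Archimedean[OF y(2)] by blast
    obtain n2 where n2: "y \<le> real n2" using real_arch_simple by blast
    have "y \<in> I (max n1 n2)"
    proof -
      have "1 / real (Suc (max n1 n2)) \<le> 1 / real (Suc n1)" by (intro divide_left_mono) auto
      then show ?thesis using n1 n2 y by (auto simp: I_def l_def inverse_eq_divide)
    qed
    then show "y \<in> (\<Union>n. I n)" by blast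
  next
    fix y assume "y \<in> (\<Union>n. I n)"
    then obtain n where "l n < y" by (auto simp: I_def)
    moreover have "0 < l n" "x \<le> l n" using l(1) by (auto simp: l_def)
    ultimately show "y \<in> {max x 0<..}" by auto
  qed
  have eq: "emeasure ?Q (I n) = emeasure ?D (I n)" for n
  proof (cases "l n \<le> real n")
    case True
    have "emeasure ?Q (I n) = ennreal (prob (dist_event s (l n) (real n)))"
      by (subst Q) (auto simp: I_def dist_event_def emeasure_eq_measure intro!: arg_cong[where f = prob])
    also have "\<dots> = emeasure ?D (I n)"
      unfolding prob_dist_event[OF l(1) True] dist_mass_def I_def
      by (subst emeasure_density) auto
    finally show ?thesis .
  qed (simp add: I_def)
  have "emeasure ?Q {x<..} = emeasure ?Q {max x 0<..}"
    unfolding Q[OF borel_open[OF open_greaterThan]]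
    using AE_regular_point
    by (intro emeasure_eq_AE) (auto simp: regular_point_def serving_dist_def elim!: eventually_mono)
  also have "\<dots> = emeasure ?D {max x 0<..}"
    unfolding I_UN[symmetric]
    using SUP_emeasure_incseq[OF _ I_inc, of ?Q] SUP_emeasure_incseq[OF _ I_inc, of ?D] eq
    by (simp add: I_def image_subset_iff)
  also have "\<dots> = emeasure ?D {x<..}"
    by (simp add: emeasure_density)
       (auto intro!: nn_integral_cong simp: indicator_def dist_density_def)
  finally show "emeasure ?Q {x<..} = emeasure ?D {x<..}" .
qed simp_all

lemma nn_integral_serving_dist:
  assumes [measurable]: "\<phi> \<in> borel_measurable borel"
  shows "(\<integral>\<^sup>+\<omega>\<in>{\<omega>\<in>space M. serving_link V X S \<omega> = s}. \<phi> (serving_dist V X S \<omega>) \<partial>M) =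
    (\<integral>\<^sup>+r. ennreal (dist_density s r) * \<phi> r \<partial>lborel)"
proof -
  have "(\<integral>\<^sup>+\<omega>\<in>{\<omega>\<in>space M. serving_link V X S \<omega> = s}. \<phi> (serving_dist V X S \<omega>) \<partial>M) =
      (\<integral>\<^sup>+r. \<phi> r \<partial>distr (density M (indicator {\<omega>\<in>space M. serving_link V X S \<omega> = s})) borel (serving_dist V X S))"
    by (subst nn_integral_distr, simp, simp, subst nn_integral_density) (auto simp: mult.commute)
  also have "\<dots> = (\<integral>\<^sup>+r. ennreal (dist_density s r) * \<phi> r \<partial>lborel)"
    unfolding serving_dist_law by (rule nn_integral_density) auto
  finally show ?thesis .
qed

end

section \<open>Coverage\<close>

locale covered_downlink = downlink V M X S G
  for V :: network and M :: "'w measure" and X S G +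
  fixes \<kappa> :: "link \<Rightarrow> real \<Rightarrow> (real \<times> ennreal) measure" and \<gamma> :: real
  assumes cond_law: "serving_cond_law V M X S G \<kappa>" and threshold_pos: "0 < \<gamma>"
begin

lemma measurable_cond_law: "\<kappa> s \<in> borel \<rightarrow>\<^sub>M prob_algebra (borel \<Otimes>\<^sub>M borel)"
  using cond_law by (simp add: serving_cond_law_def regular_cond_law_def)

lemma measurable_cond_law_subprob [measurable]: "\<kappa> s \<in> borel \<rightarrow>\<^sub>M subprob_algebra (borel \<Otimes>\<^sub>M borel)"
  by (rule measurable_prob_algebraD[OF measurable_cond_law])

lemma prob_space_cond_law: "prob_space (\<kappa> s r)"
  and sets_cond_law: "sets (\<kappa> s r) = sets (borel \<Otimes>\<^sub>M borel)"
  using measurable_space[OF measurable_cond_law, of r s] by (auto simp: space_prob_algebra)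

definition served :: "link \<Rightarrow> 'w set" where
  "served s = {\<omega>\<in>space M. serving_link V X S \<omega> = s}"

lemma served_sets [measurable]: "served s \<in> sets M"
  unfolding served_def by measurable

text \<open>Two layers: the kernel averages gain and interference at a given distance, then
  \<open>dist_density\<close> averages over the distance.\<close>

lemma disintegrate:
  assumes f [measurable]: "f \<in> borel_measurable (borel \<Otimes>\<^sub>M (borel \<Otimes>\<^sub>M borel))"
  shows "(\<integral>\<^sup>+\<omega>\<in>served s. f (serving_dist V X S \<omega>, serving_gain V X S G \<omega>, interference V X S G \<omega>) \<partial>M) =
    (\<integral>\<^sup>+r. ennreal (dist_density s r) * (\<integral>\<^sup>+y. f (r, y) \<partial>\<kappa> s r) \<partial>lborel)"
proof -
  have "(\<integral>\<^sup>+\<omega>\<in>{\<omega>\<in>space M. serving_link V X S \<omega> = s}.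
        f (serving_dist V X S \<omega>, serving_gain V X S G \<omega>, interference V X S G \<omega>) \<partial>M) =
      (\<integral>\<^sup>+\<omega>\<in>{\<omega>\<in>space M. serving_link V X S \<omega> = s}.
        (\<integral>\<^sup>+y. f (serving_dist V X S \<omega>, y) \<partial>\<kappa> s (serving_dist V X S \<omega>)) \<partial>M)"
  proof (rule kernel_rectangle_extend[OF finite_measure_axioms _ _ measurable_cond_law _ _ f])
    show "serving_dist V X S \<in> borel_measurable M" by measurable
    show "(\<lambda>\<omega>. (serving_gain V X S G \<omega>, interference V X S G \<omega>)) \<in> M \<rightarrow>\<^sub>M borel \<Otimes>\<^sub>M borel" by measurable
    show "Measurable.pred M (\<lambda>\<omega>. serving_link V X S \<omega> = s)" by measurable
    show "emeasure M {\<omega>\<in>space M. serving_link V X S \<omega> = s \<and> serving_dist V X S \<omega> \<in> B \<and>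
          (serving_gain V X S G \<omega>, interference V X S G \<omega>) \<in> C} =
        (\<integral>\<^sup>+\<omega>\<in>{\<omega>\<in>space M. serving_link V X S \<omega> = s \<and> serving_dist V X S \<omega> \<in> B}.
          emeasure (\<kappa> s (serving_dist V X S \<omega>)) C \<partial>M)"
      if "B \<in> sets borel" "C \<in> sets (borel \<Otimes>\<^sub>M borel)" for B C
      using cond_law that by (simp add: serving_cond_law_def regular_cond_law_def)
  qed
  also have "\<dots> = (\<integral>\<^sup>+r. ennreal (dist_density s r) * (\<integral>\<^sup>+y. f (r, y) \<partial>\<kappa> s r) \<partial>lborel)"
    by (rule nn_integral_serving_dist)
       (rule nn_integral_measurable_subprob_algebra2[of "\<lambda>r y. f (r, y)"], measurable)
  finally show ?thesis unfolding served_def .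
qed

text \<open>Phrased with \<open>zeta\<close> instead of \<open>zeta_piece\<close>, so that coverage
  can be handled on the whole line before it is cut into pieces.\<close>

definition above :: "link \<Rightarrow> real \<Rightarrow> real \<Rightarrow> ennreal \<Rightarrow> bool" where
  "above s r h y \<longleftrightarrow> ennreal \<gamma> < ennreal (tx_power V * zeta V s r * h) / y"

lemma measurable_above [measurable]:
  assumes [measurable]: "f \<in> borel_measurable N" "g \<in> borel_measurable N" "k \<in> borel_measurable N"
  shows "Measurable.pred N (\<lambda>x. above s (f x) (g x) (k x))"
  unfolding above_def by measurable

definition cover :: "link \<Rightarrow> real \<Rightarrow> ennreal" where
  "cover s r = emeasure (\<kappa> s r) {(h, y). above s r h y}"

definition tail :: "link \<Rightarrow> real \<Rightarrow> ennreal \<Rightarrow> ennreal" where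
  "tail s r y = emeasure (rician (rician_factor s r)) {h. above s r h y}"

text \<open>The value \<open>cover\<close> would have if, under \<open>\<kappa> s r\<close>, the
  gain were Rician and independent of the interference. Only the interference marginal of
  \<open>\<kappa> s r\<close> enters.\<close>

definition rician_cover :: "link \<Rightarrow> real \<Rightarrow> ennreal" where
  "rician_cover s r = (\<integral>\<^sup>+p. tail s r (snd p) \<partial>\<kappa> s r)"

lemma measurable_cover [measurable]: "cover s \<in> borel_measurable borel"
proof -
  have "{(r, h, y). above s r h y} = {p\<in>space (borel \<Otimes>\<^sub>M (borel \<Otimes>\<^sub>M borel)). above s (fst p) (fst (snd p)) (snd (snd p))}"
    by (auto simp: space_pair_measure)
  also have "\<dots> \<in> sets (borel \<Otimes>\<^sub>M (borel \<Otimes>\<^sub>M borel))" by measurable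
  finally have "(SIGMA r:space borel. {(h, y). above s r h y}) \<in> sets (borel \<Otimes>\<^sub>M (borel \<Otimes>\<^sub>M borel))"
    by (rule back_subst[of "\<lambda>A. A \<in> _"]) auto
  then show ?thesis
    unfolding cover_def [abs_def] by (rule emeasure_measurable_subprob_algebra2) measurable
qed

lemma measurable_tail [measurable]:
  assumes [measurable]: "f \<in> borel_measurable N" "k \<in> borel_measurable N"
  shows "(\<lambda>x. tail s (f x) (k x)) \<in> borel_measurable N"
proof -
  have "{p\<in>space (N \<Otimes>\<^sub>M borel). above s (f (fst p)) (snd p) (k (fst p))} \<in> sets (N \<Otimes>\<^sub>M borel)" by measurable
  then have "(SIGMA x:space N. {h. above s (f x) h (k x)}) \<in> sets (N \<Otimes>\<^sub>M borel)"
    by (rule back_subst[of "\<lambda>A. A \<in> _"]) (auto simp: space_pair_measure)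
  moreover have "(\<lambda>x. rician (rician_factor s (f x))) \<in> N \<rightarrow>\<^sub>M subprob_algebra borel"
    by (intro measurable_prob_algebraD measurable_rician) auto
  ultimately show ?thesis
    unfolding tail_def by (rule emeasure_measurable_subprob_algebra2)
qed

lemma measurable_rician_cover [measurable]: "rician_cover s \<in> borel_measurable borel"
  unfolding rician_cover_def [abs_def]
  by (rule nn_integral_measurable_subprob_algebra2[of "\<lambda>r p. tail s r (snd p)"]) measurable

lemma SINR_above_iff:
  "\<omega> \<in> served s \<Longrightarrow> ennreal \<gamma> < SINR V X S G \<omega> \<longleftrightarrow>
     above s (serving_dist V X S \<omega>) (serving_gain V X S G \<omega>) (interference V X S G \<omega>)"
  by (auto simp: served_def SINR_def above_def link_loss_def serving_link_def serving_dist_def)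

lemma covered_sets [measurable]: "{\<omega>\<in>space M. ennreal \<gamma> < SINR V X S G \<omega>} \<in> sets M"
proof -
  have "{\<omega>\<in>space M. ennreal \<gamma> < SINR V X S G \<omega>} = {\<omega>\<in>space M. \<exists>s\<in>UNIV. serving_link V X S \<omega> = s \<and>
     above s (serving_dist V X S \<omega>) (serving_gain V X S G \<omega>) (interference V X S G \<omega>)}"
    using SINR_above_iff by (auto simp: served_def)
  also have "\<dots> \<in> sets M" by measurable
  finally show ?thesis .
qed

text \<open>One of two evaluations of the same probability. The set \<open>B\<close> of distances
  stays arbitrary so that comparison with \<open>covered_integral_rician\<close> identifies the
  integrands.\<close>

lemma covered_integral:
  assumes [measurable]: "B \<in> sets borel"
  shows "(\<integral>\<^sup>+\<omega>\<in>served s. indicator B (serving_dist V X S \<omega>) *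
      indicator {\<omega>\<in>space M. ennreal \<gamma> < SINR V X S G \<omega>} \<omega> \<partial>M) =
    (\<integral>\<^sup>+r. ennreal (dist_density s r) * cover s r * indicator B r \<partial>lborel)"
proof -
  define f where "f p = indicator B (fst p) *
    (indicator {p. above s (fst p) (fst (snd p)) (snd (snd p))} p :: ennreal)" for p
  have f: "f \<in> borel_measurable (borel \<Otimes>\<^sub>M (borel \<Otimes>\<^sub>M borel))"
  proof -
    have "{p\<in>space (borel \<Otimes>\<^sub>M (borel \<Otimes>\<^sub>M borel)). above s (fst p) (fst (snd p)) (snd (snd p))} \<in> sets (borel \<Otimes>\<^sub>M (borel \<Otimes>\<^sub>M borel))"
      by measurable
    then have [measurable]: "{p. above s (fst p) (fst (snd p)) (snd (snd p))} \<in> sets (borel \<Otimes>\<^sub>M (borel \<Otimes>\<^sub>M borel))"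
      by (simp add: space_pair_measure)
    show ?thesis unfolding f_def by measurable
  qed
  have "(\<integral>\<^sup>+\<omega>\<in>served s. indicator B (serving_dist V X S \<omega>) *
      indicator {\<omega>\<in>space M. ennreal \<gamma> < SINR V X S G \<omega>} \<omega> \<partial>M) =
    (\<integral>\<^sup>+\<omega>\<in>served s. f (serving_dist V X S \<omega>, serving_gain V X S G \<omega>, interference V X S G \<omega>) \<partial>M)"
    using SINR_above_iff by (intro nn_integral_cong) (auto simp: f_def split: split_indicator)
  also have "\<dots> = (\<integral>\<^sup>+r. ennreal (dist_density s r) * (\<integral>\<^sup>+y. f (r, y) \<partial>\<kappa> s r) \<partial>lborel)"
    using f by (rule disintegrate)
  also have "\<dots> = (\<integral>\<^sup>+r. ennreal (dist_density s r) * cover s r * indicator B r \<partial>lborel)"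
  proof (intro nn_integral_cong)
    fix r
    have "{p\<in>space (borel \<Otimes>\<^sub>M borel). above s r (fst p) (snd p)} \<in> sets (borel \<Otimes>\<^sub>M borel)" by measurable
    then have "{(h, y). above s r h y} \<in> sets (\<kappa> s r)"
      unfolding sets_cond_law by (rule back_subst[of "\<lambda>A. A \<in> _"]) (auto simp: space_pair_measure)
    then have "(\<integral>\<^sup>+y. indicator B r * indicator {(h, y). above s r h y} y \<partial>\<kappa> s r) = indicator B r * cover s r"
      unfolding cover_def by (rule nn_integral_cmult_indicator)
    moreover have "f (r, y) = indicator B r * indicator {(h, y). above s r h y} y" for y
      by (auto simp: f_def split: split_indicator)
    ultimately show "ennreal (dist_density s r) * (\<integral>\<^sup>+y. f (r, y) \<partial>\<kappa> s r) = ennreal (dist_density s r) * cover s r * indicator B r"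
      by (simp add: mult_ac)
  qed
  finally show ?thesis .
qed

text \<open>The interference with the serving index frozen at \<open>i\<close>. It agrees with
  \<open>interference\<close> where station \<open>i\<close> serves and, unlike
  \<open>interference\<close>, never involves the gain of station \<open>i\<close>.\<close>

definition interference_without :: "nat \<Rightarrow> 'w \<Rightarrow> ennreal" where
  "interference_without i \<omega> = (\<Sum>j. if j = i then 0 else ennreal (tx_power V * link_loss V X S j \<omega> * G j \<omega>))"

lemma measurable_interference_without [measurable]: "interference_without i \<in> borel_measurable (other_marks i)"
  unfolding interference_without_def [abs_def]
proof (intro borel_measurable_suminf_order)
  fix j
  show "(\<lambda>\<omega>. if j = i then 0 else ennreal (tx_power V * link_loss V X S j \<omega> * G j \<omega>)) \<in> borel_measurable (other_marks i)"
  proof (cases "j = i")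
    case False
    note [measurable] = measurable_other_marks_G[OF False]
    show ?thesis by measurable
  qed simp
qed

text \<open>The event is split by the value \<open>i\<close> of the serving index. On each part
  everything but the gain of station \<open>i\<close> belongs to \<open>other_marks i\<close>, so
  \<open>nn_integral_gain\<close> replaces that gain by a Rician tail; the parts are then summed up
  again.\<close>

lemma covered_integral_rician:
  assumes [measurable]: "B \<in> sets borel"
  shows "(\<integral>\<^sup>+\<omega>\<in>served s. indicator B (serving_dist V X S \<omega>) *
      indicator {\<omega>\<in>space M. ennreal \<gamma> < SINR V X S G \<omega>} \<omega> \<partial>M) =
    (\<integral>\<^sup>+r. ennreal (dist_density s r) * rician_cover s r * indicator B r \<partial>lborel)"
proof -
  let ?C = "{\<omega>\<in>space M. ennreal \<gamma> < SINR V X S G \<omega>}"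
  define Q where "Q i \<omega> \<longleftrightarrow> serving V X S \<omega> = i \<and> S i \<omega> = s \<and> norm (X i \<omega>) \<in> B" for i \<omega>
  \<comment> \<open>Where station \<open>i\<close> serves, its gain enters only through the second
    component, because \<open>interference_without i\<close> omits it.\<close>
  define f where "f i p = (if Q i (fst p) \<and> above s (norm (X i (fst p))) (snd p) (interference_without i (fst p)) then 1 else 0 :: ennreal)"
    for i and p :: "'w \<times> real"
  have serv [measurable]: "serving V X S \<in> other_marks i \<rightarrow>\<^sub>M count_space UNIV" for i
    by (rule measurable_serving) measurable
  have Q [measurable]: "Measurable.pred (other_marks i) (Q i)" for i
    unfolding Q_def by measurable
  have f: "f i \<in> borel_measurable (other_marks i \<Otimes>\<^sub>M borel)" for i
    unfolding f_def by measurable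
  have part: "(\<Sum>i. of_bool (serving V X S \<omega> = i) * g i) = g (serving V X S \<omega>)" for \<omega> and g :: "nat \<Rightarrow> ennreal"
  proof -
    have "(\<Sum>i. of_bool (serving V X S \<omega> = i) * g i) = (\<Sum>i\<in>{serving V X S \<omega>}. of_bool (serving V X S \<omega> = i) * g i)"
      by (rule suminf_finite) auto
    then show ?thesis by simp
  qed
  have tail_eq: "(\<integral>\<^sup>+h. f i (\<omega>, h) \<partial>gain_law i \<omega>) = of_bool (Q i \<omega>) * tail s (norm (X i \<omega>)) (interference_without i \<omega>)"
    if "\<omega> \<in> space M" for i \<omega>
  proof (cases "Q i \<omega>")
    case True
    have "{h\<in>space borel. above s (norm (X i \<omega>)) h (interference_without i \<omega>)} \<in> sets borel" by measurable
    then have m: "{h. above s (norm (X i \<omega>)) h (interference_without i \<omega>)} \<in> sets (gain_law i \<omega>)"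
      by (simp add: gain_law_def)
    have "(\<integral>\<^sup>+h. f i (\<omega>, h) \<partial>gain_law i \<omega>) =
        (\<integral>\<^sup>+h. indicator {h. above s (norm (X i \<omega>)) h (interference_without i \<omega>)} h \<partial>gain_law i \<omega>)"
      using True by (intro nn_integral_cong) (auto simp: f_def indicator_def)
    also have "\<dots> = tail s (norm (X i \<omega>)) (interference_without i \<omega>)"
      using m True by (simp add: tail_def gain_law_def Q_def)
    finally show ?thesis using True by simp
  qed (simp add: f_def)
  have "(\<integral>\<^sup>+\<omega>\<in>served s. indicator B (serving_dist V X S \<omega>) * indicator ?C \<omega> \<partial>M) =
      (\<integral>\<^sup>+\<omega>. (\<Sum>i. f i (\<omega>, G i \<omega>)) \<partial>M)"
  proof (intro nn_integral_cong)
    fix \<omega> assume \<omega>: "\<omega> \<in> space M"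
    have "(\<Sum>i. f i (\<omega>, G i \<omega>)) = (\<Sum>i. of_bool (serving V X S \<omega> = i) * f i (\<omega>, G i \<omega>))"
      by (intro suminf_cong) (auto simp: f_def Q_def)
    also have "\<dots> = f (serving V X S \<omega>) (\<omega>, serving_gain V X S G \<omega>)"
      unfolding part by (simp add: serving_gain_def)
    also have "\<dots> = indicator B (serving_dist V X S \<omega>) * indicator ?C \<omega> * indicator (served s) \<omega>"
      using \<omega> SINR_above_iff[of \<omega> s]
      by (auto simp: f_def Q_def served_def serving_dist_def serving_link_def interference_without_def
          interference_def indicator_def)
    finally show "indicator B (serving_dist V X S \<omega>) * indicator ?C \<omega> * indicator (served s) \<omega> =
        (\<Sum>i. f i (\<omega>, G i \<omega>))" ..
  qed
  also have "\<dots> = (\<Sum>i. \<integral>\<^sup>+\<omega>. f i (\<omega>, G i \<omega>) \<partial>M)"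
  proof (rule nn_integral_suminf)
    fix i
    have "(\<lambda>\<omega>. (\<omega>, G i \<omega>)) \<in> M \<rightarrow>\<^sub>M other_marks i \<Otimes>\<^sub>M borel"
      using subalgebra_other_marks[of i]
      by (intro measurable_Pair measurable_G) (auto simp: subalgebra_def intro!: measurableI)
    from measurable_compose[OF this f] show "(\<lambda>\<omega>. f i (\<omega>, G i \<omega>)) \<in> borel_measurable M" .
  qed
  also have "\<dots> = (\<Sum>i. \<integral>\<^sup>+\<omega>. of_bool (Q i \<omega>) * tail s (norm (X i \<omega>)) (interference_without i \<omega>) \<partial>M)"
    unfolding nn_integral_gain[OF f] by (intro suminf_cong nn_integral_cong) (simp add: tail_eq)
  also have "\<dots> = (\<integral>\<^sup>+\<omega>. (\<Sum>i. of_bool (Q i \<omega>) * tail s (norm (X i \<omega>)) (interference_without i \<omega>)) \<partial>M)"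
  proof (rule nn_integral_suminf[symmetric])
    fix i
    have "(\<lambda>\<omega>. of_bool (Q i \<omega>) * tail s (norm (X i \<omega>)) (interference_without i \<omega>)) \<in> borel_measurable (other_marks i)"
      unfolding of_bool_def by measurable
    then show "(\<lambda>\<omega>. of_bool (Q i \<omega>) * tail s (norm (X i \<omega>)) (interference_without i \<omega>)) \<in> borel_measurable M"
      by (rule measurable_from_subalg[OF subalgebra_other_marks])
  qed
  \<comment> \<open>After averaging, the integrand depends on the serving distance and the
    interference alone, so the sum over \<open>i\<close> is a function of the serving quantities and
    \<open>disintegrate\<close> applies a second time.\<close>
  also have "\<dots> = (\<integral>\<^sup>+\<omega>\<in>served s. (\<lambda>(r, p). indicator B r * tail s r (snd p))
      (serving_dist V X S \<omega>, serving_gain V X S G \<omega>, interference V X S G \<omega>) \<partial>M)"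
  proof (intro nn_integral_cong)
    fix \<omega> assume \<omega>: "\<omega> \<in> space M"
    have "(\<Sum>i. of_bool (Q i \<omega>) * tail s (norm (X i \<omega>)) (interference_without i \<omega>)) =
        (\<Sum>i. of_bool (serving V X S \<omega> = i) * (of_bool (S i \<omega> = s \<and> norm (X i \<omega>) \<in> B) * tail s (norm (X i \<omega>)) (interference_without i \<omega>)))"
      by (intro suminf_cong) (auto simp: Q_def)
    also have "\<dots> = (\<lambda>(r, p). indicator B r * tail s r (snd p))
      (serving_dist V X S \<omega>, serving_gain V X S G \<omega>, interference V X S G \<omega>) * indicator (served s) \<omega>"
      unfolding part using \<omega>
      by (auto simp: served_def serving_dist_def serving_link_def interference_without_def interference_def indicator_def)
    finally show "(\<Sum>i. of_bool (Q i \<omega>) * tail s (norm (X i \<omega>)) (interference_without i \<omega>)) = \<dots>" .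
  qed
  also have "\<dots> = (\<integral>\<^sup>+r. ennreal (dist_density s r) * (\<integral>\<^sup>+p. (\<lambda>(r, p). indicator B r * tail s r (snd p)) (r, p) \<partial>\<kappa> s r) \<partial>lborel)"
    by (rule disintegrate) measurable
  also have "\<dots> = (\<integral>\<^sup>+r. ennreal (dist_density s r) * rician_cover s r * indicator B r \<partial>lborel)"
  proof (intro nn_integral_cong)
    fix r
    have "(\<lambda>p. tail s r (snd p)) \<in> borel_measurable (\<kappa> s r)"
      by (subst measurable_cong_sets[OF sets_cond_law refl]) measurable
    then show "ennreal (dist_density s r) * (\<integral>\<^sup>+p. (\<lambda>(r, p). indicator B r * tail s r (snd p)) (r, p) \<partial>\<kappa> s r) =
        ennreal (dist_density s r) * rician_cover s r * indicator B r"
      by (simp add: nn_integral_cmult rician_cover_def mult_ac)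
  qed
  finally show ?thesis .
qed

text \<open>Equal integrals over all Borel sets of distances force equal integrands almost
  everywhere, and the density cancels where it is positive. Where it vanishes, the conditional law
  is arbitrary.\<close>

lemma AE_cover_eq: "AE r in lborel. 0 < dist_density s r \<longrightarrow> cover s r = rician_cover s r"
proof -
  have "AE r in lborel. ennreal (dist_density s r) * cover s r = ennreal (dist_density s r) * rician_cover s r"
  proof (rule sigma_finite_measure.density_unique2[OF lborel.sigma_finite_measure_axioms])
    fix B assume "B \<in> sets (lborel :: real measure)"
    then show "(\<integral>\<^sup>+r\<in>B. ennreal (dist_density s r) * cover s r \<partial>lborel) =
        (\<integral>\<^sup>+r\<in>B. ennreal (dist_density s r) * rician_cover s r \<partial>lborel)"
      using covered_integral[of B s] covered_integral_rician[of B s] by simp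
  qed measurable
  then show ?thesis
    by eventually_elim (auto simp: ennreal_mult_cancel_left)
qed

lemma cond_coverage_eq:
  assumes "n \<in> {1..pieces V}" "on_piece V n r"
  shows "cond_coverage V \<kappa> \<gamma> s n r = enn2real (cover s r)"
  using piecewise_on_piece[OF assms, of "zeta_piece V s"]
  by (simp add: cond_coverage_def cover_def above_def measure_def zeta_def)

text \<open>At almost every distance of positive density the coverage is a Rician tail averaged over
  the interference; \<open>rician_coverage_sums\<close> then applies with \<open>c\<close> the
  received power at unit gain.\<close>

lemma coverage_series:
  assumes n: "n \<in> {1..pieces V}"
  shows "AE r in lborel. on_piece V n r \<and> 0 < serving_density V s n r \<longrightarrow>
      (\<lambda>k. \<Sum>m=0..k. J (rician_factor s r) m k * \<gamma> ^ (k - m) * (- 1) ^ (k - m) *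
           (deriv ^^ (k - m))
             (\<lambda>t. laplace_interference (\<kappa> s r) (t / (tx_power V * zeta_piece V s n r))) \<gamma>)
      sums cond_coverage V \<kappa> \<gamma> s n r"
  using AE_cover_eq[of s]
proof eventually_elim
  case (elim r)
  show ?case
  proof (intro impI, elim conjE)
    assume r: "on_piece V n r" and "0 < serving_density V s n r"
    then have "cover s r = rician_cover s r"
      using elim serving_density_eq[OF n r] by simp
    moreover have "zeta V s r = zeta_piece V s n r"
      unfolding zeta_def using n r by (rule piecewise_on_piece)
    ultimately have "cond_coverage V \<kappa> \<gamma> s n r = enn2real (\<integral>\<^sup>+p. emeasure (rician (rician_factor s r))
        {h. ennreal \<gamma> < ennreal (tx_power V * zeta_piece V s n r * h) / snd p} \<partial>\<kappa> s r)"
      unfolding cond_coverage_eq[OF n r] by (simp add: rician_cover_def tail_def above_def)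
    moreover have "0 < tx_power V * zeta_piece V s n r"
      using tx_power_pos zeta_piece_pos[OF n on_piece_pos[OF n r]] by simp
    ultimately show "(\<lambda>k. \<Sum>m=0..k. J (rician_factor s r) m k * \<gamma> ^ (k - m) * (- 1) ^ (k - m) *
           (deriv ^^ (k - m))
             (\<lambda>t. laplace_interference (\<kappa> s r) (t / (tx_power V * zeta_piece V s n r))) \<gamma>)
      sums cond_coverage V \<kappa> \<gamma> s n r"
      using rician_coverage_sums[OF prob_space_cond_law sets_cond_law rician_factor_nonneg _ threshold_pos]
      by simp
  qed
qed

text \<open>For a nonnegative measurable function the Bochner integral is \<open>enn2real\<close> of
  the nonnegative integral, whether or not the latter is finite. Finiteness is supplied in
  \<open>coverage_sum\<close>.\<close>

lemma coverage_piece: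
  assumes n: "n \<in> {1..pieces V}"
  shows "(LBINT r=breakpoint V (n - 1)..breakpoint V n. cond_coverage V \<kappa> \<gamma> s n r * serving_density V s n r) =
    enn2real (\<integral>\<^sup>+r. ennreal (dist_density s r) * cover s r * indicator {r. on_piece V n r} r \<partial>lborel)"
proof -
  have cover_le: "cover s r \<le> 1" for r
    unfolding cover_def by (rule prob_space.emeasure_le_1[OF prob_space_cond_law])
  have [measurable]: "{r. on_piece V n r} \<in> sets borel"
    using measurable_on_piece[of n] by (simp add: pred_def)
  have "breakpoint V (n - 1) \<le> breakpoint V n" using n by (intro breakpoint_mono) auto
  then have "(LBINT r=breakpoint V (n - 1)..breakpoint V n. cond_coverage V \<kappa> \<gamma> s n r * serving_density V s n r) =
      (LBINT r:{r. on_piece V n r}. cond_coverage V \<kappa> \<gamma> s n r * serving_density V s n r)"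
    unfolding on_piece_def by (rule interval_integral_Ioc')
  also have "\<dots> = (\<integral>r. dist_density s r * enn2real (cover s r) * indicator {r. on_piece V n r} r \<partial>lborel)"
    unfolding set_lebesgue_integral_def
    by (intro Bochner_Integration.integral_cong refl)
       (auto simp: indicator_def serving_density_eq[OF n] cond_coverage_eq[OF n])
  also have "\<dots> = enn2real (\<integral>\<^sup>+r. ennreal (dist_density s r * enn2real (cover s r) * indicator {r. on_piece V n r} r) \<partial>lborel)"
    using dist_density_nonneg by (intro integral_eq_nn_integral) auto
  also have "(\<integral>\<^sup>+r. ennreal (dist_density s r * enn2real (cover s r) * indicator {r. on_piece V n r} r) \<partial>lborel) =
      (\<integral>\<^sup>+r. ennreal (dist_density s r) * cover s r * indicator {r. on_piece V n r} r \<partial>lborel)"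
  proof (intro nn_integral_cong)
    fix r
    have "ennreal (enn2real (cover s r)) = cover s r"
      using cover_le[of r] by (intro ennreal_enn2real) (auto intro: le_less_trans)
    then show "ennreal (dist_density s r * enn2real (cover s r) * indicator {r. on_piece V n r} r) =
        ennreal (dist_density s r) * cover s r * indicator {r. on_piece V n r} r"
      using dist_density_nonneg[of s r] by (auto simp: indicator_def ennreal_mult)
  qed
  finally show ?thesis .
qed

lemma coverage_sum:
  "coverage V M X S G \<gamma> = (\<Sum>n=1..pieces V. \<Sum>s\<in>UNIV.
     (LBINT r=breakpoint V (n - 1)..breakpoint V n. cond_coverage V \<kappa> \<gamma> s n r * serving_density V s n r))"
proof -
  let ?C = "{\<omega>\<in>space M. ennreal \<gamma> < SINR V X S G \<omega>}"
  let ?I = "\<lambda>n s. \<integral>\<^sup>+r. ennreal (dist_density s r) * cover s r * indicator {r. on_piece V n r} r \<partial>lborel"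
  have [measurable]: "{r. on_piece V n r} \<in> sets borel" for n
    using measurable_on_piece[of n] by (simp add: pred_def)
  have "emeasure M ?C = (\<integral>\<^sup>+\<omega>. indicator ?C \<omega> \<partial>M)"
    by (rule nn_integral_indicator[symmetric]) measurable
  also have "\<dots> = (\<integral>\<^sup>+\<omega>. (\<Sum>s\<in>UNIV. indicator UNIV (serving_dist V X S \<omega>) * indicator ?C \<omega> * indicator (served s) \<omega>) \<partial>M)"
  proof (intro nn_integral_cong)
    fix \<omega> assume "\<omega> \<in> space M"
    then show "(indicator ?C \<omega> :: ennreal) = (\<Sum>s\<in>UNIV. indicator UNIV (serving_dist V X S \<omega>) * indicator ?C \<omega> * indicator (served s) \<omega>)"
      by (cases "serving_link V X S \<omega>") (simp_all add: UNIV_link served_def indicator_def)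
  qed
  also have "\<dots> = (\<Sum>s\<in>UNIV. \<integral>\<^sup>+\<omega>\<in>served s. indicator UNIV (serving_dist V X S \<omega>) * indicator ?C \<omega> \<partial>M)"
    by (rule nn_integral_sum) measurable
  also have "\<dots> = (\<Sum>s\<in>UNIV. \<integral>\<^sup>+r. ennreal (dist_density s r) * cover s r \<partial>lborel)"
    by (simp only: covered_integral[OF sets.top[of borel, unfolded space_borel]]) simp
  also have "\<dots> = (\<Sum>s\<in>UNIV. \<Sum>n=1..pieces V. ?I n s)"
  proof (intro sum.cong refl)
    fix s
    have "(\<integral>\<^sup>+r. ennreal (dist_density s r) * cover s r \<partial>lborel) =
        (\<integral>\<^sup>+r. (\<Sum>n=1..pieces V. ennreal (dist_density s r) * cover s r * indicator {r. on_piece V n r} r) \<partial>lborel)"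
    proof (intro nn_integral_cong)
      fix r
      show "ennreal (dist_density s r) * cover s r =
          (\<Sum>n=1..pieces V. ennreal (dist_density s r) * cover s r * indicator {r. on_piece V n r} r)"
      \<comment> \<open>Positive distances lie on exactly one piece; the others lie on none, but
        there the density is 0.\<close>
      proof (cases "0 < r")
        case True
        then obtain m where m: "m \<in> {1..pieces V}" "on_piece V m r" using on_piece_exists by blast
        have "(\<Sum>n=1..pieces V. ennreal (dist_density s r) * cover s r * indicator {r. on_piece V n r} r) =
            (\<Sum>n\<in>{m}. ennreal (dist_density s r) * cover s r * indicator {r. on_piece V n r} r)"
        proof (rule sum.mono_neutral_right)
          show "{m} \<subseteq> {1..pieces V}" using m by simp
          show "\<forall>n\<in>{1..pieces V} - {m}. ennreal (dist_density s r) * cover s r * indicator {r. on_piece V n r} r = 0"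
            using on_piece_unique m by (metis (no_types, lifting) DiffE indicator_simps(2) insertI1 mem_Collect_eq mult_zero_right)
        qed simp
        then show ?thesis using m by simp
      next
        case False
        then show ?thesis by (simp add: dist_density_def)
      qed
    qed
    also have "\<dots> = (\<Sum>n=1..pieces V. ?I n s)" by (rule nn_integral_sum) measurable
    finally show "(\<integral>\<^sup>+r. ennreal (dist_density s r) * cover s r \<partial>lborel) = (\<Sum>n=1..pieces V. ?I n s)" .
  qed
  also have "\<dots> = (\<Sum>n=1..pieces V. \<Sum>s\<in>UNIV. ?I n s)" by (rule sum.swap)
  finally have eq: "emeasure M ?C = (\<Sum>n=1..pieces V. \<Sum>s\<in>UNIV. ?I n s)" .
  \<comment> \<open>Each summand is at most the total, which is a probability; otherwise
    \<open>enn2real\<close> could turn an infinite summand into 0.\<close>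
  have fin: "?I n s < \<top>" if "n \<in> {1..pieces V}" for n s
  proof -
    have "?I n s \<le> (\<Sum>s\<in>UNIV. ?I n s)" by (rule member_le_sum) auto
    also have "\<dots> \<le> (\<Sum>n=1..pieces V. \<Sum>s\<in>UNIV. ?I n s)"
      by (rule member_le_sum[where f = "\<lambda>n. \<Sum>s\<in>UNIV. ?I n s"]) (use that in auto)
    also have "\<dots> < \<top>" unfolding eq[symmetric] by (simp add: emeasure_eq_measure)
    finally show ?thesis .
  qed
  have "ennreal (coverage V M X S G \<gamma>) = (\<Sum>n=1..pieces V. \<Sum>s\<in>UNIV. ?I n s)"
    unfolding eq[symmetric] by (simp add: coverage_def emeasure_eq_measure)
  also have "\<dots> = (\<Sum>n=1..pieces V. \<Sum>s\<in>UNIV. ennreal (enn2real (?I n s)))"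
    using fin by (intro sum.cong refl) simp
  also have "\<dots> = ennreal (\<Sum>n=1..pieces V. \<Sum>s\<in>UNIV. enn2real (?I n s))"
    by (simp add: sum_ennreal sum_nonneg)
  finally have "coverage V M X S G \<gamma> = (\<Sum>n=1..pieces V. \<Sum>s\<in>UNIV. enn2real (?I n s))"
    by (subst (asm) ennreal_inj) (auto simp: coverage_def intro!: sum_nonneg)
  also have "\<dots> = (\<Sum>n=1..pieces V. \<Sum>s\<in>UNIV.
     (LBINT r=breakpoint V (n - 1)..breakpoint V n. cond_coverage V \<kappa> \<gamma> s n r * serving_density V s n r))"
    by (intro sum.cong refl coverage_piece[symmetric])
  finally show ?thesis .
qed

end

theorem theorem1:
  fixes V :: network and M :: "'w measure"
    and X :: "nat \<Rightarrow> 'w \<Rightarrow> real \<times> real" and S :: "nat \<Rightarrow> 'w \<Rightarrow> link" and G :: "nat \<Rightarrow> 'w \<Rightarrow> real"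
    and \<kappa> :: "link \<Rightarrow> real \<Rightarrow> (real \<times> ennreal) measure" and \<gamma> :: real
  assumes "valid_network V"
    and "downlink_model V M X S G"
    and "serving_cond_law V M X S G \<kappa>"
    and "0 < \<gamma>"
  shows "(coverage V M X S G \<gamma> =
      (\<Sum>n=1..pieces V.
         (LBINT r=breakpoint V (n - 1)..breakpoint V n.
            cond_coverage V \<kappa> \<gamma> LOS n r * serving_density V LOS n r) +
         (LBINT r=breakpoint V (n - 1)..breakpoint V n.
            cond_coverage V \<kappa> \<gamma> NLOS n r * serving_density V NLOS n r))) \<and>
    (\<forall>s. \<forall>n\<in>{1..pieces V}. AE r in lborel.
      on_piece V n r \<and> 0 < serving_density V s n r \<longrightarrow>
      (\<lambda>k. \<Sum>m=0..k. J (rician_factor s r) m k * \<gamma> ^ (k - m) * (- 1) ^ (k - m) *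
           (deriv ^^ (k - m))
             (\<lambda>t. laplace_interference (\<kappa> s r) (t / (tx_power V * zeta_piece V s n r))) \<gamma>)
      sums cond_coverage V \<kappa> \<gamma> s n r)"
proof -
  interpret covered_downlink V M X S G \<kappa> \<gamma>
    using assms by unfold_locales
  show ?thesis
    unfolding coverage_sum using coverage_series by (simp add: UNIV_link)
qed

end
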